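(* Let $n\geq 2$ be an integer. There exists a positive constant $c=c(n)$, depending only on $n$, such that for every bounded domain $\Omega\subset\mathbb{R}^n$ that contains the origin, with $R_\Omega:=\sup_{x\in\Omega}|x|$, $$\sup_{u\in\mathcal{I}_n(\Omega)}\ \frac{1}{\mathcal{L}^n(\Omega)}\int_\Omega \exp\Big(\alpha\Big[|u(x)|\,X_2^{1/n}\big(|x|/R_\Omega\big)\Big]^{n/(n-1)}\Big)\,dx<\infty\qquad\text{for all }\alpha<c,$$ where $\mathcal{I}_n(\Omega):=\{u\in C_c^1(\Omega)\,:\, I_n[u]\leq 1\}$ and $$I_n[u]:=\int_\Omega|\nabla u|^n\,dx-\Big(\frac{n-1}{n}\Big)^n\int_\Omega\frac{|u|^n}{|x|^n}X_1^n\Big(\frac{|x|}{R_\Omega}\Big)\,dx.$$ Moreover, the exponent $1/n$ on $X_2$ cannot be decreased: for every bounded domain $\Omega\subset\mathbb{R}^n$ containing the origin, every real $\beta<1/n$ and every $\alpha>0$, $$\sup_{u\in\mathcal{I}_n(\Omega)}\ \frac{1}{\mathcal{L}^n(\Omega)}\int_\Omega \exp\Big(\alpha\Big[|u(x)|\,X_2^{\beta}\big(|x|/R_\Omega\big)\Big]^{n/(n-1)}\Big)\,dx=\infty.$$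
   Context: $\mathcal{L}^n$ denotes Lebesgue measure on $\mathbb{R}^n$ and $C_c^1(\Omega)$ the space of continuously differentiable real-valued functions with compact support in $\Omega$. The function $X_1:[0,1]\to[0,1]$ is $X_1(t):=(1-\log t)^{-1}$ for $t\in(0,1]$ and $X_1(0):=0$; the function $X_2:[0,1]\to[0,1]$ is $X_2(t):=X_1(X_1(t))$. Powers are written $X_i^{s}(t)=(X_i(t))^{s}$. *)

theory Defs
  imports "HOL-Analysis.Analysis"
begin

text \<open>Only the values on the unit interval are meaningful.\<close>

definition X1 :: "real \<Rightarrow> real" where
  "X1 t = (if t = 0 then 0 else 1 / (1 - ln t))"

definition X2 :: "real \<Rightarrow> real" where
  "X2 t = X1 (X1 t)"

definition outer_radius :: "'a::real_normed_vector set \<Rightarrow> real" where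
  "outer_radius \<Omega> = (SUP x\<in>\<Omega>. norm x)"

definition gradient :: "('a::real_inner \<Rightarrow> real) \<Rightarrow> 'a \<Rightarrow> 'a" where
  "gradient u x = (THE D. GDERIV u x :> D)"

text \<open>A function in \<open>C1c \<Omega>\<close> is represented by its extension by zero to the whole space.
  As its support is a compact subset of the open set \<open>\<Omega>\<close>, this extension is continuously
  differentiable everywhere.\<close>

definition C1c :: "'a::real_inner set \<Rightarrow> ('a \<Rightarrow> real) set" where
  "C1c \<Omega> = {u. (\<forall>x. u differentiable (at x)) \<and> continuous_on UNIV (gradient u) \<and>
                compact (closure {x. u x \<noteq> 0}) \<and> closure {x. u x \<noteq> 0} \<subseteq> \<Omega>}"

text \<open>Both integrands below are integrable for \<open>u \<in> C1c \<Omega>\<close> when \<open>\<Omega>\<close> is bounded and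
  \<open>CARD('n) \<ge> 2\<close>, so the Bochner integrals do not take their default value 0.  The value
  of the second integrand at the origin, where the quotient is 0 by convention, is
  immaterial.\<close>

definition hardy_functional :: "(real ^ 'n) set \<Rightarrow> (real ^ 'n \<Rightarrow> real) \<Rightarrow> real" where
  "hardy_functional \<Omega> u =
     (LINT x:\<Omega>|lborel. norm (gradient u x) ^ CARD('n)) -
     ((real CARD('n) - 1) / real CARD('n)) ^ CARD('n) *
       (LINT x:\<Omega>|lborel. \<bar>u x\<bar> ^ CARD('n) / norm x ^ CARD('n) *
          X1 (norm x / outer_radius \<Omega>) ^ CARD('n))"

definition admissible :: "(real ^ 'n) set \<Rightarrow> (real ^ 'n \<Rightarrow> real) set" where
  "admissible \<Omega> = {u \<in> C1c \<Omega>. hardy_functional \<Omega> u \<le> 1}"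

definition exp_mean :: "real \<Rightarrow> real \<Rightarrow> (real ^ 'n) set \<Rightarrow> (real ^ 'n \<Rightarrow> real) \<Rightarrow> ennreal" where
  "exp_mean \<alpha> \<beta> \<Omega> u =
     (\<integral>\<^sup>+x\<in>\<Omega>. ennreal (exp (\<alpha> *
         (\<bar>u x\<bar> * X2 (norm x / outer_radius \<Omega>) powr \<beta>) powr (real CARD('n) / (real CARD('n) - 1))))
       \<partial>lborel) / emeasure lborel \<Omega>"

definition bounded_domain :: "'a::real_normed_vector set \<Rightarrow> bool" where
  "bounded_domain \<Omega> \<longleftrightarrow> open \<Omega> \<and> connected \<Omega> \<and> \<Omega> \<noteq> {} \<and> bounded \<Omega>"

end

(* Write R for the outer radius, tau(x) = 1 - log(|x|/R), theta = (n-1)/n and u = tau^theta v.  The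
   vector inequality |a+b|^n >= |a|^n + n |a|^(n-2) a.b + c (|a|^(n-2) |b|^2 + |b|^n), applied to
   a = v grad(tau^theta) and b = tau^theta grad v, bounds I_n[u] from below: the first term is the
   Hardy term, the second integrates to 0, and the remainder is coercive.  Its quadratic part controls
   the gradient of |v|^(n/2), and integrating along rays shows that the mean of |v| over B(x,|x|/2) is
   at most C (1 + log tau)^(1/n).  Its part |b|^n controls the deviation of v from that mean through a
   Riesz potential, which is exponentially integrable with the exponent n/(n-1).  Since
   exp(tau) = e R/|x|, the product is integrable for a small constant.  For the converse, v is a bump of
   height S^(1/n) spread over S/2 < log tau < 3S/2: its energy stays bounded, but the exponential
   integral over the shell exp(S) < tau < exp(S) + 1 blows up with S when beta < 1/n. *)

theory Submission
  imports Defs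
begin

section \<open>Radial integrals and dilations\<close>

text \<open>The part |b|^n of the remainder cannot do everything alone. Integrated along rays with
  Hoelder's inequality it bounds |v| by a multiple of (ln \<tau>)^((n-1)/n), too large by a power of
  ln \<tau> as soon as n > 2. The quadratic part is better: its weight |a|^(n-2) makes it the energy
  of |v|^(n/2), Cauchy-Schwarz bounds that function by the square root of ln \<tau>, and |v| by the
  n-th root of ln \<tau>, which is the power that the weight with exponent 1/n absorbs. Point values
  are out of reach, since in dimension n an L^n bound on the gradient does not control them; so this
  bound is proved for means over balls of radius |x|/2. On such a ball \<tau> drops at most by a
  factor 2, so the potential of b carries no \<tau> once v is turned back into u. Exponential
  integrability is arranged pointwise: the potential at x is at most a constant times (1 + ln
  K(x))^((n-1)/n) with K integrable over the ball, so its exponential is a power of K(x). R enters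
  only through the last volume factor, hence c depends on n alone.\<close>

abbreviation vball :: "'a::euclidean_space itself \<Rightarrow> real" where
  "vball _ \<equiv> unit_ball_vol (real DIM('a))"

lemma vball_pos: "0 < vball TYPE('a::euclidean_space)"
  by simp

lemma sets_ball_borel [measurable]: "ball (c :: 'a::metric_space) r \<in> sets borel"
  by simp

text \<open>Polar coordinates for radial integrands, with no measure on the sphere: measures on the
  line are determined by half-lines, and there the claim is the volume formula for balls.\<close>

lemma distr_norm_lborel:
  "distr lborel borel (norm :: 'a::euclidean_space \<Rightarrow> real) =
   density lborel (\<lambda>r. ennreal (DIM('a) * vball TYPE('a) * r ^ (DIM('a) - 1)) * indicator {0..} r)"
    (is "?M = ?D")
proof (rule measure_eqI_generator_eq[where E="range (\<lambda>a::real. {..a})" and \<Omega>=UNIV and A="\<lambda>i::nat. {..real i}"])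
  show "Int_stable (range (\<lambda>a::real. {..a}))"
    by (auto simp: Int_stable_def)
  have eq: "emeasure ?M {..a} = emeasure ?D {..a} \<and> emeasure ?M {..a} \<noteq> \<infinity>" for a
  proof (cases "a \<ge> 0")
    case True
    have "emeasure ?M {..a} = emeasure lborel (cball (0::'a) a)"
      by (subst emeasure_distr) (auto intro!: arg_cong[where f="emeasure lborel"])
    also have "\<dots> = ennreal (vball TYPE('a) * a ^ DIM('a))"
      by (rule emeasure_cball[OF True])
    finally have 1: "emeasure ?M {..a} = ennreal (vball TYPE('a) * a ^ DIM('a))" .
    have "emeasure ?D {..a} = (\<integral>\<^sup>+ r. ennreal (DIM('a) * vball TYPE('a) * r ^ (DIM('a) - 1)) * indicator {0..a} r \<partial>lborel)"
      by (subst emeasure_density)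
         (auto intro!: nn_integral_cong simp: indicator_def)
    also have "\<dots> = ennreal (vball TYPE('a) * a ^ DIM('a)) - ennreal (vball TYPE('a) * 0 ^ DIM('a))"
      using True by (subst nn_integral_FTC_Icc[where F="\<lambda>r. vball TYPE('a) * r ^ DIM('a)"])
         (auto intro!: derivative_eq_intros simp: ennreal_minus)
    finally show ?thesis using 1 by (simp add: zero_power)
  next
    case False
    have "(norm :: 'a \<Rightarrow> real) -` {..a} = {}"
      using False by (auto dest: order_trans[OF norm_ge_zero])
    then have "emeasure ?M {..a} = 0"
      by (subst emeasure_distr) simp_all
    moreover have "emeasure ?D {..a} = 0"
      using False by (subst emeasure_density) (auto simp: nn_integral_0_iff_AE indicator_def)
    ultimately show ?thesis by simp
  qed
  show "emeasure ?M X = emeasure ?D X" if "X \<in> range (\<lambda>a::real. {..a})" for X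
    using that eq by auto
  show "emeasure ?M {..real i} \<noteq> \<infinity>" for i by (rule conjunct2[OF eq[of "real i"]])
  show "sets ?M = sigma_sets UNIV (range atMost)" "sets ?D = sigma_sets UNIV (range atMost)"
    by (simp_all add: borel_eq_atMost)
  show "(\<Union>i. {..real i}) = UNIV" using real_arch_simple by auto
qed auto

lemma nn_integral_norm:
  assumes [measurable]: "F \<in> borel_measurable borel"
  shows "(\<integral>\<^sup>+x. F (norm (x::'a::euclidean_space)) \<partial>lborel) =
    (\<integral>\<^sup>+r. ennreal (DIM('a) * vball TYPE('a) * r ^ (DIM('a) - 1)) * indicator {0..} r * F r \<partial>lborel)"
proof -
  have "(\<integral>\<^sup>+x. F (norm (x::'a)) \<partial>lborel) = (\<integral>\<^sup>+r. F r \<partial>distr lborel borel (norm :: 'a \<Rightarrow> real))"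
    by (subst nn_integral_distr) auto
  then show ?thesis
    by (simp add: distr_norm_lborel nn_integral_density)
qed

text \<open>One-sided limits replace values at the end points, so that antiderivatives singular at
  0, such as \<open>1 / (1 - ln (r / R))\<close>, are covered.\<close>

lemma nn_integral_FTC_Ioo:
  fixes F f :: "real \<Rightarrow> real"
  assumes "p < q"
    and F: "\<And>r. p < r \<Longrightarrow> r < q \<Longrightarrow> (F has_real_derivative f r) (at r)"
    and f: "\<And>r. p < r \<Longrightarrow> r < q \<Longrightarrow> isCont f r"
    and nonneg: "\<And>r. p < r \<Longrightarrow> r < q \<Longrightarrow> 0 \<le> f r"
    and A: "(F \<longlongrightarrow> A) (at_right p)" and B: "(F \<longlongrightarrow> B) (at_left q)"
  shows "(\<integral>\<^sup>+r. ennreal (f r) * indicator {p<..<q} r \<partial>lborel) = ennreal (B - A)"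
proof -
  have int: "set_integrable lborel (einterval (ereal p) (ereal q)) f"
    and eq: "(LBINT x=ereal p..ereal q. f x) = B - A"
    by (rule interval_integral_FTC_nonneg[where F=F and A=A and B=B]; use assms in \<open>auto simp: ereal_tendsto_simps\<close>)+
  have "(\<integral>\<^sup>+r. ennreal (f r) * indicator {p<..<q} r \<partial>lborel) =
        (\<integral>\<^sup>+r. ennreal (indicator {p<..<q} r * f r) \<partial>lborel)"
    by (intro nn_integral_cong) (auto simp: indicator_def)
  also have "\<dots> = ennreal (LINT r|lborel. indicator {p<..<q} r * f r)"
    using int nonneg by (intro nn_integral_eq_integral) (auto simp: set_integrable_def indicator_def)
  also have "(LINT r|lborel. indicator {p<..<q} r * f r) = B - A"
    using eq \<open>p < q\<close> by (simp add: interval_lebesgue_integral_def set_lebesgue_integral_def)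
  finally show ?thesis .
qed

text \<open>Dividing by the power of the norm cancels the polar Jacobian, so \<open>F\<close> is an
  antiderivative of \<open>f\<close> itself.\<close>

lemma nn_integral_radial_FTC:
  fixes F f :: "real \<Rightarrow> real"
  assumes "0 \<le> p" "p < q"
    and F: "\<And>r. p < r \<Longrightarrow> r < q \<Longrightarrow> (F has_real_derivative f r) (at r)"
    and f: "\<And>r. p < r \<Longrightarrow> r < q \<Longrightarrow> isCont f r"
    and nonneg: "\<And>r. p < r \<Longrightarrow> r < q \<Longrightarrow> 0 \<le> f r"
    and A: "(F \<longlongrightarrow> A) (at_right p)" and B: "(F \<longlongrightarrow> B) (at_left q)"
    and [measurable]: "f \<in> borel_measurable borel"
  shows "(\<integral>\<^sup>+x. ennreal (f (norm x) / norm x ^ (DIM('a) - 1)) * indicator {x. p < norm x \<and> norm x < q} x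
      \<partial>(lborel :: 'a::euclidean_space measure)) = ennreal (DIM('a) * vball TYPE('a) * (B - A))"
proof -
  let ?n = "DIM('a)"
  let ?c = "real ?n * vball TYPE('a)"
  have "(\<integral>\<^sup>+x. ennreal (f (norm x) / norm x ^ (?n - 1)) * indicator {x. p < norm x \<and> norm x < q} x
      \<partial>(lborel :: 'a::euclidean_space measure)) =
    (\<integral>\<^sup>+x. (\<lambda>r. ennreal (f r / r ^ (?n - 1)) * indicator {p<..<q} r) (norm x) \<partial>(lborel :: 'a measure))"
    by (intro nn_integral_cong) (auto simp: indicator_def)
  also have "\<dots> = (\<integral>\<^sup>+r. ennreal (?c * r ^ (?n - 1)) * indicator {0..} r *
        (ennreal (f r / r ^ (?n - 1)) * indicator {p<..<q} r) \<partial>lborel)"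
    by (rule nn_integral_norm) measurable
  also have "\<dots> = (\<integral>\<^sup>+r. ennreal ?c * (ennreal (f r) * indicator {p<..<q} r) \<partial>lborel)"
  proof (intro nn_integral_cong)
    fix r :: real
    show "ennreal (?c * r ^ (?n - 1)) * indicator {0..} r *
        (ennreal (f r / r ^ (?n - 1)) * indicator {p<..<q} r) =
        ennreal ?c * (ennreal (f r) * indicator {p<..<q} r)"
    proof (cases "p < r \<and> r < q")
      case True
      then have "r > 0" "f r \<ge> 0" using assms nonneg by auto
      then show ?thesis using True by (simp add: ennreal_mult'[symmetric] )
    qed auto
  qed
  also have "\<dots> = ennreal ?c * (\<integral>\<^sup>+r. ennreal (f r) * indicator {p<..<q} r \<partial>lborel)"
    by (rule nn_integral_cmult) measurable
  also have "\<dots> = ennreal (?c * (B - A))"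
    by (subst nn_integral_FTC_Ioo[OF \<open>p < q\<close> F f nonneg A B]) (auto simp: ennreal_mult')
  finally show ?thesis .
qed

lemma AE_norm_neq: "AE x in (lborel :: 'a::euclidean_space measure). norm x \<noteq> d"
proof -
  have "sphere (0::'a) d \<in> null_sets lborel"
    using negligible_sphere[of 0 d] by (simp add: null_sets_completion_iff negligible_iff_null_sets negligible_convex_frontier)
  then show ?thesis
    by (rule AE_not_in[THEN AE_mp]) auto
qed

lemma nn_integral_inverse_norm_ball:
  assumes "d > 0"
  shows "(\<integral>\<^sup>+x. ennreal (1 / norm x ^ (DIM('a) - 1)) * indicator (ball 0 d) x
      \<partial>(lborel :: 'a::euclidean_space measure)) = ennreal (DIM('a) * vball TYPE('a) * d)"
proof -
  have "(\<integral>\<^sup>+x. ennreal (1 / norm x ^ (DIM('a) - 1)) * indicator (ball 0 d) x \<partial>(lborel :: 'a measure)) =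
    (\<integral>\<^sup>+x. ennreal (1 / norm x ^ (DIM('a) - 1)) * indicator {x. 0 < norm x \<and> norm x < d} x \<partial>(lborel :: 'a measure))"
    by (rule nn_integral_cong_AE, use AE_norm_neq[of 0] in eventually_elim) (auto simp: indicator_def)
  also have "\<dots> = ennreal (DIM('a) * vball TYPE('a) * (d - 0))"
    using assms by (intro nn_integral_radial_FTC[where F="\<lambda>r. r"]) (auto intro!: derivative_eq_intros tendsto_eq_intros)
  finally show ?thesis by simp
qed

lemma nn_integral_inverse_norm_shell:
  assumes "0 < p" "p < q"
  shows "(\<integral>\<^sup>+x. ennreal (1 / norm x ^ DIM('a)) * indicator {x. p < norm x \<and> norm x < q} x
      \<partial>(lborel :: 'a::euclidean_space measure)) = ennreal (DIM('a) * vball TYPE('a) * ln (q / p))"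
proof -
  let ?n = "DIM('a)"
  have "(\<integral>\<^sup>+x. ennreal (1 / norm x ^ ?n) * indicator {x. p < norm x \<and> norm x < q} x \<partial>(lborel :: 'a measure)) =
   (\<integral>\<^sup>+x. ennreal ((1 / norm x) / norm x ^ (?n - 1)) * indicator {x. p < norm x \<and> norm x < q} x \<partial>(lborel :: 'a measure))"
  proof (intro nn_integral_cong)
    fix x :: 'a
    have "norm x ^ ?n = norm x * norm x ^ (?n - 1)"
      using power_minus_mult[of "?n" "norm x"] by (simp add: mult_ac)
    then show "ennreal (1 / norm x ^ ?n) * indicator {x. p < norm x \<and> norm x < q} x =
        ennreal ((1 / norm x) / norm x ^ (?n - 1)) * indicator {x. p < norm x \<and> norm x < q} x"
      by simp
  qed
  also have "\<dots> = ennreal (?n * vball TYPE('a) * (ln q - ln p))"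
    using assms by (intro nn_integral_radial_FTC[where F=ln]) (auto intro!: derivative_eq_intros tendsto_eq_intros continuous_intros)
  finally show ?thesis using assms by (simp add: ln_div)
qed

section \<open>Dilations and translations of the integral\<close>

lemma nn_integral_scaleR:
  fixes f :: "'a::euclidean_space \<Rightarrow> ennreal"
  assumes [measurable]: "f \<in> borel_measurable borel" and "s > 0"
  shows "(\<integral>\<^sup>+x. f (s *\<^sub>R x) \<partial>lborel) = ennreal (1 / s ^ DIM('a)) * (\<integral>\<^sup>+x. f x \<partial>lborel)"
proof -
  let ?n = "DIM('a)"
  have "(\<integral>\<^sup>+x. f x \<partial>lborel) = (\<integral>\<^sup>+x. f x \<partial>density (distr lborel borel (\<lambda>x. 0 + s *\<^sub>R x)) (\<lambda>_. ennreal (\<bar>s\<bar>^?n)))"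
    using \<open>s > 0\<close> by (subst lborel_affine[of s 0]) auto
  also have "\<dots> = (\<integral>\<^sup>+x. ennreal (\<bar>s\<bar>^?n) * f (s *\<^sub>R x) \<partial>lborel)"
    by (simp add: nn_integral_density nn_integral_distr)
  also have "\<dots> = ennreal (s^?n) * (\<integral>\<^sup>+x. f (s *\<^sub>R x) \<partial>lborel)"
    using \<open>s > 0\<close> by (subst nn_integral_cmult) auto
  finally have "ennreal (1 / s ^ ?n) * (\<integral>\<^sup>+x. f x \<partial>lborel) = ennreal (1 / s ^ ?n) * (ennreal (s^?n) * (\<integral>\<^sup>+x. f (s *\<^sub>R x) \<partial>lborel))" by simp
  also have "\<dots> = (\<integral>\<^sup>+x. f (s *\<^sub>R x) \<partial>lborel)"
    using \<open>s > 0\<close> by (simp add: mult.assoc[symmetric] ennreal_mult'[symmetric])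
  finally show ?thesis by simp
qed

lemma nn_integral_shift:
  fixes f :: "'a::euclidean_space \<Rightarrow> ennreal"
  assumes [measurable]: "f \<in> borel_measurable borel"
  shows "(\<integral>\<^sup>+x. f (c + x) \<partial>lborel) = (\<integral>\<^sup>+x. f x \<partial>lborel)"
  by (subst lborel_affine[of 1 c, simplified]) (auto simp: nn_integral_density nn_integral_distr)

lemma nn_integral_powr_tail:
  assumes "l > 0" "n > 0"
  shows "(\<integral>\<^sup>+s. ennreal (1 / s ^ Suc n) * indicator {l..} s \<partial>lborel) = ennreal (1 / (n * l ^ n))"
proof -
  have "(\<integral>\<^sup>+s. ennreal (1 / s ^ Suc n) * indicator {l..} s \<partial>lborel) = ennreal (0 - (- (1 / (n * l ^ n))))"
  proof (rule nn_integral_FTC_atLeast)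
    have "((\<lambda>s::real. 1 / (real n * s ^ n)) \<longlongrightarrow> 0) at_top" using \<open>n > 0\<close>
      by (intro tendsto_divide_0[OF tendsto_const] filterlim_at_top_imp_at_infinity
          filterlim_tendsto_pos_mult_at_top[OF tendsto_const] filterlim_pow_at_top filterlim_ident) auto
    from tendsto_minus[OF this] show "((\<lambda>s. - (1 / (real n * s ^ n))) \<longlongrightarrow> 0) at_top" by simp
    fix s assume "l \<le> s" then have "s > 0" using assms by simp
    have pw: "s ^ n = s ^ (n - 1) * s" using power_minus_mult[OF \<open>n > 0\<close>, of s] by simp
    have "((\<lambda>s. - (1 / real n) * inverse (s ^ n)) has_real_derivative
        - (1 / real n) * (- (inverse (s ^ n) * (real n * s ^ (n - 1)) * inverse (s ^ n)))) (at s)"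
      using \<open>s > 0\<close> by (intro DERIV_cmult DERIV_inverse') (auto intro!: derivative_eq_intros)
    then show "((\<lambda>s. - (1 / (real n * s ^ n))) has_real_derivative 1 / s ^ Suc n) (at s)"
      using \<open>n > 0\<close> \<open>s > 0\<close> by (simp add: pw field_simps)
    show "0 \<le> 1 / s ^ Suc n" using \<open>s > 0\<close> by simp
  qed auto
  then show ?thesis by simp
qed

text \<open>Source of every Riesz kernel below. For fixed s substitute z = s y, which produces
  1/s^(n+1); the condition |y| \<le> d becomes s \<ge> |z|/d, and integrating s out over this
  half-line leaves |z|^(1-n). With \<open>g\<close> cut off near 0 it serves integration from the
  centre of a ball, and with \<open>g\<close> cut off to a shell it serves integration outwards
  along rays.\<close>

lemma nn_integral_dilation:
  fixes g :: "'a::euclidean_space \<Rightarrow> ennreal"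
  assumes [measurable]: "g \<in> borel_measurable borel" and "d > 0"
  shows "(\<integral>\<^sup>+y. (\<integral>\<^sup>+s. g (s *\<^sub>R y) * ennreal (norm y) * indicator {0<..} s \<partial>lborel) * indicator {y. norm y \<le> d} y \<partial>lborel)
    = ennreal (d ^ DIM('a) / DIM('a)) * (\<integral>\<^sup>+z. g z * ennreal (1 / norm z ^ (DIM('a) - 1)) \<partial>lborel)"
    (is "?L = ?R")
proof -
  let ?n = "DIM('a)"
  have n: "?n > 0" by simp
  define k where "k s z = g z * ennreal (norm z) * indicator {z. norm z \<le> s * d} z" for s :: real and z :: 'a
  have km [measurable]: "case_prod k \<in> borel_measurable (borel \<Otimes>\<^sub>M borel)"
    unfolding k_def by measurable
  have km2 [measurable]: "k s \<in> borel_measurable borel" for s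
    unfolding k_def by measurable
  have "?L = (\<integral>\<^sup>+y. (\<integral>\<^sup>+s. g (s *\<^sub>R y) * ennreal (norm y) * indicator {0<..} s * indicator {y. norm y \<le> d} y \<partial>lborel) \<partial>lborel)"
    by (intro nn_integral_cong nn_integral_multc[symmetric]) measurable
  also have "\<dots> = (\<integral>\<^sup>+s. (\<integral>\<^sup>+y. g (s *\<^sub>R y) * ennreal (norm y) * indicator {0<..} s * indicator {y. norm y \<le> d} y \<partial>lborel) \<partial>lborel)"
    by (rule lborel_pair.Fubini') measurable
  also have "\<dots> = (\<integral>\<^sup>+s. (\<integral>\<^sup>+z. ennreal (1 / s ^ Suc ?n) * indicator {0<..} s * k s z \<partial>lborel) \<partial>lborel)"
  proof (rule nn_integral_cong)
    fix s :: real
    show "(\<integral>\<^sup>+y. g (s *\<^sub>R y) * ennreal (norm y) * indicator {0<..} s * indicator {y. norm y \<le> d} y \<partial>lborel)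
       = (\<integral>\<^sup>+z. ennreal (1 / s ^ Suc ?n) * indicator {0<..} s * k s z \<partial>lborel)"
    proof (cases "s > 0")
      case True
      have "(\<integral>\<^sup>+y. g (s *\<^sub>R y) * ennreal (norm y) * indicator {0<..} s * indicator {y. norm y \<le> d} y \<partial>lborel)
         = (\<integral>\<^sup>+y. (\<lambda>z. ennreal (1 / s) * k s z) (s *\<^sub>R y) \<partial>lborel)"
      proof (intro nn_integral_cong)
        fix y :: 'a
        have "ennreal (norm y) = ennreal (1/s) * ennreal (norm (s *\<^sub>R y))"
          using True by (simp add: ennreal_mult'[symmetric] )
        moreover have "norm y \<le> d \<longleftrightarrow> norm (s *\<^sub>R y) \<le> s * d" using True by simp
        ultimately show "g (s *\<^sub>R y) * ennreal (norm y) * indicator {0<..} s * indicator {y. norm y \<le> d} y =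
          ennreal (1 / s) * k s (s *\<^sub>R y)"
          using True unfolding k_def by (simp add: indicator_def mult_ac)
      qed
      also have "\<dots> = ennreal (1 / s ^ ?n) * (\<integral>\<^sup>+z. ennreal (1/s) * k s z \<partial>lborel)"
        using True by (intro nn_integral_scaleR) measurable
      also have "\<dots> = ennreal (1 / s ^ Suc ?n) * (\<integral>\<^sup>+z. k s z \<partial>lborel)"
      proof -
        have "ennreal (1 / s ^ ?n) * ennreal (1 / s) = ennreal (1 / s ^ Suc ?n)"
          using True by (simp add: ennreal_mult'[symmetric] mult.commute)
        then show ?thesis by (subst nn_integral_cmult) (simp_all flip: mult.assoc)
      qed
      finally show ?thesis using True by (simp add: nn_integral_cmult)
    qed simp
  qed
  also have "\<dots> = (\<integral>\<^sup>+z. (\<integral>\<^sup>+s. ennreal (1 / s ^ Suc ?n) * indicator {0<..} s * k s z \<partial>lborel) \<partial>lborel)"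
    by (rule lborel_pair.Fubini'[symmetric]) measurable
  also have "\<dots> = (\<integral>\<^sup>+z. ennreal (d ^ ?n / ?n) * (g z * ennreal (1 / norm z ^ (?n - 1))) \<partial>lborel)"
  proof (rule nn_integral_cong_AE, use AE_norm_neq[of 0] in eventually_elim)
    fix z :: 'a assume "norm z \<noteq> 0"
    then have z: "norm z > 0" by simp
    let ?l = "norm z / d"
    have l: "?l > 0" using z \<open>d > 0\<close> by simp
    have "(\<integral>\<^sup>+s. ennreal (1 / s ^ Suc ?n) * indicator {0<..} s * k s z \<partial>lborel)
      = (\<integral>\<^sup>+s. (g z * ennreal (norm z)) * (ennreal (1 / s ^ Suc ?n) * indicator {?l..} s) \<partial>lborel)"
    proof (intro nn_integral_cong)
      fix s
      have "norm z \<le> s * d \<longleftrightarrow> ?l \<le> s" using \<open>d > 0\<close> by (simp add: field_simps)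
      moreover have "s > 0" if "?l \<le> s" using l that by linarith
      ultimately show "ennreal (1 / s ^ Suc ?n) * indicator {0<..} s * k s z =
        (g z * ennreal (norm z)) * (ennreal (1 / s ^ Suc ?n) * indicator {?l..} s)"
        unfolding k_def by (auto simp: indicator_def mult_ac)
    qed
    also have "\<dots> = (g z * ennreal (norm z)) * ennreal (1 / (?n * ?l ^ ?n))"
      by (subst nn_integral_cmult) (auto simp: nn_integral_powr_tail[OF l n, simplified])
    also have "\<dots> = g z * ennreal (norm z * (1 / (?n * ?l ^ ?n)))"
      by (simp add: mult.assoc ennreal_mult'[symmetric])
    also have "norm z * (1 / (?n * ?l ^ ?n)) = (d ^ ?n / ?n) * (1 / norm z ^ (?n - 1))"
    proof -
      have "norm z ^ ?n = norm z ^ (?n - 1) * norm z"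
        using power_minus_mult[of ?n "norm z"] by simp
      then show ?thesis using z \<open>d > 0\<close> n by (simp add: power_divide)
    qed
    also have "ennreal \<dots> = ennreal (d ^ ?n / ?n) * ennreal (1 / norm z ^ (?n - 1))"
      using \<open>d > 0\<close> by (intro ennreal_mult') auto
    finally show "(\<integral>\<^sup>+s. ennreal (1 / s ^ Suc ?n) * indicator {0<..} s * k s z \<partial>lborel) =
       ennreal (d ^ ?n / ?n) * (g z * ennreal (1 / norm z ^ (?n - 1)))"
      by (simp only: mult_ac)
  qed
  also have "\<dots> = ?R"
    by (rule nn_integral_cmult) measurable
  finally show ?thesis .
qed

lemma integral_scaleR:
  fixes f :: "'a::euclidean_space \<Rightarrow> real"
  assumes [measurable]: "f \<in> borel_measurable borel" and s: "s > 0"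
  shows "(\<integral>x. f (s *\<^sub>R x) \<partial>lborel) = (\<integral>x. f x \<partial>lborel) / s ^ DIM('a)"
proof -
  have "(\<integral>x. f x \<partial>lborel) = (\<integral>x. f x \<partial>density (distr lborel borel (\<lambda>x. 0 + s *\<^sub>R x)) (\<lambda>_. ennreal (\<bar>s\<bar>^DIM('a))))"
    using s by (subst lborel_affine[of s 0]) auto
  also have "\<dots> = s ^ DIM('a) * (\<integral>x. f (s *\<^sub>R x) \<partial>lborel)"
    using s by (simp add: integral_density integral_distr)
  finally show ?thesis using s by simp
qed

lemma integrable_scaleR:
  fixes f :: "'a::euclidean_space \<Rightarrow> real"
  assumes f: "integrable lborel f" and s: "s > 0"
  shows "integrable lborel (\<lambda>x. f (s *\<^sub>R x))"
proof -
  have [measurable]: "f \<in> borel_measurable borel" using f by auto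
  show ?thesis
    unfolding integrable_iff_bounded
    using f s nn_integral_scaleR[of "\<lambda>x. ennreal (norm (f x))" s]
    by (auto simp: integrable_iff_bounded ennreal_mult_less_top)
qed

lemma has_bochner_integral_inverse_norm_shell:
  assumes "0 < p" "p < q"
  shows "has_bochner_integral (lborel :: 'a::euclidean_space measure)
     (\<lambda>x. indicator {x. p < norm x \<and> norm x < q} x / norm x ^ DIM('a)) (DIM('a) * vball TYPE('a) * ln (q / p))"
proof (rule has_bochner_integral_nn_integral)
  have "(\<integral>\<^sup>+x. ennreal (indicator {x. p < norm x \<and> norm x < q} x / norm x ^ DIM('a)) \<partial>(lborel :: 'a measure)) =
    (\<integral>\<^sup>+x. ennreal (1 / norm x ^ DIM('a)) * indicator {x. p < norm x \<and> norm x < q} x \<partial>(lborel :: 'a measure))"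
    by (intro nn_integral_cong) (auto simp: indicator_def)
  then show "(\<integral>\<^sup>+x. ennreal (indicator {x. p < norm x \<and> norm x < q} x / norm x ^ DIM('a)) \<partial>(lborel :: 'a measure)) =
    ennreal (DIM('a) * vball TYPE('a) * ln (q / p))"
    using nn_integral_inverse_norm_shell[OF assms, where 'a='a] by simp
  show "0 \<le> DIM('a) * vball TYPE('a) * ln (q / p)" using assms by (intro mult_nonneg_nonneg) auto
qed (auto simp: indicator_def)

lemmas integrable_inverse_norm_shell = integrable.intros[OF has_bochner_integral_inverse_norm_shell]

text \<open>The measure \<open>dx / \<bar>x\<bar>\<^bsup>N\<^esup>\<close> is invariant under dilations, so by Fubini \<open>ln 2\<close> times the integral is
  that of \<open>(g (2 x) - g x) / \<bar>x\<bar>\<^bsup>N\<^esup>\<close>; outside a small ball the latter reduces to the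
  integral of \<open>- g / \<bar>x\<bar>\<^bsup>N\<^esup>\<close> over the shell between the radii \<open>\<epsilon>\<close> and \<open>2 \<epsilon>\<close>.\<close>

lemma integral_radial_derivative_eq_0:
  fixes g q :: "'a::euclidean_space \<Rightarrow> real"
  assumes [measurable]: "g \<in> borel_measurable borel" "q \<in> borel_measurable borel"
    and der: "\<And>x s. x \<noteq> 0 \<Longrightarrow> s > 0 \<Longrightarrow> ((\<lambda>s. g (s *\<^sub>R x)) has_real_derivative q (s *\<^sub>R x) / s) (at s)"
    and cont: "\<And>x. x \<noteq> 0 \<Longrightarrow> continuous_on {0<..} (\<lambda>s. q (s *\<^sub>R x))"
    and lim: "(g \<longlongrightarrow> 0) (at 0)"
    and supp: "\<And>x. norm x \<ge> R \<Longrightarrow> g x = 0"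
    and bdd: "\<And>x. \<bar>g x\<bar> \<le> M"
    and int: "integrable lborel (\<lambda>x. q x / norm x ^ DIM('a))"
  shows "(\<integral>x. q x / norm x ^ DIM('a) \<partial>lborel) = 0"
proof -
  let ?n = "DIM('a)"
  define h where "h z = q z / norm z ^ ?n" for z
  have [measurable]: "h \<in> borel_measurable borel" unfolding h_def by measurable
  have inth: "integrable lborel h" using int unfolding h_def .
  define J where "J = (\<integral>x. h x \<partial>lborel)"
  define k where "k x = (g (2 *\<^sub>R x) - g x) / norm x ^ ?n" for x
  have [measurable]: "k \<in> borel_measurable borel" unfolding k_def by measurable
  define f where "f s x = indicator {1..2} s * (q (s *\<^sub>R x) / s / norm x ^ ?n)" for s :: real and x :: 'a
  have fm [measurable]: "case_prod f \<in> borel_measurable (lborel \<Otimes>\<^sub>M lborel)"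
    unfolding f_def by measurable
  have scale: "q (s *\<^sub>R x) / s / norm x ^ ?n = s ^ ?n / s * h (s *\<^sub>R x)" if "s > 0" for s x
    using that by (simp add: power_mult_distrib h_def)
  have fx: "integrable lborel (f s)" for s
  proof (cases "s \<in> {1..2}")
    case True
    then have "s > 0" by simp
    then show ?thesis unfolding f_def scale[OF \<open>s > 0\<close>]
      by (intro integrable_mult_right integrable_scaleR[OF inth])
  qed (simp add: f_def[abs_def])
  have Jf: "(\<integral>x. f s x \<partial>lborel) = indicator {1..2} s * (J / s)" for s
  proof (cases "s \<in> {1..2}")
    case True
    then have "s > 0" by simp
    then show ?thesis unfolding f_def scale[OF \<open>s > 0\<close>]
      using True \<open>s > 0\<close> integral_scaleR[of h s] by (simp add: J_def)
  qed (simp add: f_def)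
  have Jn: "(\<integral>x. norm (f s x) \<partial>lborel) = indicator {1..2} s * ((\<integral>x. norm (h x) \<partial>lborel) / s)" for s
  proof (cases "s \<in> {1..2}")
    case True
    then have s: "s > 0" by simp
    have "norm (f s x) = s ^ ?n / s * norm (h (s *\<^sub>R x))" for x
      unfolding f_def scale[OF s] using s True by (simp add: abs_mult)
    then show ?thesis
      using True s integral_scaleR[of "\<lambda>z. norm (h z)" s] by simp
  qed (simp add: f_def)
  have inv_int: "integrable lborel (\<lambda>s::real. indicator {1..2} s * (c / s))" for c
  proof -
    have "set_integrable lborel {1..2::real} (\<lambda>s. c / s)"
      by (intro borel_integrable_atLeastAtMost' continuous_intros) auto
    then show ?thesis by (simp add: set_integrable_def)
  qed
  have fint: "integrable (lborel \<Otimes>\<^sub>M lborel) (case_prod f)"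
  proof (rule lborel_pair.Fubini_integrable)
    show "integrable lborel (\<lambda>x. LINT y|lborel. norm (case (x, y) of (s, x) \<Rightarrow> f s x))"
      using Jn inv_int by simp
  qed (use fx in auto)
  have kf: "(\<integral>s. f s x \<partial>lborel) = k x" if "x \<noteq> 0" for x
  proof -
    have "continuous_on {1..2} (\<lambda>s. q (s *\<^sub>R x) / s)"
      by (intro continuous_intros continuous_on_subset[OF cont[OF that]]) auto
    then have "(\<integral>s. indicator {1..2} s *\<^sub>R (q (s *\<^sub>R x) / s) \<partial>lborel) = g (2 *\<^sub>R x) - g (1 *\<^sub>R x)"
      by (intro integral_FTC_Icc)
         (auto intro!: has_field_derivative_at_within[OF der[OF that]] simp flip: has_real_derivative_iff_has_vector_derivative)
    moreover have "f s x = (indicator {1..2} s *\<^sub>R (q (s *\<^sub>R x) / s)) * (1 / norm x ^ ?n)" for s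
      by (simp add: f_def)
    then have "(\<integral>s. f s x \<partial>lborel) = (\<integral>s. indicator {1..2} s *\<^sub>R (q (s *\<^sub>R x) / s) \<partial>lborel) * (1 / norm x ^ ?n)"
      by (simp only: integral_mult_left_zero)
    ultimately show ?thesis by (simp add: k_def)
  qed
  have AEk: "AE x in lborel. (\<integral>s. f s x \<partial>lborel) = k x"
    using AE_norm_neq[of 0] by eventually_elim (auto intro!: kf)
  have kint: "integrable lborel k"
    using lborel_pair.integrable_snd[OF fint] by (subst (asm) integrable_cong_AE[OF _ _ AEk]) auto
  have "(\<integral>x. k x \<partial>lborel) = (\<integral>x. (\<integral>s. f s x \<partial>lborel) \<partial>lborel)"
    using AEk by (intro integral_cong_AE) (auto elim: eventually_mono)
  also have "\<dots> = (\<integral>s. (\<integral>x. f s x \<partial>lborel) \<partial>lborel)"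
    by (rule lborel_pair.Fubini_integral[OF fint])
  also have "\<dots> = (\<integral>s. indicator {1..2} s *\<^sub>R (J / s) \<partial>lborel)" by (simp add: Jf)
  also have "\<dots> = J * ln 2 - J * ln 1"
  proof (rule integral_FTC_Icc)
    fix s :: real assume "1 \<le> s" "s \<le> 2"
    then have "((\<lambda>s. J * ln s) has_real_derivative J / s) (at s)"
      by (auto intro!: derivative_eq_intros)
    then show "((\<lambda>s. J * ln s) has_vector_derivative J / s) (at s within {1..2})"
      unfolding has_real_derivative_iff_has_vector_derivative by (rule has_vector_derivative_at_within)
  qed (auto intro!: continuous_intros)
  finally have kJ: "(\<integral>x. k x \<partial>lborel) = J * ln 2" by simp

  define G where "G e x = indicator {x. e < norm x} x * g x / norm x ^ ?n" for e and x :: 'a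
  have [measurable]: "G e \<in> borel_measurable borel" for e unfolding G_def by measurable
  have Gint: "integrable lborel (G e)" if "e > 0" for e
  proof (rule Bochner_Integration.integrable_bound)
    show "integrable lborel (\<lambda>x::'a. M * (indicator {x. e < norm x \<and> norm x < max R (2 * e)} x / norm x ^ ?n))"
      using that by (intro integrable_mult_right integrable_inverse_norm_shell) auto
    have "M \<ge> 0" using bdd[of 0] by simp
    show "AE x in lborel. norm (G e x) \<le> norm (M * (indicator {x. e < norm x \<and> norm x < max R (2 * e)} x / norm x ^ ?n))"
    proof (intro AE_I2)
      fix x :: 'a
      show "norm (G e x) \<le> norm (M * (indicator {x. e < norm x \<and> norm x < max R (2 * e)} x / norm x ^ ?n))"
        using bdd[of x] supp[of x] \<open>M \<ge> 0\<close> by (cases "norm x < R") (auto simp: G_def indicator_def abs_mult divide_right_mono)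
    qed
  qed measurable
  define k' where "k' m x = indicator {x. 1 / real (Suc m) < norm x} x * k x" for m x
  have k'_lim: "(\<lambda>m. \<integral>x. k' m x \<partial>lborel) \<longlonglongrightarrow> (\<integral>x. k x \<partial>lborel)"
  proof (rule integral_dominated_convergence[where w="\<lambda>x. norm (k x)"])
    show "integrable lborel (\<lambda>x. norm (k x))" using kint by simp
    show "AE x in lborel. (\<lambda>m. k' m x) \<longlonglongrightarrow> k x"
      using AE_norm_neq[of 0]
    proof eventually_elim
      fix x :: 'a assume "norm x \<noteq> 0"
      then have "norm x > 0" by simp
      then obtain m0 where m0: "inverse (real (Suc m0)) < norm x" using reals_Archimedean by blast
      have "\<forall>\<^sub>F m in sequentially. k' m x = k x"
        using eventually_ge_at_top[of m0]
      proof eventually_elim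
        fix m assume "m0 \<le> m"
        then have "1 / real (Suc m) \<le> inverse (real (Suc m0))" by (simp add: field_simps)
        then show "k' m x = k x" using m0 by (simp add: k'_def)
      qed
      then show "(\<lambda>m. k' m x) \<longlonglongrightarrow> k x" by (rule tendsto_eventually)
    qed
  qed (auto simp: k'_def indicator_def)
  have k'_eq: "(\<integral>x. k' m x \<partial>lborel) = (\<integral>x. (G (2 * e) x - G e x) \<partial>lborel)" if e: "e = 1 / real (Suc m)" for m e
  proof -
    have e0: "e > 0" using e by simp
    \<comment> \<open>In both terms the cut-off is at |x| > e: doubling the argument doubles the
      radius. The integrals of the two terms can therefore be subtracted after rescaling the first
      one.\<close>
    have "k' m x = 2 ^ ?n * G (2 * e) (2 *\<^sub>R x) - G e x" for x
      using e by (simp add: k'_def k_def G_def power_mult_distrib diff_divide_distrib indicator_def)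
    then have "(\<integral>x. k' m x \<partial>lborel) = (\<integral>x. 2 ^ ?n * G (2 * e) (2 *\<^sub>R x) - G e x \<partial>lborel)" by simp
    also have "\<dots> = (\<integral>x. 2 ^ ?n * G (2 * e) (2 *\<^sub>R x) \<partial>lborel) - (\<integral>x. G e x \<partial>lborel)"
      using e0 by (intro Bochner_Integration.integral_diff integrable_mult_right integrable_scaleR Gint) auto
    also have "(\<integral>x. 2 ^ ?n * G (2 * e) (2 *\<^sub>R x) \<partial>lborel) = (\<integral>x. G (2 * e) x \<partial>lborel)"
      by (simp add: integral_scaleR)
    also have "\<dots> - (\<integral>x. G e x \<partial>lborel) = (\<integral>x. (G (2 * e) x - G e x) \<partial>lborel)"
      using e0 by (intro Bochner_Integration.integral_diff[symmetric] Gint) auto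
    finally show ?thesis .
  qed
  have "(\<lambda>m. \<integral>x. k' m x \<partial>lborel) \<longlonglongrightarrow> 0"
  proof (rule tendstoI)
    fix \<epsilon> :: real assume "\<epsilon> > 0"
    \<comment> \<open>Mass of the shell e < |x| < 3 e. The difference lives on e < |x| \<le> 2 e,
      which this open shell contains together with its outer sphere.\<close>
    define C where "C = ?n * vball TYPE('a) * ln 3"
    have C: "C > 0" unfolding C_def by (intro mult_pos_pos) auto
    then have "\<epsilon> / (2 * C) > 0" using \<open>\<epsilon> > 0\<close> by simp
    from tendstoD[OF lim this] obtain d where d: "d > 0" "\<And>x. x \<noteq> 0 \<Longrightarrow> norm x < d \<Longrightarrow> \<bar>g x\<bar> < \<epsilon> / (2 * C)"
      unfolding eventually_at by auto
    have "\<forall>\<^sub>F m in sequentially. 1 / real (Suc m) < d / 2"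
      using d by (intro order_tendstoD[OF LIMSEQ_Suc[OF lim_1_over_n]]) auto
    then show "\<forall>\<^sub>F m in sequentially. dist (\<integral>x. k' m x \<partial>lborel) 0 < \<epsilon>"
    proof eventually_elim
      fix m assume m: "1 / real (Suc m) < d / 2"
      define e where "e = 1 / real (Suc m)"
      have e: "e > 0" "2 * e < d" using m by (auto simp: e_def)
      have "norm (\<integral>x. (G (2 * e) x - G e x) \<partial>lborel) \<le> (\<integral>x. \<epsilon> / (2 * C) * (indicator {x. e < norm x \<and> norm x < 3 * e} (x::'a) / norm x ^ ?n) \<partial>lborel)"
      proof (rule Bochner_Integration.integral_norm_bound_integral)
        show "integrable lborel (\<lambda>x. G (2 * e) x - G e x)" using e by (intro Bochner_Integration.integrable_diff Gint) auto
        show "integrable lborel (\<lambda>x::'a. \<epsilon> / (2 * C) * (indicator {x. e < norm x \<and> norm x < 3 * e} x / norm x ^ ?n))"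
          using has_bochner_integral_inverse_norm_shell[of e "3 * e", where 'a='a] e
          by (intro integrable_mult_right) (auto simp: has_bochner_integral_iff)
        fix x :: 'a
        show "norm (G (2 * e) x - G e x) \<le> \<epsilon> / (2 * C) * (indicator {x. e < norm x \<and> norm x < 3 * e} x / norm x ^ ?n)"
        proof (cases "e < norm x \<and> norm x \<le> 2 * e")
          case True
          then have "\<bar>g x\<bar> \<le> \<epsilon> / (2 * C)" using d(2)[of x] e by (smt (verit) norm_zero)
          then have "\<bar>g x\<bar> / norm x ^ ?n \<le> \<epsilon> / (2 * C) / norm x ^ ?n" by (intro divide_right_mono) auto
          then show ?thesis using True e by (simp add: G_def indicator_def)
        next
          case False
          then show ?thesis using e \<open>\<epsilon> > 0\<close> C by (auto simp: G_def indicator_def)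
        qed
      qed
      also have "\<dots> = \<epsilon> / (2 * C) * C"
      proof -
        have "(\<integral>x. indicator {x. e < norm x \<and> norm x < 3 * e} (x::'a) / norm x ^ ?n \<partial>lborel) = C"
          using has_bochner_integral_inverse_norm_shell[of e "3 * e", where 'a='a] e
          by (simp add: has_bochner_integral_iff C_def)
        then show ?thesis by (simp only: integral_mult_right_zero)
      qed
      also have "\<dots> < \<epsilon>" using C \<open>\<epsilon> > 0\<close> by simp
      finally show "dist (\<integral>x. k' m x \<partial>lborel) 0 < \<epsilon>"
        using k'_eq[OF e_def] by simp
    qed
  qed
  with k'_lim have "(\<integral>x. k x \<partial>lborel) = 0" by (rule LIMSEQ_unique)
  with kJ show ?thesis unfolding J_def h_def by simp
qed

section \<open>Riesz potentials\<close>

lemma abs_diff_le_nn_integral: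
  fixes f f' :: "real \<Rightarrow> real"
  assumes "p \<le> q"
    and der: "\<And>s. p \<le> s \<Longrightarrow> s \<le> q \<Longrightarrow> (f has_real_derivative f' s) (at s)"
    and cont: "continuous_on {p..q} f'"
  shows "ennreal \<bar>f q - f p\<bar> \<le> (\<integral>\<^sup>+s. ennreal \<bar>f' s\<bar> * indicator {p..q} s \<partial>lborel)"
proof -
  have int: "integrable lborel (\<lambda>s. indicator {p..q} s *\<^sub>R f' s)"
    using borel_integrable_atLeastAtMost'[OF cont] by (simp add: set_integrable_def)
  have "(\<integral>s. indicator {p..q} s *\<^sub>R f' s \<partial>lborel) = f q - f p"
    by (rule integral_FTC_Icc[OF \<open>p \<le> q\<close> has_vector_derivative_at_within[OF
          der[unfolded has_real_derivative_iff_has_vector_derivative]] cont])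
  then have "ennreal \<bar>f q - f p\<bar> = ennreal (norm (\<integral>s. indicator {p..q} s *\<^sub>R f' s \<partial>lborel))" by simp
  also have "\<dots> \<le> ennreal (\<integral>s. norm (indicator {p..q} s *\<^sub>R f' s) \<partial>lborel)"
    by (intro ennreal_leI integral_norm_bound)
  also have "\<dots> = (\<integral>\<^sup>+s. ennreal (norm (indicator {p..q} s *\<^sub>R f' s)) \<partial>lborel)"
    using int by (intro nn_integral_eq_integral[symmetric]) auto
  also have "\<dots> = (\<integral>\<^sup>+s. ennreal \<bar>f' s\<bar> * indicator {p..q} s \<partial>lborel)"
    by (intro nn_integral_cong) (auto simp: indicator_def)
  finally show ?thesis .
qed

text \<open>Integrate the derivative along the segment from x to y and average over y:
  \<open>nn_integral_dilation\<close>, centred at x, turns the double integral into a potential.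
  Segments stay inside the ball, so cutting the gradient off to the ball loses nothing.\<close>

lemma nn_integral_oscillation_le:
  fixes V :: "'a::euclidean_space \<Rightarrow> real" and H :: "'a \<Rightarrow> 'a"
  assumes "d > 0" and [measurable]: "V \<in> borel_measurable borel" "H \<in> borel_measurable borel"
    and der: "\<And>z. z \<in> ball x d \<Longrightarrow> (V has_derivative (\<lambda>h. H z \<bullet> h)) (at z)"
    and cont: "continuous_on (ball x d) H"
  shows "(\<integral>\<^sup>+y. ennreal \<bar>V y - V x\<bar> * indicator (ball x d) y \<partial>lborel) \<le>
    ennreal (d ^ DIM('a) / DIM('a)) *
    (\<integral>\<^sup>+y. ennreal (norm (H y) / norm (y - x) ^ (DIM('a) - 1)) * indicator (ball x d) y \<partial>lborel)"
proof -
  let ?n = "DIM('a)"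
  define g where "g z = ennreal (norm (H (x + z))) * indicator (ball 0 d) z" for z
  have [measurable]: "g \<in> borel_measurable borel" unfolding g_def by measurable
  have ib: "indicator (ball x d) (x + w) = (indicator (ball 0 d) w :: ennreal)" for w
    by (auto simp: indicator_def dist_norm)
  have "(\<integral>\<^sup>+y. ennreal \<bar>V y - V x\<bar> * indicator (ball x d) y \<partial>lborel)
     = (\<integral>\<^sup>+w. ennreal \<bar>V (x + w) - V x\<bar> * indicator (ball x d) (x + w) \<partial>lborel)"
    by (rule nn_integral_shift[symmetric]) measurable
  also have "\<dots> \<le> (\<integral>\<^sup>+w. (\<integral>\<^sup>+s. g (s *\<^sub>R w) * ennreal (norm w) * indicator {0<..} s \<partial>lborel) * indicator {y. norm y \<le> d} w \<partial>lborel)" (is "_ \<le> nn_integral _ ?rhs")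
  proof (rule nn_integral_mono)
    fix w :: 'a
    show "ennreal \<bar>V (x + w) - V x\<bar> * indicator (ball x d) (x + w) \<le> ?rhs w"
    proof (cases "norm w < d")
      case True
      have inb: "x + s *\<^sub>R w \<in> ball x d" "s *\<^sub>R w \<in> ball 0 d" if "0 \<le> s" "s \<le> 1" for s
      proof -
        have "\<bar>s\<bar> * norm w \<le> 1 * norm w" using that by (intro mult_right_mono) auto
        then show "x + s *\<^sub>R w \<in> ball x d" "s *\<^sub>R w \<in> ball 0 d" using True by (auto simp: dist_norm)
      qed
      have "ennreal \<bar>(\<lambda>s. V (x + s *\<^sub>R w)) 1 - (\<lambda>s. V (x + s *\<^sub>R w)) 0\<bar> \<le>
        (\<integral>\<^sup>+s. ennreal \<bar>H (x + s *\<^sub>R w) \<bullet> w\<bar> * indicator {0..1} s \<partial>lborel)"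
      proof (rule abs_diff_le_nn_integral)
        fix s :: real assume s: "0 \<le> s" "s \<le> 1"
        have "((\<lambda>s. x + s *\<^sub>R w) has_vector_derivative w) (at s)"
          by (auto intro!: derivative_eq_intros)
        from vector_derivative_diff_chain_within[OF this has_derivative_at_withinI[OF der[OF inb(1)[OF s]]]]
        have "(V \<circ> (\<lambda>s. x + s *\<^sub>R w) has_vector_derivative H (x + s *\<^sub>R w) \<bullet> w) (at s)" .
        then show "((\<lambda>s. V (x + s *\<^sub>R w)) has_real_derivative H (x + s *\<^sub>R w) \<bullet> w) (at s)"
          by (simp add: has_real_derivative_iff_has_vector_derivative o_def)
      next
        have "continuous_on {0..1} (\<lambda>s. H (x + s *\<^sub>R w))"
          by (rule continuous_on_compose2[OF cont]) (auto intro!: continuous_intros inb(1)[simplified])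
        then show "continuous_on {0..1} (\<lambda>s. H (x + s *\<^sub>R w) \<bullet> w)" by (intro continuous_intros)
      qed simp
      also have "\<dots> \<le> (\<integral>\<^sup>+s. g (s *\<^sub>R w) * ennreal (norm w) * indicator {0<..} s \<partial>lborel)"
      proof (rule nn_integral_mono_AE)
        show "AE s in lborel. ennreal \<bar>H (x + s *\<^sub>R w) \<bullet> w\<bar> * indicator {0..1} s \<le> g (s *\<^sub>R w) * ennreal (norm w) * indicator {0<..} s"
          using AE_lborel_singleton[of "0::real"]
        proof eventually_elim
          fix s :: real assume "s \<noteq> 0"
          show "ennreal \<bar>H (x + s *\<^sub>R w) \<bullet> w\<bar> * indicator {0..1} s \<le> g (s *\<^sub>R w) * ennreal (norm w) * indicator {0<..} s"
          proof (cases "0 \<le> s \<and> s \<le> 1")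
            case True
            have "ennreal \<bar>H (x + s *\<^sub>R w) \<bullet> w\<bar> \<le> ennreal (norm (H (x + s *\<^sub>R w)) * norm w)"
              by (intro ennreal_leI Cauchy_Schwarz_ineq2)
            then show ?thesis using True \<open>s \<noteq> 0\<close> inb(2)[of s] by (simp add: g_def ennreal_mult)
          qed simp
        qed
      qed
      finally show ?thesis using True by (simp add: ib)
    qed (simp add: ib)
  qed
  also have "\<dots> = ennreal (d ^ ?n / ?n) * (\<integral>\<^sup>+z. g z * ennreal (1 / norm z ^ (?n - 1)) \<partial>lborel)"
    using \<open>d > 0\<close> by (intro nn_integral_dilation) measurable
  also have "(\<integral>\<^sup>+z. g z * ennreal (1 / norm z ^ (?n - 1)) \<partial>lborel) =
    (\<integral>\<^sup>+z. (\<lambda>y. ennreal (norm (H y) / norm (y - x) ^ (?n - 1)) * indicator (ball x d) y) (x + z) \<partial>lborel)"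
    by (intro nn_integral_cong) (simp add: g_def ib mult_ac ennreal_mult'[symmetric])
  also have "\<dots> = (\<integral>\<^sup>+y. ennreal (norm (H y) / norm (y - x) ^ (?n - 1)) * indicator (ball x d) y \<partial>lborel)"
    by (rule nn_integral_shift) measurable
  finally show ?thesis .
qed

text \<open>Inside radius R/K the kernel is a multiple of |z|^(1-n) and has a mass independent of K;
  outside, |z|^(-n) contributes ln K. This logarithm is what later makes the potential exponentially
  integrable.\<close>

lemma nn_integral_log_kernel_le:
  assumes "R > 0" "K \<ge> 1" "DIM('a) \<ge> 2"
  shows "(\<integral>\<^sup>+z. ennreal (min 1 (K * norm z / R) / norm z ^ DIM('a)) * indicator (ball 0 R) z
     \<partial>(lborel :: 'a::euclidean_space measure)) \<le> ennreal (DIM('a) * vball TYPE('a) * (1 + ln K))"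
proof -
  let ?n = "DIM('a)" and ?c = "DIM('a) * vball TYPE('a)"
  have c: "?c \<ge> 0" by simp
  define r where "r = R / K"
  have r: "r > 0" "r \<le> R" using assms by (auto simp: r_def field_simps)
  have Kr: "K / R = 1 / r" by (simp add: r_def)
  have "(\<integral>\<^sup>+z. ennreal (min 1 (K * norm z / R) / norm z ^ ?n) * indicator (ball 0 R) z \<partial>(lborel :: 'a measure))
    \<le> (\<integral>\<^sup>+z. ennreal (1 / r) * (ennreal (1 / norm z ^ (?n - 1)) * indicator (ball 0 r) z) +
        ennreal (1 / norm z ^ ?n) * indicator {z. r < norm z \<and> norm z < R} z \<partial>(lborel :: 'a measure))" (is "nn_integral _ ?lhs \<le> nn_integral _ ?rhs")
  proof (rule nn_integral_mono_AE)
    show "AE z in (lborel :: 'a measure). ?lhs z \<le> ?rhs z"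
      using AE_norm_neq[of r]
    proof eventually_elim
      fix z :: 'a assume zr: "norm z \<noteq> r"
      have nn: "norm z ^ ?n = norm z ^ (?n - 1) * norm z" using power_minus_mult[of ?n "norm z"] by simp
      show "?lhs z \<le> ?rhs z"
      proof (cases "norm z < r")
        case True
        have "min 1 (K * norm z / R) / norm z ^ ?n \<le> (K * norm z / R) / norm z ^ ?n"
          by (intro divide_right_mono) auto
        also have "\<dots> \<le> 1 / r * (1 / norm z ^ (?n - 1))"
          using Kr r by (cases "z = 0") (simp_all add: nn field_simps)
        finally have "ennreal (min 1 (K * norm z / R) / norm z ^ ?n) \<le> ennreal (1 / r) * ennreal (1 / norm z ^ (?n - 1))"
          using r by (subst ennreal_mult'[symmetric]) (auto intro: ennreal_leI)
        then show ?thesis using True r by (simp add: indicator_def)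
      next
        case False
        have "ennreal (min 1 (K * norm z / R) / norm z ^ ?n) \<le> ennreal (1 / norm z ^ ?n)"
          by (intro ennreal_leI divide_right_mono) auto
        then show ?thesis using False zr by (auto simp: indicator_def)
      qed
    qed
  qed
  also have "\<dots> = ennreal (1 / r) * (\<integral>\<^sup>+z. ennreal (1 / norm z ^ (?n - 1)) * indicator (ball 0 r) z \<partial>(lborel :: 'a measure)) +
     (\<integral>\<^sup>+z. ennreal (1 / norm z ^ ?n) * indicator {z. r < norm z \<and> norm z < R} z \<partial>(lborel :: 'a measure))"
    by (subst nn_integral_add) (auto simp: nn_integral_cmult)
  also have "(\<integral>\<^sup>+z. ennreal (1 / norm z ^ (?n - 1)) * indicator (ball 0 r) z \<partial>(lborel :: 'a measure)) = ennreal (?c * r)"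
    by (rule nn_integral_inverse_norm_ball[OF r(1)])
  also have "(\<integral>\<^sup>+z. ennreal (1 / norm z ^ ?n) * indicator {z. r < norm z \<and> norm z < R} z \<partial>(lborel :: 'a measure))
     \<le> ennreal (?c * ln K)"
  proof (cases "r < R")
    case True
    have "R / r = K" using assms by (simp add: r_def)
    then show ?thesis using nn_integral_inverse_norm_shell[OF r(1) True, where 'a='a] by simp
  next
    case False
    then have "{z::'a. r < norm z \<and> norm z < R} = {}" by auto
    then show ?thesis by simp
  qed
  also have "ennreal (1 / r) * ennreal (?c * r) + ennreal (?c * ln K) = ennreal (?c * (1 + ln K))"
    using assms r c by (simp add: ennreal_mult'[symmetric] ennreal_plus[symmetric] distrib_left del: ennreal_plus)
  finally show ?thesis by (simp add: add_left_mono)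
qed

text \<open>The dichotomy \<open>f \<le> \<delta>\<sigma>/\<rho>\<close> or \<open>1/\<rho> < f/(\<delta>\<sigma>)\<close> replaces Young's inequality.\<close>

lemma kernel_young:
  fixes f \<rho> c :: real
  assumes "f \<ge> 0" "\<rho> > 0" "c > 0" "n \<ge> 1"
  shows "f / \<rho> ^ (n - 1) \<le> f ^ n / c ^ (n - 1) + c / \<rho> ^ n"
proof -
  have e: "\<rho> ^ n = \<rho> ^ (n - 1) * \<rho>" "f ^ n = f ^ (n - 1) * f"
    using assms by (cases n; simp)+
  show ?thesis
  proof (cases "f \<le> c / \<rho>")
    case True
    then have "f / \<rho> ^ (n - 1) \<le> (c / \<rho>) / \<rho> ^ (n - 1)"
      using assms by (intro divide_right_mono) auto
    also have "\<dots> = c / \<rho> ^ n" by (simp add: e mult_ac)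
    also have "\<dots> \<le> f ^ n / c ^ (n - 1) + c / \<rho> ^ n" using assms by simp
    finally show ?thesis .
  next
    case False
    then have "1 / \<rho> \<le> f / c" using assms by (simp add: field_simps)
    then have "(1 / \<rho>) ^ (n - 1) \<le> (f / c) ^ (n - 1)" using assms by (intro power_mono) auto
    then have "f * (1 / \<rho>) ^ (n - 1) \<le> f * (f / c) ^ (n - 1)" using assms by (intro mult_left_mono)
    then have "f / \<rho> ^ (n - 1) \<le> f ^ n / c ^ (n - 1)" by (simp add: power_divide e mult_ac)
    moreover have "c / \<rho> ^ n \<ge> 0" using assms by simp
    ultimately show ?thesis by linarith
  qed
qed

text \<open>A pointwise form of Trudinger's inequality. K stands for the value at x of a function
  that is integrable in x by Fubini, and the potential is bounded by a power of its logarithm, the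
  power being the reciprocal of the exponent n/(n-1) in the theorem. The singular kernel is
  truncated at distance R/K, and the mass lost there is paid for by the hypothesis
  \<open>fK\<close>.\<close>

lemma riesz_potential_le:
  fixes f :: "'a::euclidean_space \<Rightarrow> real"
  assumes n: "DIM('a) \<ge> 2" and [measurable]: "f \<in> borel_measurable borel" and f0: "\<And>y. f y \<ge> 0"
    and RK: "0 < d" "d \<le> R" "K \<ge> 1" and "C \<ge> 0"
    and fC: "(\<integral>\<^sup>+y. ennreal (f y ^ DIM('a)) \<partial>lborel) \<le> ennreal C"
    and fK: "(\<integral>\<^sup>+y. ennreal (f y ^ DIM('a) * (R / norm (y - x)) ^ (DIM('a) - 1)) \<partial>lborel) \<le> ennreal K"
  shows "(\<integral>\<^sup>+y. ennreal (f y / norm (y - x) ^ (DIM('a) - 1)) * indicator (ball x d) y \<partial>lborel) \<le>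
    ennreal ((C + 1 + DIM('a) * vball TYPE('a)) * (1 + ln K) powr ((real DIM('a) - 1) / DIM('a)))"
proof -
  let ?n = "DIM('a)" and ?c = "DIM('a) * vball TYPE('a)"
  define L where "L = 1 + ln K"
  have L: "L \<ge> 1" using RK by (simp add: L_def)
  \<comment> \<open>This choice balances the two sides of \<open>kernel_young\<close>: the factor
    \<open>1 / \<delta> ^ (n - 1)\<close> of the energy and the factor \<open>\<delta> * L\<close>
    of the truncated kernel both become \<open>L powr ((n - 1) / n)\<close>.\<close>
  define \<delta> where "\<delta> = L powr (- 1 / ?n)"
  have \<delta>: "\<delta> > 0" using L by (simp add: \<delta>_def)
  have R: "R > 0" using RK by simp
  define D where "D = 1 / \<delta> ^ (?n - 1)"
  have D: "D = L powr ((real ?n - 1) / ?n)"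
  proof -
    have "\<delta> ^ (?n - 1) = L powr (- 1 / ?n * real (?n - 1))"
      using \<delta> by (simp only: powr_realpow[symmetric] powr_powr \<delta>_def)
    then have "D = L powr - (- 1 / ?n * real (?n - 1))"
      unfolding D_def by (simp only: powr_minus_divide)
    also have "- (- 1 / ?n * real (?n - 1)) = (real ?n - 1) / ?n" using n by (simp add: of_nat_diff field_simps)
    finally show ?thesis .
  qed
  have \<delta>L: "\<delta> * L = L powr ((real ?n - 1) / ?n)"
  proof -
    have "\<delta> * L = L powr (- 1 / ?n) * L powr 1" using L by (simp add: \<delta>_def)
    also have "\<dots> = L powr (- 1 / ?n + 1)" by (rule powr_add[symmetric])
    also have "- 1 / ?n + 1 = (real ?n - 1) / ?n" using n by (simp add: field_simps)
    finally show ?thesis .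
  qed
  have D0: "D > 0" using \<delta> by (simp add: D_def)
  have pt: "f y / norm (y - x) ^ (?n - 1) \<le>
      D * (f y ^ ?n + f y ^ ?n * (R / norm (y - x)) ^ (?n - 1) / K) +
      \<delta> * (min 1 (K * norm (y - x) / R) / norm (y - x) ^ ?n)" if "y \<noteq> x" for y
  proof -
    define \<rho> \<sigma> where "\<rho> = norm (y - x)" and "\<sigma> = min 1 (K * \<rho> / R)"
    have \<rho>: "\<rho> > 0" using that by (simp add: \<rho>_def)
    have \<sigma>: "\<sigma> > 0" using \<rho> RK R by (simp add: \<sigma>_def)
    have s: "1 / \<sigma> ^ (?n - 1) \<le> 1 + (R / \<rho>) ^ (?n - 1) / K"
    proof (cases "K * \<rho> / R \<ge> 1")
      case True
      then show ?thesis using \<rho> RK R by (simp add: \<sigma>_def)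
    next
      case False
      \<comment> \<open>Within distance R/K of x the truncation puts K^(n-1) into the denominator;
        one power of K is all that is kept, as the integral in \<open>fK\<close> is at most
        K.\<close>
      have "K \<le> K ^ (?n - 1)" using power_increasing[of 1 "?n - 1" K] n RK by simp
      then have "(R / \<rho>) ^ (?n - 1) / K ^ (?n - 1) \<le> (R / \<rho>) ^ (?n - 1) / K"
        using RK R \<rho> by (intro divide_left_mono) auto
      moreover have "1 / \<sigma> ^ (?n - 1) = (R / \<rho>) ^ (?n - 1) / K ^ (?n - 1)"
        using False by (simp add: \<sigma>_def power_divide power_mult_distrib mult_ac)
      ultimately show ?thesis by simp
    qed
    have "f y / \<rho> ^ (?n - 1) \<le> f y ^ ?n / (\<delta> * \<sigma>) ^ (?n - 1) + \<delta> * \<sigma> / \<rho> ^ ?n"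
      using f0 \<rho> \<delta> \<sigma> n by (intro kernel_young) auto
    also have "f y ^ ?n / (\<delta> * \<sigma>) ^ (?n - 1) = D * (f y ^ ?n * (1 / \<sigma> ^ (?n - 1)))"
      by (simp add: D_def power_mult_distrib)
    also have "\<dots> \<le> D * (f y ^ ?n * (1 + (R / \<rho>) ^ (?n - 1) / K))"
      using s f0 D0 by (intro mult_left_mono) auto
    finally show ?thesis unfolding \<rho>_def[symmetric] \<sigma>_def[symmetric] by (simp add: distrib_left)
  qed
  have gen: "ennreal (D * (A + 1 / K * B) + \<delta> * E) = ennreal D * (ennreal A + ennreal (1 / K) * ennreal B) + ennreal \<delta> * ennreal E"
    if "A \<ge> 0" "B \<ge> 0" "E \<ge> 0" for A B E
    using that D0 \<delta> RK by (simp add: ennreal_mult'[symmetric] ennreal_plus[symmetric] del: ennreal_plus)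
  have "(\<integral>\<^sup>+y. ennreal (f y / norm (y - x) ^ (?n - 1)) * indicator (ball x d) y \<partial>lborel) \<le>
    (\<integral>\<^sup>+y. ennreal D * (ennreal (f y ^ ?n) + ennreal (1 / K) * ennreal (f y ^ ?n * (R / norm (y - x)) ^ (?n - 1))) +
      ennreal \<delta> * (ennreal (min 1 (K * norm (y - x) / R) / norm (y - x) ^ ?n) * indicator (ball x R) y) \<partial>lborel)" (is "nn_integral _ ?lhs \<le> nn_integral _ ?rhs")
  proof (rule nn_integral_mono_AE)
    show "AE y in lborel. ?lhs y \<le> ?rhs y"
      using AE_lborel_singleton[of x]
    proof eventually_elim
      fix y assume "y \<noteq> x"
      show "?lhs y \<le> ?rhs y"
      proof (cases "y \<in> ball x d")
        case True
        then have "y \<in> ball x R" using RK by auto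
        have "ennreal (f y / norm (y - x) ^ (?n - 1)) \<le> ennreal (D * (f y ^ ?n + 1 / K * (f y ^ ?n * (R / norm (y - x)) ^ (?n - 1))) +
          \<delta> * (min 1 (K * norm (y - x) / R) / norm (y - x) ^ ?n))"
          using pt[OF \<open>y \<noteq> x\<close>] by (intro ennreal_leI) simp
        also have "\<dots> = ennreal D * (ennreal (f y ^ ?n) + ennreal (1 / K) * ennreal (f y ^ ?n * (R / norm (y - x)) ^ (?n - 1))) +
          ennreal \<delta> * ennreal (min 1 (K * norm (y - x) / R) / norm (y - x) ^ ?n)"
          by (rule gen) (use f0 RK R in auto)
        finally show ?thesis using True \<open>y \<in> ball x R\<close> by simp
      qed simp
    qed
  qed
  also have "\<dots> = ennreal D * ((\<integral>\<^sup>+y. ennreal (f y ^ ?n) \<partial>lborel) + ennreal (1 / K) * (\<integral>\<^sup>+y. ennreal (f y ^ ?n * (R / norm (y - x)) ^ (?n - 1)) \<partial>lborel)) +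
     ennreal \<delta> * (\<integral>\<^sup>+y. ennreal (min 1 (K * norm (y - x) / R) / norm (y - x) ^ ?n) * indicator (ball x R) y \<partial>lborel)"
    by (simp add: nn_integral_add nn_integral_cmult)
  also have "(\<integral>\<^sup>+y. ennreal (min 1 (K * norm (y - x) / R) / norm (y - x) ^ ?n) * indicator (ball x R) y \<partial>lborel) =
     (\<integral>\<^sup>+z. (\<lambda>y. ennreal (min 1 (K * norm (y - x) / R) / norm (y - x) ^ ?n) * indicator (ball x R) y) (x + z) \<partial>lborel)"
    by (rule nn_integral_shift[symmetric]) measurable
  also have "\<dots> = (\<integral>\<^sup>+z. ennreal (min 1 (K * norm z / R) / norm z ^ ?n) * indicator (ball 0 R) (z::'a) \<partial>lborel)"
    by (intro nn_integral_cong) (auto simp: indicator_def dist_norm)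
  also have "\<dots> \<le> ennreal (?c * L)"
    unfolding L_def by (rule nn_integral_log_kernel_le[OF R \<open>K \<ge> 1\<close> n])
  also have "ennreal D * ((\<integral>\<^sup>+y. ennreal (f y ^ ?n) \<partial>lborel) + ennreal (1 / K) * (\<integral>\<^sup>+y. ennreal (f y ^ ?n * (R / norm (y - x)) ^ (?n - 1)) \<partial>lborel))
       + ennreal \<delta> * ennreal (?c * L)
    \<le> ennreal D * (ennreal C + ennreal (1 / K) * ennreal K) + ennreal \<delta> * ennreal (?c * L)"
    by (intro add_mono mult_left_mono fC fK) auto
  also have "\<dots> = ennreal (D * (C + 1) + \<delta> * (?c * L))"
    using RK L \<open>C \<ge> 0\<close> by (subst gen[symmetric]) auto
  also have "D * (C + 1) + \<delta> * (?c * L) = D * (C + 1) + ?c * (\<delta> * L)" by simp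
  also have "\<dots> = (C + 1 + ?c) * L powr ((real ?n - 1) / ?n)"
    unfolding \<delta>L D by (simp add: algebra_simps)
  finally show ?thesis unfolding L_def by (simp add: add_left_mono mult_left_mono)
qed

section \<open>Ground state representation\<close>

lemma power_minus2_mult: "2 \<le> k \<Longrightarrow> x ^ (k - 2) * x\<^sup>2 = (x ^ k :: 'a::monoid_mult)"
  by (metis le_add_diff_inverse2 power_add)

text \<open>With s = |a| and t = |a + b| one has 2 a.b + |b|^2 = t^2 - s^2, so this is the tangent
  line inequality at s^2 of the convex function w^(n/2). Induction on n keeps all powers
  natural.\<close>

lemma norm_add_power_ge:
  fixes a b :: "'a::real_inner"
  assumes "n \<ge> 2"
  shows "norm a ^ n + n * norm a ^ (n - 2) * (a \<bullet> b) + n / 2 * norm a ^ (n - 2) * (norm b)\<^sup>2 \<le> norm (a + b) ^ n"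
proof -
  define s t where "s = norm a" and "t = norm (a + b)"
  have st: "s \<ge> 0" "t \<ge> 0" by (auto simp: s_def t_def)
  have h: "2 * (a \<bullet> b) + (norm b)\<^sup>2 = t\<^sup>2 - s\<^sup>2"
    unfolding s_def t_def by (simp add: power2_norm_eq_inner inner_add_left inner_add_right inner_commute)
  have key: "s ^ (m + 2) + (m + 2) / 2 * s ^ m * (t\<^sup>2 - s\<^sup>2) \<le> t ^ (m + 2)" for m :: nat
  proof (induction m)
    case 0
    then show ?case by (simp add: power2_eq_square)
  next
    case (Suc m)
    have "s ^ (Suc m + 2) + (Suc m + 2) / 2 * s ^ Suc m * (t\<^sup>2 - s\<^sup>2) \<le> t ^ (Suc m + 2)"
    proof -
      have 1: "(s ^ (m + 2) + (m + 2) / 2 * s ^ m * (t\<^sup>2 - s\<^sup>2)) * t \<le> t ^ (m + 2) * t"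
        using Suc st by (intro mult_right_mono)
      have "s ^ (Suc m + 2) + (Suc m + 2) / 2 * s ^ Suc m * (t\<^sup>2 - s\<^sup>2) \<le>
         (s ^ (m + 2) + (m + 2) / 2 * s ^ m * (t\<^sup>2 - s\<^sup>2)) * t"
      proof -
        have "(s ^ (m + 2) + (m + 2) / 2 * s ^ m * (t\<^sup>2 - s\<^sup>2)) * t - 
           (s ^ (Suc m + 2) + (Suc m + 2) / 2 * s ^ Suc m * (t\<^sup>2 - s\<^sup>2))
           = s ^ m * ((t - s)\<^sup>2 * ((m + 2) / 2 * t + (m + 1) / 2 * s))"
          by (simp add: field_simps power2_eq_square)
        also have "\<dots> \<ge> 0" using st by (intro mult_nonneg_nonneg add_nonneg_nonneg) auto
        finally show ?thesis by simp
      qed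
      also note 1
      finally show ?thesis by (simp add: mult.commute)
    qed
    then show ?case by simp
  qed
  obtain m where n: "n = m + 2" using assms by (metis add.commute le_Suc_ex)
  show ?thesis
    using key[of m] unfolding n s_def[symmetric] t_def[symmetric] h[symmetric] by (simp add: field_simps)
qed

text \<open>If |b| is at most a multiple of |a|, the quadratic term of
  \<open>norm_add_power_ge\<close> already dominates |b|^n. Otherwise |a + b| is nearly |b|, and
  everything on the left is a small fraction of |b|^n.\<close>

lemma norm_add_power_coercive:
  fixes a b :: "'a::real_inner"
  assumes n: "n \<ge> 2"
  shows "norm a ^ n + n * norm a ^ (n - 2) * (a \<bullet> b) +
     (norm a ^ (n - 2) * (norm b)\<^sup>2 + norm b ^ n) / (4 * (4 * n) ^ n) \<le> norm (a + b) ^ n"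
proof -
  \<comment> \<open>Chosen so that n/K = 1/4: Bernoulli's inequality then keeps 3/4 of |b|^n in the
    second case, against 1/8, 1/32 and 1/16 for the three terms on the left.\<close>
  define K where "K = 4 * real n"
  have K: "K \<ge> 8" using n by (simp add: K_def)
  define s r where "s = norm a" and "r = norm b"
  have sr: "s \<ge> 0" "r \<ge> 0" by (auto simp: s_def r_def)
  have Kn: "K ^ n \<ge> K" using power_increasing[of 1 n K] K n by simp
  have pos: "s ^ (n - 2) * r\<^sup>2 \<ge> 0" "r ^ n \<ge> 0" using sr by auto
  show ?thesis
  proof (cases "r \<le> K * s")
    case True
    have "r ^ n = r ^ (n - 2) * r\<^sup>2" by (rule power_minus2_mult[OF n, symmetric])
    also have "\<dots> \<le> (K * s) ^ (n - 2) * r\<^sup>2" using True sr by (intro mult_right_mono power_mono) auto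
    also have "\<dots> \<le> K ^ n * (s ^ (n - 2) * r\<^sup>2)"
      using K sr power_increasing[of "n - 2" n K] by (simp add: power_mult_distrib mult_right_mono mult.assoc)
    finally have "s ^ (n - 2) * r\<^sup>2 + r ^ n \<le> (1 + K ^ n) * (s ^ (n - 2) * r\<^sup>2)" by (simp add: algebra_simps)
    also have "\<dots> \<le> (2 * K ^ n) * (s ^ (n - 2) * r\<^sup>2)" using Kn K pos by (intro mult_right_mono) auto
    finally have "(s ^ (n - 2) * r\<^sup>2 + r ^ n) / (4 * K ^ n) \<le> (2 * K ^ n) * (s ^ (n - 2) * r\<^sup>2) / (4 * K ^ n)"
      using K by (intro divide_right_mono) auto
    also have "\<dots> = s ^ (n - 2) * r\<^sup>2 / 2" using K by simp
    also have "\<dots> \<le> n / 2 * (s ^ (n - 2) * r\<^sup>2)"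
      using n mult_right_mono[of "1/2" "n/2" "s ^ (n - 2) * r\<^sup>2"] pos by simp
    finally have "(s ^ (n - 2) * r\<^sup>2 + r ^ n) / (4 * K ^ n) \<le> n / 2 * s ^ (n - 2) * r\<^sup>2" by (simp add: mult.assoc)
    then show ?thesis using norm_add_power_ge[OF n, of a b] unfolding K_def s_def r_def by linarith
  next
    case False
    then have s: "s \<le> r / K" using K by (simp add: field_simps)
    have rpos: "r > 0" using False sr K by (smt (verit) mult_nonneg_nonneg)
    \<comment> \<open>The estimate of the mixed term gains K^2 from K^(n-1), which requires n \<ge>
      3. For n = 2 the expansion of the square has no error term.\<close>
    show ?thesis
    proof (cases "n = 2")
      case True
      have "(r\<^sup>2 + r\<^sup>2) / (4 * K ^ n) \<le> r\<^sup>2"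
        using Kn K mult_right_mono[of 1 "2 * K ^ n" "r\<^sup>2"] by (simp add: field_simps)
      then show ?thesis using norm_add_power_ge[OF n, of a b] True
        unfolding K_def s_def r_def by simp (use zero_le_power2[of "norm b"] in linarith)
    next
      case False
      then have n3: "n \<ge> 3" using n by simp
      have sK: "s ^ k \<le> r ^ k / K ^ k" for k
        using power_mono[OF s, of k] sr by (simp add: power_divide)
      have "r - s \<le> norm (a + b)"
        unfolding r_def s_def by (metis add.commute norm_diff_ineq)
      then have ge: "r * (1 - 1 / K) \<le> norm (a + b)" using s by (simp add: algebra_simps)
      have "1 - n * (1 / K) \<le> (1 - 1 / K) ^ n"
        using Bernoulli_inequality[of "- (1 / K)" n] K by (simp)
      then have "3 / 4 \<le> (1 - 1 / K) ^ n" using n by (simp add: K_def)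
      then have "3 / 4 * r ^ n \<le> (r * (1 - 1 / K)) ^ n"
        using mult_right_mono[of "3 / 4" "(1 - 1 / K) ^ n" "r ^ n"] pos
        by (simp add: power_mult_distrib mult_ac)
      also have "\<dots> \<le> norm (a + b) ^ n" using ge K sr by (intro power_mono) auto
      finally have A: "3 / 4 * r ^ n \<le> norm (a + b) ^ n" .
      have K2: "K * K \<le> K ^ (n - 1)" using power_increasing[of 2 "n - 1" K] n3 K by (simp add: power2_eq_square)
      have "s ^ n \<le> r ^ n / K ^ n" by (rule sK)
      also have "\<dots> \<le> r ^ n / 8" using Kn K pos by (intro divide_left_mono) auto
      finally have B: "s ^ n \<le> r ^ n / 8" .
      have "s ^ (n - 2) * (a \<bullet> b) \<le> s ^ (n - 2) * (s * r)"
        using sr Cauchy_Schwarz_ineq2[of a b] by (intro mult_left_mono) (auto simp: s_def r_def)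
      also have "\<dots> = s ^ (n - 1) * r"
      proof -
        have "n - 1 = Suc (n - 2)" using n by simp
        then show ?thesis by simp
      qed
      also have "\<dots> \<le> r ^ (n - 1) / K ^ (n - 1) * r" using sr by (intro mult_right_mono sK) auto
      also have "\<dots> = r ^ n / K ^ (n - 1)" using power_minus_mult[of n r] n by simp
      also have "\<dots> \<le> r ^ n / (K * K)" using K2 K pos by (intro divide_left_mono) auto
      finally have "n * (s ^ (n - 2) * (a \<bullet> b)) \<le> n * (r ^ n / (K * K))" by (intro mult_left_mono) auto
      also have "\<dots> = r ^ n / (4 * K)" using n by (simp add: K_def field_simps)
      also have "\<dots> \<le> r ^ n / 32" using K pos by (intro divide_left_mono) auto
      finally have C: "n * (s ^ (n - 2) * (a \<bullet> b)) \<le> r ^ n / 32" .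
      have "s ^ (n - 2) * r\<^sup>2 \<le> r ^ n"
      proof -
        have "r / K \<le> r" using K rpos by (simp add: divide_le_eq)
        then have "s \<le> r" using s by simp
        then have "s ^ (n - 2) * r\<^sup>2 \<le> r ^ (n - 2) * r\<^sup>2" using sr by (intro mult_right_mono power_mono) auto
        then show ?thesis by (simp only: power_minus2_mult[OF n])
      qed
      then have "(s ^ (n - 2) * r\<^sup>2 + r ^ n) / (4 * K ^ n) \<le> (2 * r ^ n) / (4 * K ^ n)"
        using K by (intro divide_right_mono) auto
      also have "\<dots> \<le> (2 * r ^ n) / (4 * 8)" using Kn K pos by (intro divide_left_mono) auto
      finally have D: "(s ^ (n - 2) * r\<^sup>2 + r ^ n) / (4 * K ^ n) \<le> r ^ n / 16" by simp
      have C': "n * s ^ (n - 2) * (a \<bullet> b) \<le> r ^ n / 32" using C by (simp only: mult.assoc)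
      show ?thesis using A B C' D pos unfolding K_def s_def[symmetric] r_def[symmetric]
        by linarith
    qed
  qed
qed

text \<open>The opposite direction to \<open>norm_add_power_coercive\<close>, for the sharpness
  part. Scalars suffice because for a radial test function the vectors a and b are parallel. Below
  |y| all terms are compared with |y|^n; above it the binomial terms of order at least 2 are all
  bounded by x^(n-2) y^2.\<close>

lemma add_power_le:
  fixes x y :: real
  assumes n: "n \<ge> 2" and x: "x \<ge> 0"
  shows "\<bar>x + y\<bar> ^ n \<le> x ^ n + n * x ^ (n - 1) * y + 4 ^ n * (x ^ (n - 2) * y\<^sup>2 + \<bar>y\<bar> ^ n)"
proof (cases "x \<le> \<bar>y\<bar>")
  case True
  have "\<bar>x + y\<bar> ^ n \<le> (2 * \<bar>y\<bar>) ^ n" using True x by (intro power_mono) auto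
  then have 1: "\<bar>x + y\<bar> ^ n \<le> 2 ^ n * \<bar>y\<bar> ^ n" by (simp add: power_mult_distrib)
  have "x ^ (n - 1) * \<bar>y\<bar> \<le> \<bar>y\<bar> ^ (n - 1) * \<bar>y\<bar>" using True x by (intro mult_right_mono power_mono) auto
  also have "\<dots> = \<bar>y\<bar> ^ n" using n power_minus_mult[of n "\<bar>y\<bar>"] by simp
  finally have "- (x ^ (n - 1) * y) \<le> \<bar>y\<bar> ^ n" using x by (smt (verit) mult_minus_right zero_le_power mult_left_mono)
  then have "n * (- (x ^ (n - 1) * y)) \<le> n * \<bar>y\<bar> ^ n" by (intro mult_left_mono) auto
  moreover have "2 ^ n + real n \<le> 4 ^ n"
  proof -
    have "real n \<le> 2 ^ n" using of_nat_less_two_power[of n] by (simp add: less_imp_le)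
    then have "2 ^ n + real n \<le> 2 * 2 ^ n" by simp
    also have "\<dots> \<le> 2 ^ n * 2 ^ n" using n power_increasing[of 1 n "2::real"] by (intro mult_right_mono) auto
    also have "\<dots> = 4 ^ n" by (simp flip: power_mult_distrib)
    finally show ?thesis .
  qed
  then have "(2 ^ n + real n) * \<bar>y\<bar> ^ n \<le> 4 ^ n * \<bar>y\<bar> ^ n" by (intro mult_right_mono) auto
  moreover have "0 \<le> 4 ^ n * (x ^ (n - 2) * y\<^sup>2)" "x ^ n \<ge> 0" using x by auto
  ultimately show ?thesis using 1 by (simp add: algebra_simps)
next
  case False
  then have xy: "\<bar>y\<bar> \<le> x" "x + y \<ge> 0" by auto
  have "(x + y) ^ n = (\<Sum>k\<le>n. real (n choose k) * y ^ k * x ^ (n - k))"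
    using binomial_ring[of y x n] by (simp add: add.commute)
  also have "{..n} = insert 0 (insert 1 {2..n})" using n by auto
  also have "(\<Sum>k\<in>\<dots>. real (n choose k) * y ^ k * x ^ (n - k)) =
      x ^ n + n * x ^ (n - 1) * y + (\<Sum>k\<in>{2..n}. real (n choose k) * y ^ k * x ^ (n - k))"
    by (simp add: mult_ac)
  also have "(\<Sum>k\<in>{2..n}. real (n choose k) * y ^ k * x ^ (n - k)) \<le> (\<Sum>k\<in>{2..n}. real (n choose k) * (x ^ (n - 2) * y\<^sup>2))"
  proof (rule sum_mono)
    fix k assume k: "k \<in> {2..n}"
    have "y ^ k * x ^ (n - k) \<le> \<bar>y\<bar> ^ k * x ^ (n - k)"
      using x by (intro mult_right_mono) (metis abs_ge_self power_abs, simp)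
    also have "\<dots> = y\<^sup>2 * (\<bar>y\<bar> ^ (k - 2) * x ^ (n - k))"
    proof -
      have "\<bar>y\<bar> ^ k = \<bar>y\<bar>\<^sup>2 * \<bar>y\<bar> ^ (k - 2)" using k power_minus2_mult[of k "\<bar>y\<bar>"] by (simp only: mult.commute) simp
      then show ?thesis by simp
    qed
    also have "\<dots> \<le> y\<^sup>2 * (x ^ (k - 2) * x ^ (n - k))"
      using xy x by (intro mult_left_mono mult_right_mono power_mono) auto
    also have "\<dots> = x ^ (n - 2) * y\<^sup>2" using k by (simp add: mult_ac flip: power_add)
    finally show "real (n choose k) * y ^ k * x ^ (n - k) \<le> real (n choose k) * (x ^ (n - 2) * y\<^sup>2)"
      by (simp add: mult.assoc mult_left_mono)
  qed
  also have "\<dots> = (\<Sum>k\<in>{2..n}. real (n choose k)) * (x ^ (n - 2) * y\<^sup>2)" by (simp add: sum_distrib_right)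
  also have "\<dots> \<le> 4 ^ n * (x ^ (n - 2) * y\<^sup>2)"
  proof (intro mult_right_mono)
    have "(\<Sum>k\<in>{2..n}. real (n choose k)) \<le> (\<Sum>k\<le>n. real (n choose k))"
      by (intro sum_mono2) auto
    also have "\<dots> = 2 ^ n" using choose_row_sum[of n] by (metis of_nat_sum of_nat_numeral of_nat_power)
    also have "\<dots> \<le> 4 ^ n" by (intro power_mono) auto
    finally show "(\<Sum>k\<in>{2..n}. real (n choose k)) \<le> 4 ^ n" .
  qed (use x in auto)
  also have "x ^ n + n * x ^ (n - 1) * y + 4 ^ n * (x ^ (n - 2) * y\<^sup>2) \<le>
    x ^ n + n * x ^ (n - 1) * y + 4 ^ n * (x ^ (n - 2) * y\<^sup>2 + \<bar>y\<bar> ^ n)" by (simp add: distrib_left)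
  finally show ?thesis using xy by simp
qed

text \<open>The derivative of -ln \<tau> along the radius r is 1/(\<tau> r). This integral is where
  the iterated logarithm, and hence \<open>X2\<close>, comes from.\<close>

lemma nn_integral_log_shell:
  assumes "0 < p" "p < q" "q \<le> R"
  shows "(\<integral>\<^sup>+x. ennreal (1 / ((1 - ln (norm x / R)) * norm x ^ DIM('a))) * indicator {x. p < norm x \<and> norm x < q} x
    \<partial>(lborel :: 'a::euclidean_space measure)) =
    ennreal (DIM('a) * vball TYPE('a) * (ln (1 - ln (p / R)) - ln (1 - ln (q / R))))"
proof -
  let ?n = "DIM('a)"
  define f where "f r = 1 / ((1 - ln (r / R)) * r)" for r :: real
  have pos: "1 - ln (r / R) > 0" if "0 < r" "r \<le> R" for r
  proof -
    have "ln (r / R) \<le> 0" using that by (subst ln_le_zero_iff) auto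
    then show ?thesis by simp
  qed
  have R: "R > 0" using assms by simp
  have nn: "norm x ^ ?n = norm x * norm x ^ (?n - 1)" for x :: 'a
    using power_minus_mult[of "?n" "norm x"] by (simp add: mult_ac)
  have "(\<integral>\<^sup>+x. ennreal (1 / ((1 - ln (norm x / R)) * norm x ^ ?n)) * indicator {x. p < norm x \<and> norm x < q} x
    \<partial>(lborel :: 'a measure)) =
    (\<integral>\<^sup>+x. ennreal (f (norm x) / norm x ^ (?n - 1)) * indicator {x. p < norm x \<and> norm x < q} x \<partial>(lborel :: 'a measure))"
    by (intro nn_integral_cong) (simp add: f_def nn mult.assoc)
  also have "\<dots> = ennreal (?n * vball TYPE('a) * (- ln (1 - ln (q / R)) - (- ln (1 - ln (p / R)))))"
  proof (rule nn_integral_radial_FTC[where F="\<lambda>r. - ln (1 - ln (r / R))"])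
    show "f \<in> borel_measurable borel" unfolding f_def by measurable
    fix r assume r: "p < r" "r < q"
    have r0: "0 < r" "r \<le> R" using r assms by auto
    show "((\<lambda>r. - ln (1 - ln (r / R))) has_real_derivative f r) (at r)"
      using pos[OF r0] r0 R by (auto intro!: derivative_eq_intros simp: f_def field_simps)
    show "isCont f r"
      unfolding f_def using pos[OF r0] r0 R by (auto intro!: continuous_intros)
    show "0 \<le> f r" using pos[OF r0] r0 by (simp add: f_def)
  next
    show "((\<lambda>r. - ln (1 - ln (r / R))) \<longlongrightarrow> - ln (1 - ln (p / R))) (at_right p)"
      using pos[of p] assms R by (intro tendsto_intros) auto
    show "((\<lambda>r. - ln (1 - ln (r / R))) \<longlongrightarrow> - ln (1 - ln (q / R))) (at_left q)"
      using pos[of q] assms R by (intro tendsto_intros) auto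
  qed (use assms in auto)
  finally show ?thesis by (simp add: add.commute)
qed

lemma filterlim_log_at_top_at_right_0:
  assumes "R > 0"
  shows "filterlim (\<lambda>r::real. 1 - ln (r / R)) at_top (at_right 0)"
proof -
  have "filterlim (\<lambda>r::real. 1 / R * r) (at_right 0) (at_right 0)"
  proof (rule tendsto_imp_filterlim_at_right)
    show "((\<lambda>r::real. 1 / R * r) \<longlongrightarrow> 0) (at_right 0)" by (intro tendsto_mult_right_zero tendsto_ident_at)
    show "\<forall>\<^sub>F r::real in at_right 0. 0 < 1 / R * r"
      by (rule eventually_mono[OF eventually_at_right_less[of "0::real"]]) (intro mult_pos_pos, simp_all add: assms)
  qed
  then have "filterlim (\<lambda>r::real. ln (1 / R * r)) at_bot (at_right 0)"
    by (rule filterlim_compose[OF ln_at_0])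
  then have "filterlim (\<lambda>r::real. - ln (r / R)) at_top (at_right 0)"
    by (subst filterlim_uminus_at_top) simp
  from filterlim_tendsto_add_at_top[OF tendsto_const[of 1] this] show ?thesis by simp
qed

text \<open>The antiderivative 1/\<tau> tends to 0 at the origin. As \<tau> \<ge> 1 and n \<ge> 2,
  this density dominates the Hardy density of a bounded function.\<close>

lemma integrable_log_sq_ball:
  assumes R: "R > 0"
  shows "integrable (lborel :: 'a::euclidean_space measure)
    (\<lambda>x. indicator (ball 0 R) x / ((1 - ln (norm x / R))\<^sup>2 * norm x ^ DIM('a)))"
proof -
  let ?n = "DIM('a)"
  define f where "f r = 1 / ((1 - ln (r / R))\<^sup>2 * r)" for r :: real
  have pos: "1 - ln (r / R) > 0" if "0 < r" "r \<le> R" for r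
  proof -
    have "ln (r / R) \<le> 0" using that by (subst ln_le_zero_iff) auto
    then show ?thesis by simp
  qed
  have nn: "norm x ^ ?n = norm x * norm x ^ (?n - 1)" for x :: 'a
    using power_minus_mult[of "?n" "norm x"] by (simp add: mult_ac)
  have "(\<integral>\<^sup>+x. ennreal (indicator (ball 0 R) x / ((1 - ln (norm x / R))\<^sup>2 * norm x ^ ?n)) \<partial>(lborel :: 'a measure)) =
    (\<integral>\<^sup>+x. ennreal (f (norm x) / norm x ^ (?n - 1)) * indicator {x. 0 < norm x \<and> norm x < R} x \<partial>(lborel :: 'a measure))"
    by (rule nn_integral_cong_AE, use AE_norm_neq[of 0] in eventually_elim)
       (auto simp: f_def nn indicator_def mult.assoc)
  also have "\<dots> = ennreal (?n * vball TYPE('a) * (1 / (1 - ln (R / R)) - 0))"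
  proof (rule nn_integral_radial_FTC[where F="\<lambda>r. 1 / (1 - ln (r / R))"])
    show "f \<in> borel_measurable borel" unfolding f_def by measurable
    fix r assume r: "0 < r" "r < R"
    then have r0: "0 < r" "r \<le> R" by auto
    show "((\<lambda>r. 1 / (1 - ln (r / R))) has_real_derivative f r) (at r)"
      using pos[OF r0] r0 R by (auto intro!: derivative_eq_intros simp: f_def field_simps power2_eq_square)
    show "isCont f r"
      unfolding f_def using pos[OF r0] r0 R by (auto intro!: continuous_intros)
    show "0 \<le> f r" using r0 by (simp add: f_def)
  next
    show "((\<lambda>r. 1 / (1 - ln (r / R))) \<longlongrightarrow> 0) (at_right 0)"
      by (intro tendsto_divide_0[OF tendsto_const] filterlim_at_top_imp_at_infinity filterlim_log_at_top_at_right_0 R)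
    show "((\<lambda>r. 1 / (1 - ln (r / R))) \<longlongrightarrow> 1 / (1 - ln (R / R))) (at_left R)"
      using pos[of R] R by (intro tendsto_intros) auto
  qed (use R in auto)
  finally have "(\<integral>\<^sup>+x. ennreal (norm (indicator (ball 0 R) x / ((1 - ln (norm x / R))\<^sup>2 * norm x ^ ?n))) \<partial>(lborel :: 'a measure)) < \<infinity>"
    by (simp add: abs_mult indicator_def if_distrib cong: if_cong)
  then show ?thesis
    by (rule integrableI_bounded[rotated]) measurable
qed

section \<open>Derivatives of powers and of the logarithm of the norm\<close>

lemma has_real_derivative_abs:
  assumes "t \<noteq> 0"
  shows "(abs has_real_derivative sgn t) (at t)"
proof -
  have "(*) (sgn t) = (\<lambda>h. h * sgn t)" by (simp add: fun_eq_iff mult.commute)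
  then show ?thesis
    using has_derivative_norm[of t] assms by (simp add: has_field_derivative_def real_norm_def[abs_def])
qed

lemma has_real_derivative_abs_power:
  assumes "n \<ge> 2"
  shows "((\<lambda>t::real. \<bar>t\<bar> ^ n) has_real_derivative n * \<bar>t\<bar> ^ (n - 2) * t) (at t)"
proof (cases "t = 0")
  case True
  have "((\<lambda>t::real. \<bar>t\<bar> ^ (n - 1)) \<longlongrightarrow> \<bar>0\<bar> ^ (n - 1)) (at 0)" by (intro tendsto_intros)
  then have "((\<lambda>t::real. \<bar>t\<bar> ^ (n - 1)) \<longlongrightarrow> 0) (at 0)" using assms by (simp add: zero_power)
  then have "((\<lambda>t::real. \<bar>t\<bar> ^ n / t) \<longlongrightarrow> 0) (at 0)"
  proof (rule Lim_null_comparison[rotated])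
    show "\<forall>\<^sub>F t::real in at 0. norm (\<bar>t\<bar> ^ n / t) \<le> \<bar>t\<bar> ^ (n - 1)"
    proof (intro always_eventually allI)
      fix t :: real
      have "\<bar>t\<bar> ^ n = \<bar>t\<bar> ^ (n - 1) * \<bar>t\<bar>" using assms power_minus_mult[of n "\<bar>t\<bar>"] by simp
      then show "norm (\<bar>t\<bar> ^ n / t) \<le> \<bar>t\<bar> ^ (n - 1)" by (cases "t = 0") (auto simp: abs_mult power_abs)
    qed
  qed
  then show ?thesis using True assms by (simp add: has_field_derivative_iff zero_power)
next
  case False
  have s: "\<bar>t\<bar> ^ (n - 1) * sgn t = \<bar>t\<bar> ^ (n - 2) * t"
  proof -
    have "n - 1 = Suc (n - 2)" using assms by simp
    then show ?thesis by (auto simp: sgn_if)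
  qed
  from DERIV_power[OF has_real_derivative_abs[OF False], of n] have "((\<lambda>t::real. \<bar>t\<bar> ^ n) has_real_derivative n * (\<bar>t\<bar> ^ (n - 1) * sgn t)) (at t)"
    by (simp add: mult_ac)
  then show ?thesis unfolding s by (simp add: mult.assoc)
qed

lemma has_derivative_log_norm:
  fixes x :: "'a::euclidean_space"
  assumes "x \<noteq> 0" "R > 0"
  shows "((\<lambda>x. 1 - ln (norm x / R)) has_derivative (\<lambda>h. - (x \<bullet> h) / (norm x)\<^sup>2)) (at x)"
proof -
  have nx: "norm x > 0" using assms by simp
  have n: "(norm has_derivative (\<lambda>h. (x \<bullet> h) / norm x)) (at x)"
    using has_derivative_norm[OF assms(1)] by (simp add: inner_commute sgn_div_norm divide_inverse mult.commute)
  show ?thesis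
    using nx assms by (auto intro!: derivative_eq_intros n simp: field_simps power2_eq_square)
qed

text \<open>The domain is gone: u is extended by zero and only R survives. The gap between \<rho>
  and R makes u vanish near the sphere of radius R and beyond, so the values of the logarithmic
  weight out there, where it falls below 1 and eventually becomes negative, never enter.\<close>

locale leray =
  fixes R \<rho> :: real and u :: "'a::euclidean_space \<Rightarrow> real" and G :: "'a \<Rightarrow> 'a"
  assumes dim: "DIM('a) \<ge> 2" and \<rho>: "0 < \<rho>" "\<rho> < R"
    and der: "\<And>x. (u has_derivative (\<lambda>h. G x \<bullet> h)) (at x)"
    and contG: "continuous_on UNIV G"
    and supp: "\<And>x. norm x \<ge> \<rho> \<Longrightarrow> u x = 0"
begin

text \<open>With the ground state \<open>w = \<tau> powr \<theta>\<close> and \<open>u = w v\<close>, the gradient of \<open>u\<close> splits into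
  \<open>a = v \<nabla>w\<close> and \<open>b = w \<nabla>v\<close>; \<open>H\<close> is \<open>\<nabla>v\<close>.\<close>

definition "\<theta> = (real DIM('a) - 1) / real DIM('a)"
definition "\<tau> x = 1 - ln (norm x / R)" for x :: 'a
definition "a x = - ((\<theta> * u x / (\<tau> x * (norm x)\<^sup>2)) *\<^sub>R x)"
definition "b x = G x - a x"
definition "v x = u x * \<tau> x powr - \<theta>"
definition "H x = \<tau> x powr - \<theta> *\<^sub>R b x"

lemma R: "R > 0" using \<rho> by simp

lemma \<theta>: "0 < \<theta>" "\<theta> < 1" "1 / 2 \<le> \<theta>" "\<theta> * real DIM('a) = real (DIM('a) - 1)"
  using dim by (auto simp: \<theta>_def field_simps of_nat_diff)

text \<open>At the origin this rests on the default value of \<open>ln 0\<close>.\<close>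

lemma \<tau>_ge_1: "norm x \<le> R \<Longrightarrow> \<tau> x \<ge> 1"
  using R by (cases "x = 0") (auto simp: \<tau>_def)

lemma cont_u: "continuous_on UNIV u"
  using der by (auto intro!: continuous_at_imp_continuous_on has_derivative_continuous)

lemma G_eq_0: assumes "norm x > \<rho>" shows "G x = 0"
proof -
  have "((\<lambda>_. 0) has_derivative (\<lambda>h. G x \<bullet> h)) (at x)"
  proof (rule has_derivative_transform_within_open[OF der])
    show "open {x. norm x > \<rho>}" by (intro open_Collect_less continuous_intros)
  qed (use assms supp in auto)
  then have "(\<lambda>h. G x \<bullet> h) = (\<lambda>h. 0)" by (rule has_derivative_unique) simp
  then have "G x \<bullet> G x = 0" by meson
  then show ?thesis by simp
qed

lemma a_eq_0: "norm x \<ge> \<rho> \<Longrightarrow> a x = 0"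
  by (simp add: a_def supp)

lemma b_eq_0: "norm x > \<rho> \<Longrightarrow> b x = 0"
  by (simp add: b_def a_eq_0 G_eq_0)

lemma G_eq: "G x = a x + b x"
  by (simp add: b_def)

lemma measurable_components [measurable]:
  "u \<in> borel_measurable borel" "G \<in> borel_measurable borel" "\<tau> \<in> borel_measurable borel"
  "a \<in> borel_measurable borel" "b \<in> borel_measurable borel" "v \<in> borel_measurable borel" "H \<in> borel_measurable borel"
proof -
  show [measurable]: "u \<in> borel_measurable borel" "G \<in> borel_measurable borel"
    using cont_u contG by (auto intro: borel_measurable_continuous_onI)
  show [measurable]: "\<tau> \<in> borel_measurable borel" unfolding \<tau>_def by measurable
  show [measurable]: "a \<in> borel_measurable borel" unfolding a_def by measurable
  show [measurable]: "b \<in> borel_measurable borel" unfolding b_def by measurable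
  show "v \<in> borel_measurable borel" unfolding v_def by measurable
  show "H \<in> borel_measurable borel" unfolding H_def by measurable
qed

lemma norm_a: assumes "norm x \<le> R" shows "norm (a x) = \<theta> * \<bar>u x\<bar> / (\<tau> x * norm x)"
  using \<tau>_ge_1[OF assms] \<theta> by (simp add: a_def abs_mult power2_eq_square)

lemma v_deriv: assumes "x \<noteq> 0" shows "(v has_derivative (\<lambda>h. H x \<bullet> h)) (at x)"
proof (cases "norm x < R")
  case True
  have t: "\<tau> x > 0" using \<tau>_ge_1[of x] True by simp
  have nx: "norm x > 0" using assms by simp
  have 1: "(\<tau> has_derivative (\<lambda>h. - (x \<bullet> h) / (norm x)\<^sup>2)) (at x)"
    unfolding \<tau>_def by (rule has_derivative_log_norm[OF assms R])
  have "(v has_derivative (\<lambda>h. u x * (- (x \<bullet> h) / (norm x)\<^sup>2 * (- \<theta> * \<tau> x powr (- \<theta> - 1))) + (G x \<bullet> h) * \<tau> x powr - \<theta>)) (at x)"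
    unfolding v_def
    by (intro has_derivative_mult der DERIV_compose_FDERIV[OF has_real_derivative_powr[OF t] 1])
  also have "(\<lambda>h. u x * (- (x \<bullet> h) / (norm x)\<^sup>2 * (- \<theta> * \<tau> x powr (- \<theta> - 1))) + (G x \<bullet> h) * \<tau> x powr - \<theta>) =
    (\<lambda>h. H x \<bullet> h)"
  proof
    fix h
    have "\<tau> x powr (- \<theta> - 1) = \<tau> x powr - \<theta> / \<tau> x" using t by (simp add: powr_diff)
    then show "u x * (- (x \<bullet> h) / (norm x)\<^sup>2 * (- \<theta> * \<tau> x powr (- \<theta> - 1))) + (G x \<bullet> h) * \<tau> x powr - \<theta> = H x \<bullet> h"
      by (simp add: H_def b_def a_def inner_add_left inner_diff_left algebra_simps power2_eq_square)
  qed
  finally show ?thesis .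
next
  case False
  have "((\<lambda>_. 0) has_derivative (\<lambda>h. H x \<bullet> h)) (at x)"
    using False \<rho> by (simp add: H_def b_eq_0)
  then show ?thesis
  proof (rule has_derivative_transform_within_open)
    show "open {x. norm x > \<rho>}" by (intro open_Collect_less continuous_intros)
    show "x \<in> {x. norm x > \<rho>}" using False \<rho> by simp
  qed (simp add: v_def supp)
qed

lemma cont_H: "continuous_on (- {0}) H"
proof -
  have "continuous_on {x. x \<noteq> 0 \<and> norm x < R} H"
  proof -
    have "ln (norm x / R) \<noteq> 1" "1 - ln (norm x / R) \<noteq> 0" if "norm x < R" for x :: 'a
      using \<tau>_ge_1[of x] that by (auto simp: \<tau>_def)
    then show ?thesis
      unfolding H_def b_def a_def \<tau>_def using R
      by (intro continuous_intros continuous_on_subset[OF contG] continuous_on_subset[OF cont_u]) auto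
  qed
  moreover have "continuous_on {x. norm x > \<rho>} H"
    by (rule continuous_on_eq[of _ "\<lambda>_. 0"]) (auto simp: H_def b_eq_0)
  moreover have "open {x::'a. norm x > \<rho>}" by (intro open_Collect_less continuous_intros)
  moreover have "open {x::'a. x \<noteq> 0 \<and> norm x < R}"
    by (intro open_Collect_conj open_Collect_less open_Collect_neq continuous_intros)
  ultimately have "continuous_on ({x. x \<noteq> 0 \<and> norm x < R} \<union> {x. norm x > \<rho>}) H"
    by (intro continuous_on_open_Un)
  then show ?thesis by (rule continuous_on_subset) (use \<rho> in auto)
qed

lemma u_bounded: "\<exists>M. \<forall>x. \<bar>u x\<bar> \<le> M"
proof -
  have "compact (u ` cball 0 R)"
    by (intro compact_continuous_image continuous_on_subset[OF cont_u]) auto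
  then obtain M where "\<forall>y\<in>u ` cball 0 R. norm y \<le> M"
    using compact_imp_bounded bounded_iff by blast
  then have M: "norm (u x) \<le> M" if "x \<in> cball 0 R" for x using that by blast
  have "\<bar>u x\<bar> \<le> max M 0" for x
    using M[of x] supp[of x] \<rho> by (cases "norm x \<le> R") auto
  then show ?thesis by blast
qed

lemma integrable_a: "integrable lborel (\<lambda>x. norm (a x) ^ DIM('a))"
proof -
  let ?n = "DIM('a)"
  obtain M where M: "\<And>x. \<bar>u x\<bar> \<le> M" using u_bounded by blast
  have M0: "M \<ge> 0" using M[of 0] by simp
  show ?thesis
  proof (rule Bochner_Integration.integrable_bound)
    show "integrable lborel (\<lambda>x::'a. M ^ ?n * (indicator (ball 0 R) x / ((1 - ln (norm x / R))\<^sup>2 * norm x ^ ?n)))"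
      by (intro integrable_mult_right integrable_log_sq_ball R)
    show "AE x in lborel. norm (norm (a x) ^ ?n) \<le> norm (M ^ ?n * (indicator (ball 0 R) x / ((1 - ln (norm x / R))\<^sup>2 * norm x ^ ?n)))"
    proof (rule AE_I2)
      fix x
      show "norm (norm (a x) ^ ?n) \<le> norm (M ^ ?n * (indicator (ball 0 R) x / ((1 - ln (norm x / R))\<^sup>2 * norm x ^ ?n)))"
      proof (cases "norm x < R")
        case True
        have t: "\<tau> x \<ge> 1" using \<tau>_ge_1 True by simp
        have "norm (a x) ^ ?n = (\<theta> * \<bar>u x\<bar>) ^ ?n / (\<tau> x ^ ?n * norm x ^ ?n)"
          using True by (simp add: norm_a power_divide power_mult_distrib)
        also have "\<dots> \<le> M ^ ?n / (\<tau> x ^ ?n * norm x ^ ?n)"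
        proof (intro divide_right_mono power_mono)
          have "\<theta> * \<bar>u x\<bar> \<le> 1 * \<bar>u x\<bar>" using \<theta> by (intro mult_right_mono) auto
          then show "\<theta> * \<bar>u x\<bar> \<le> M" using M[of x] by simp
        qed (use \<theta> t in auto)
        also have "\<dots> \<le> M ^ ?n / ((\<tau> x)\<^sup>2 * norm x ^ ?n)"
        proof (cases "x = 0")
          case False
          have "(\<tau> x)\<^sup>2 \<le> \<tau> x ^ ?n" using power_increasing[OF dim t] .
          moreover have "M \<ge> 0" using M[of x] by simp
          ultimately show ?thesis using t False by (intro divide_left_mono mult_right_mono) auto
        qed (simp add: \<tau>_def)
        finally have "norm (a x) ^ ?n \<le> M ^ ?n / ((\<tau> x)\<^sup>2 * norm x ^ ?n)" .
        then show ?thesis using True M0 by (simp add: \<tau>_def)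
      next
        case False
        then show ?thesis using \<rho> by (simp add: a_eq_0 zero_power)
      qed
    qed
  qed measurable
qed

lemma integrable_G: "integrable lborel (\<lambda>x. norm (G x) ^ DIM('a))"
proof -
  have "integrable lborel (\<lambda>x. indicator (cball 0 R) x *\<^sub>R norm (G x) ^ DIM('a))"
    by (intro borel_integrable_compact continuous_intros continuous_on_subset[OF contG]) auto
  also have "(\<lambda>x. indicator (cball 0 R) x *\<^sub>R norm (G x) ^ DIM('a)) = (\<lambda>x. norm (G x) ^ DIM('a))"
    using \<rho> by (auto simp: indicator_def fun_eq_iff G_eq_0)
  finally show ?thesis .
qed

text \<open>Up to a constant, \<open>cross\<close> is \<open>\<nabla>(\<bar>v\<bar>\<^bsup>N\<^esup>) \<bullet> x / \<bar>x\<bar>\<^bsup>N\<^esup>\<close>, and the field \<open>x / \<bar>x\<bar>\<^bsup>N\<^esup>\<close> is divergence free.\<close>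

definition "cross x = norm (a x) ^ (DIM('a) - 2) * (a x \<bullet> b x)"

lemma measurable_cross [measurable]: "cross \<in> borel_measurable borel"
  unfolding cross_def by measurable

text \<open>b is estimated by G - a, since integrability is known for the n-th powers of these two;
  the mixed product s^(n-1) t is bounded by s^n + t^n.\<close>

lemma integrable_cross: "integrable lborel cross"
proof (rule Bochner_Integration.integrable_bound)
  show "integrable lborel (\<lambda>x. 2 * norm (a x) ^ DIM('a) + norm (G x) ^ DIM('a))"
    by (intro Bochner_Integration.integrable_add integrable_mult_right integrable_a integrable_G)
  show "AE x in lborel. norm (cross x) \<le> norm (2 * norm (a x) ^ DIM('a) + norm (G x) ^ DIM('a))"
  proof (rule AE_I2)
    fix x
    let ?s = "norm (a x)" and ?t = "norm (G x)"
    have N1: "DIM('a) - 1 = Suc (DIM('a) - 2)" "DIM('a) = Suc (DIM('a) - 1)" using dim by auto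
    have p: "?s ^ (DIM('a) - 2) * (?s * r) = ?s ^ (DIM('a) - 1) * r" for r unfolding N1(1) by simp
    have "\<bar>a x \<bullet> b x\<bar> \<le> ?s * norm (b x)" by (rule Cauchy_Schwarz_ineq2)
    also have "\<dots> \<le> ?s * (?t + ?s)" unfolding b_def by (intro mult_left_mono norm_triangle_ineq4) auto
    finally have "norm (cross x) \<le> ?s ^ (DIM('a) - 2) * (?s * (?t + ?s))"
      unfolding cross_def by (simp add: abs_mult mult_left_mono)
    also have "\<dots> = ?s ^ (DIM('a) - 1) * ?t + ?s ^ (DIM('a) - 1) * ?s" unfolding p by (simp add: distrib_left)
    also have "?s ^ (DIM('a) - 1) * ?s = ?s ^ DIM('a)" by (rule power_minus_mult) simp
    also have "?s ^ (DIM('a) - 1) * ?t \<le> ?s ^ DIM('a) + ?t ^ DIM('a)"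
    proof (cases "?s \<le> ?t")
      case True
      then have "?s ^ (DIM('a) - 1) * ?t \<le> ?t ^ (DIM('a) - 1) * ?t" by (intro mult_right_mono power_mono) auto
      also have "\<dots> = ?t ^ DIM('a)" by (rule power_minus_mult) simp
      finally show ?thesis
        using zero_le_power[OF norm_ge_zero, of "a x" "DIM('a)"] zero_le_power[OF norm_ge_zero, of "G x" "DIM('a)"] by linarith
    next
      case False
      then have "?s ^ (DIM('a) - 1) * ?t \<le> ?s ^ (DIM('a) - 1) * ?s" by (intro mult_left_mono) auto
      also have "\<dots> = ?s ^ DIM('a)" by (rule power_minus_mult) simp
      finally show ?thesis
        using zero_le_power[OF norm_ge_zero, of "a x" "DIM('a)"] zero_le_power[OF norm_ge_zero, of "G x" "DIM('a)"] by linarith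
    qed
    finally show "norm (cross x) \<le> norm (2 * norm (a x) ^ DIM('a) + norm (G x) ^ DIM('a))" by simp
  qed
qed measurable

lemma abs_v_le: "\<bar>v x\<bar> \<le> \<bar>u x\<bar>"
proof (cases "norm x < R")
  case True
  then have "\<tau> x powr - \<theta> \<le> 1" using \<tau>_ge_1[of x] \<theta> by (simp add: powr_minus_divide ge_one_powr_ge_zero)
  then show ?thesis unfolding v_def abs_mult by (intro mult_left_le) auto
next
  case False
  then show ?thesis using supp[of x] \<rho> by (simp add: v_def)
qed

lemma \<tau>_at_0: "filterlim \<tau> at_top (at 0)"
proof -
  have "filterlim (norm :: 'a \<Rightarrow> real) (at_right 0) (at 0)"
    by (rule tendsto_imp_filterlim_at_right) (auto intro!: tendsto_eq_intros simp: eventually_at_filter)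
  from filterlim_compose[OF filterlim_log_at_top_at_right_0[OF R] this]
  show ?thesis unfolding \<tau>_def .
qed

text \<open>The flux of x/|x|^n through small spheres does not shrink, so the cross term would leave
  a contribution at the origin unless v vanishes there. The function u need not vanish at 0; the
  factor \<open>\<tau> x powr - \<theta>\<close> does it.\<close>

lemma v_at_0: "(v \<longlongrightarrow> 0) (at 0)"
proof -
  have "((\<lambda>x. \<tau> x powr - \<theta>) \<longlongrightarrow> 0) (at 0)"
    using \<theta> by (intro tendsto_neg_powr \<tau>_at_0) auto
  moreover have "(u \<longlongrightarrow> u 0) (at 0)"
    using cont_u by (simp add: continuous_on_eq_continuous_at isCont_def)
  ultimately have "((\<lambda>x. u x * \<tau> x powr - \<theta>) \<longlongrightarrow> u 0 * 0) (at 0)" by (intro tendsto_mult)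
  then show ?thesis unfolding v_def by simp
qed

text \<open>Here the value of \<theta> matters. For w = \<open>\<tau> powr \<theta>\<close> the
  field w |grad w|^(n-2) grad w carries the power \<theta> + (\<theta> - 1)(n - 1) = 0 of \<tau>, so
  it is a multiple of x/|x|^n.\<close>

lemma \<tau>_powr_power: assumes "norm x \<le> R"
  shows "(\<tau> x powr - \<theta>) ^ DIM('a) = 1 / \<tau> x ^ (DIM('a) - 1)"
proof -
  let ?n = "DIM('a)"
  have t: "\<tau> x > 0" using \<tau>_ge_1[OF assms] by simp
  have "(\<tau> x powr - \<theta>) ^ ?n = \<tau> x powr (- \<theta> * real ?n)"
    using t by (simp add: powr_power mult.commute)
  also have "\<dots> = \<tau> x powr (- real (?n - 1))"
    using \<theta>(4) by (simp only: minus_mult_left[symmetric])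
  also have "\<dots> = 1 / \<tau> x ^ (?n - 1)"
    using t by (simp only: powr_minus_divide powr_realpow)
  finally show ?thesis .
qed

lemma v_power: assumes "norm x \<le> R"
  shows "\<bar>v x\<bar> ^ (DIM('a) - 2) * v x * \<tau> x powr - \<theta> = \<bar>u x\<bar> ^ (DIM('a) - 2) * u x / \<tau> x ^ (DIM('a) - 1)"
proof -
  let ?n = "DIM('a)"
  have t: "\<tau> x > 0" using \<tau>_ge_1[OF assms] by simp
  have "\<bar>v x\<bar> ^ (?n - 2) * v x * \<tau> x powr - \<theta> =
     \<bar>u x\<bar> ^ (?n - 2) * u x * ((\<tau> x powr - \<theta>) ^ (?n - 2) * (\<tau> x powr - \<theta>)\<^sup>2)"
    by (simp add: v_def abs_mult power_mult_distrib power2_eq_square)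
  also have "\<dots> = \<bar>u x\<bar> ^ (?n - 2) * u x * (1 / \<tau> x ^ (?n - 1))"
    by (simp only: power_minus2_mult[OF dim] \<tau>_powr_power[OF assms])
  finally show ?thesis by simp
qed

lemma cont_v: "continuous_on (- {0}) v"
  using v_deriv by (intro continuous_at_imp_continuous_on ballI has_derivative_continuous) auto

lemma v_ray_deriv:
  assumes "x \<noteq> 0" "s > 0"
  shows "((\<lambda>s. v (s *\<^sub>R x)) has_real_derivative H (s *\<^sub>R x) \<bullet> x) (at s)"
proof -
  have "s *\<^sub>R x \<noteq> 0" using assms by simp
  moreover have "((\<lambda>s. s *\<^sub>R x) has_vector_derivative x) (at s)"
    by (auto intro!: derivative_eq_intros)
  ultimately show ?thesis
    using vector_derivative_diff_chain_within[OF _ has_derivative_at_withinI[OF v_deriv], of "\<lambda>s. s *\<^sub>R x" x s UNIV]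
    by (simp add: has_real_derivative_iff_has_vector_derivative o_def)
qed

lemma integral_cross: "(\<integral>x. cross x \<partial>lborel) = 0"
proof -
  let ?n = "DIM('a)"
  define g where "g x = \<bar>v x\<bar> ^ ?n" for x
  define q where "q x = ?n * \<bar>v x\<bar> ^ (?n - 2) * v x * (H x \<bullet> x)" for x
  \<comment> \<open>q is the radial derivative x . grad(|v|^n). All powers of \<tau> cancel, so
    q/|x|^n and \<open>cross\<close> differ by a constant only.\<close>
  have qc: "q x / norm x ^ ?n = - (?n / \<theta> ^ (?n - 1)) * cross x" for x
  proof (cases "norm x < R \<and> x \<noteq> 0")
    case True
    then have nx: "norm x > 0" and xR: "norm x \<le> R" by auto
    have t: "\<tau> x > 0" using \<tau>_ge_1[OF xR] by simp
    have N1: "?n - 1 = Suc (?n - 2)" using dim by auto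
    have "cross x = - (\<theta> ^ (?n - 2) * \<theta> * (\<bar>u x\<bar> ^ (?n - 2) * u x) * (x \<bullet> b x) / (\<tau> x ^ (?n - 2) * \<tau> x * (norm x ^ (?n - 2) * (norm x)\<^sup>2)))"
      unfolding cross_def norm_a[OF xR] by (simp add: a_def power_divide power_mult_distrib mult_ac)
    also have "norm x ^ (?n - 2) * (norm x)\<^sup>2 = norm x ^ ?n" by (rule power_minus2_mult[OF dim])
    also have "\<theta> ^ (?n - 2) * \<theta> = \<theta> ^ (?n - 1)" unfolding N1 by simp
    also have "\<tau> x ^ (?n - 2) * \<tau> x = \<tau> x ^ (?n - 1)" unfolding N1 by simp
    finally have c: "cross x = - (\<theta> ^ (?n - 1) * (\<bar>u x\<bar> ^ (?n - 2) * u x) * (x \<bullet> b x) / (\<tau> x ^ (?n - 1) * norm x ^ ?n))" .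
    have "q x = ?n * (\<bar>v x\<bar> ^ (?n - 2) * v x * \<tau> x powr - \<theta>) * (x \<bullet> b x)"
      by (simp add: q_def H_def inner_commute)
    also have "\<dots> = ?n * (\<bar>u x\<bar> ^ (?n - 2) * u x / \<tau> x ^ (?n - 1)) * (x \<bullet> b x)"
      unfolding v_power[OF xR] ..
    finally show ?thesis unfolding c using \<theta> by simp
  next
    case False
    then show ?thesis using \<rho> by (auto simp: q_def cross_def a_eq_0 H_def b_eq_0 a_def)
  qed
  obtain M where M: "\<And>x. \<bar>u x\<bar> \<le> M" using u_bounded by blast
  have "(\<integral>x. q x / norm x ^ ?n \<partial>lborel) = 0"
  proof (rule integral_radial_derivative_eq_0[where g=g and R=R and M="M ^ ?n"])
    show "g \<in> borel_measurable borel" "q \<in> borel_measurable borel" unfolding g_def q_def by measurable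
    show "integrable lborel (\<lambda>x. q x / norm x ^ ?n)"
      unfolding qc by (intro integrable_mult_right integrable_cross)
    show "\<bar>g x\<bar> \<le> M ^ ?n" for x
      using M[of x] abs_v_le[of x] unfolding g_def by (auto intro!: power_mono simp: order_trans[OF abs_v_le])
    show "g x = 0" if "R \<le> norm x" for x
      using that \<rho> by (simp add: g_def v_def supp)
    show "(g \<longlongrightarrow> 0) (at 0)"
    proof -
      have "((\<lambda>x. \<bar>v x\<bar> ^ ?n) \<longlongrightarrow> \<bar>0\<bar> ^ ?n) (at 0)" by (intro tendsto_intros v_at_0)
      then show ?thesis by (simp add: g_def[abs_def] zero_power)
    qed
    fix x :: 'a assume x: "x \<noteq> 0"
    show "continuous_on {0<..} (\<lambda>s. q (s *\<^sub>R x))"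
    proof -
      have "continuous_on (- {0}) q" unfolding q_def
        by (intro continuous_intros cont_H cont_v)
      then show ?thesis
        by (rule continuous_on_compose2) (use x in \<open>auto intro!: continuous_intros\<close>)
    qed
    fix s :: real assume s: "s > 0"
    from DERIV_chain2[OF has_real_derivative_abs_power[OF dim] v_ray_deriv[OF x s]]
    have "((\<lambda>s. g (s *\<^sub>R x)) has_real_derivative ?n * \<bar>v (s *\<^sub>R x)\<bar> ^ (?n - 2) * v (s *\<^sub>R x) * (H (s *\<^sub>R x) \<bullet> x)) (at s)"
      unfolding g_def .
    then show "((\<lambda>s. g (s *\<^sub>R x)) has_real_derivative q (s *\<^sub>R x) / s) (at s)"
      using s by (simp add: q_def mult_ac)
  qed
  then show ?thesis using \<theta> unfolding qc by simp
qed

text \<open>As \<open>norm (a x) ^ N\<close> is the Hardy integrand with its constant, this is the functional of the theorem.\<close>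

definition "energy = (\<integral>x. norm (G x) ^ DIM('a) \<partial>lborel) - (\<integral>x. norm (a x) ^ DIM('a) \<partial>lborel)"

text \<open>Subtracting the cross term does not change the integral, but it turns the integrand into
  the quantity that \<open>norm_add_power_coercive\<close> bounds below at every point.\<close>

lemma energy_eq:
  "has_bochner_integral lborel (\<lambda>x. norm (a x + b x) ^ DIM('a) - norm (a x) ^ DIM('a) - DIM('a) * cross x) energy"
proof -
  let ?n = "DIM('a)"
  have "has_bochner_integral lborel (\<lambda>x. norm (G x) ^ ?n - norm (a x) ^ ?n - ?n * cross x)
     ((\<integral>x. norm (G x) ^ ?n \<partial>lborel) - (\<integral>x. norm (a x) ^ ?n \<partial>lborel) - ?n * (\<integral>x. cross x \<partial>lborel))"
    by (intro has_bochner_integral_diff has_bochner_integral_mult_right has_bochner_integral_integrable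
        integrable_a integrable_G integrable_cross)
  then show ?thesis by (simp only: energy_def integral_cross G_eq mult_zero_right diff_zero)
qed

section \<open>Coercivity of the energy\<close>

definition "remainder =
  (\<integral>\<^sup>+x. ennreal (norm (a x) ^ (DIM('a) - 2) * (norm (b x))\<^sup>2 + norm (b x) ^ DIM('a)) \<partial>lborel)"

lemma remainder_le_energy:
  "remainder \<le> ennreal (4 * (4 * real DIM('a)) ^ DIM('a) * energy)"
proof -
  let ?n = "DIM('a)"
  let ?K = "4 * (4 * real ?n) ^ ?n"
  have K: "?K > 0" by simp
  have pt: "norm (a x) ^ (?n - 2) * (norm (b x))\<^sup>2 + norm (b x) ^ ?n \<le> ?K * (norm (a x + b x) ^ ?n - norm (a x) ^ ?n - ?n * cross x)" for x
  proof -
    have "(norm (a x) ^ (?n - 2) * (norm (b x))\<^sup>2 + norm (b x) ^ ?n) / ?K \<le>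
        norm (a x + b x) ^ ?n - norm (a x) ^ ?n - ?n * cross x"
      using norm_add_power_coercive[OF dim, of "a x" "b x"] unfolding cross_def mult.assoc by linarith
    then show ?thesis using K by (simp only: pos_divide_le_eq mult.commute)
  qed
  have "(\<integral>\<^sup>+x. ennreal (norm (a x) ^ (?n - 2) * (norm (b x))\<^sup>2 + norm (b x) ^ ?n) \<partial>lborel) \<le>
     (\<integral>\<^sup>+x. ennreal (?K * (norm (a x + b x) ^ ?n - norm (a x) ^ ?n - ?n * cross x)) \<partial>lborel)"
    by (intro nn_integral_mono ennreal_leI pt)
  also have "\<dots> = ennreal (\<integral>x. ?K * (norm (a x + b x) ^ ?n - norm (a x) ^ ?n - ?n * cross x) \<partial>lborel)"
  proof (rule nn_integral_eq_integral)
    show "integrable lborel (\<lambda>x. ?K * (norm (a x + b x) ^ ?n - norm (a x) ^ ?n - ?n * cross x))"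
      by (intro integrable_mult_right integrable.intros[OF energy_eq])
    show "AE x in lborel. 0 \<le> ?K * (norm (a x + b x) ^ ?n - norm (a x) ^ ?n - ?n * cross x)"
      by (intro AE_I2 order_trans[OF _ pt]) auto
  qed
  also have "(\<integral>x. ?K * (norm (a x + b x) ^ ?n - norm (a x) ^ ?n - ?n * cross x) \<partial>lborel) = ?K * energy"
    using has_bochner_integral_integral_eq[OF energy_eq] by simp
  finally show ?thesis unfolding remainder_def .
qed

end

section \<open>Pointwise bound\<close>

text \<open>Keeping the sign of t makes the power of order n/2 differentiable at 0 even for n = 2,
  where it is the identity and |t|^(n/2) would have a corner.\<close>

lemma has_real_derivative_signed_power:
  assumes "n \<ge> 2"
  shows "((\<lambda>t::real. t * sqrt (\<bar>t\<bar> ^ (n - 2))) has_real_derivative n / 2 * sqrt (\<bar>t\<bar> ^ (n - 2))) (at t)"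
proof (cases "n = 2")
  case True
  then show ?thesis by simp
next
  case n2: False
  show ?thesis
  proof (cases "t = 0")
    case True
    have "((\<lambda>h::real. sqrt (\<bar>h\<bar> ^ (n - 2))) \<longlongrightarrow> sqrt (\<bar>0\<bar> ^ (n - 2))) (at 0)" by (intro tendsto_intros)
    then have "((\<lambda>h::real. sqrt (\<bar>h\<bar> ^ (n - 2))) \<longlongrightarrow> 0) (at 0)" using assms n2 by (simp add: zero_power)
    then have "((\<lambda>h::real. h * sqrt (\<bar>h\<bar> ^ (n - 2)) / h) \<longlongrightarrow> 0) (at 0)"
      by (rule Lim_transform_eventually) (auto simp: eventually_at_filter)
    then show ?thesis using True assms n2 by (simp add: has_field_derivative_iff zero_power)
  next
    case False
    define m where "m = real (n - 2) / 2"
    have eq: "sqrt (\<bar>s\<bar> ^ (n - 2)) = \<bar>s\<bar> powr m" if "s \<noteq> 0" for s :: real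
      using that by (simp add: m_def powr_half_sqrt[symmetric] powr_realpow[symmetric] powr_powr)
    have m: "1 + m = n / 2" using assms by (simp add: m_def of_nat_diff field_simps)
    have "((\<lambda>s. \<bar>s\<bar> powr m) has_real_derivative (m * \<bar>t\<bar> powr (m - 1)) * sgn t) (at t)"
      by (rule DERIV_chain2[OF has_real_derivative_powr has_real_derivative_abs[OF False]]) (use False in simp)
    from DERIV_mult[OF DERIV_ident this]
    have "((\<lambda>s. s * \<bar>s\<bar> powr m) has_real_derivative 1 * \<bar>t\<bar> powr m + (m * \<bar>t\<bar> powr (m - 1)) * sgn t * t) (at t)" .
    also have "(m * \<bar>t\<bar> powr (m - 1)) * sgn t * t = m * \<bar>t\<bar> powr m"
    proof -
      have "sgn t * t = \<bar>t\<bar>" by (simp add: sgn_if abs_if)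
      then have "(m * \<bar>t\<bar> powr (m - 1)) * sgn t * t = m * \<bar>t\<bar> powr (m - 1) * \<bar>t\<bar>" by (simp only: mult.assoc)
      then show ?thesis using False by (simp add: powr_diff)
    qed
    also have "1 * \<bar>t\<bar> powr m + m * \<bar>t\<bar> powr m = n / 2 * sqrt (\<bar>t\<bar> ^ (n - 2))"
      unfolding eq[OF False] m[symmetric] by (simp add: distrib_right)
    finally have "((\<lambda>s. s * \<bar>s\<bar> powr m) has_real_derivative n / 2 * sqrt (\<bar>t\<bar> ^ (n - 2))) (at t)" .
    then show ?thesis
      by (rule DERIV_cong_ev[THEN iffD1, rotated 3])
         (auto simp: eq intro!: eventually_mono[OF t1_space_nhds[OF False]])
  qed
qed

lemma le_of_square_eq_mult:
  fixes x p q e :: real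
  assumes "x\<^sup>2 = p * q" "p \<ge> 0" "q \<ge> 0" "e > 0"
  shows "x \<le> (e * p + q / e) / 2"
proof (rule power2_le_imp_le)
  have "((e * p + q / e) / 2)\<^sup>2 - p * q = ((e * p - q / e) / 2)\<^sup>2"
    using assms by (simp add: power2_eq_square field_simps)
  also have "\<dots> \<ge> 0" by simp
  finally show "x\<^sup>2 \<le> ((e * p + q / e) / 2)\<^sup>2" using assms(1) by linarith
  show "0 \<le> (e * p + q / e) / 2" using assms by simp
qed

context leray
begin

text \<open>\<open>\<bar>z\<bar> = \<bar>v\<bar>\<^bsup>N/2\<^esup>\<close>; natural powers under the root are used because \<open>0 powr 0 = 0\<close> would
  spoil the case \<open>N = 2\<close>.\<close>

definition "z x = v x * sqrt (\<bar>v x\<bar> ^ (DIM('a) - 2))"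

lemma measurable_z [measurable]: "z \<in> borel_measurable borel"
  unfolding z_def by measurable

lemma v_eq_0: "norm x \<ge> \<rho> \<Longrightarrow> v x = 0"
  by (simp add: v_def supp)

text \<open>The length of the gradient of \<open>z\<close>.\<close>

definition "k x = DIM('a) / 2 * sqrt (\<bar>v x\<bar> ^ (DIM('a) - 2)) * norm (H x)"

lemma measurable_k [measurable]: "k \<in> borel_measurable borel"
  unfolding k_def by measurable

lemma k_nonneg: "k x \<ge> 0"
  by (simp add: k_def)

text \<open>The ray is followed outwards, because its end on the sphere of radius R lies outside the
  support.\<close>

lemma z_le:
  assumes y: "y \<noteq> 0" "norm y < R"
  shows "ennreal \<bar>z y\<bar> \<le> (\<integral>\<^sup>+s. ennreal (k (s *\<^sub>R y) * norm y) * indicator {1..R / norm y} s \<partial>lborel)"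
proof -
  let ?n = "DIM('a)"
  have ny: "norm y > 0" using y by simp
  have q: "1 \<le> R / norm y" using y ny by simp
  let ?f' = "\<lambda>s. ?n / 2 * sqrt (\<bar>v (s *\<^sub>R y)\<bar> ^ (?n - 2)) * (H (s *\<^sub>R y) \<bullet> y)"
  have "z ((R / norm y) *\<^sub>R y) = 0"
    using ny R \<rho> by (simp add: z_def v_eq_0)
  then have "ennreal \<bar>z y\<bar> = ennreal \<bar>z ((R / norm y) *\<^sub>R y) - z (1 *\<^sub>R y)\<bar>" by simp
  also have "\<dots> \<le> (\<integral>\<^sup>+s. ennreal \<bar>?f' s\<bar> * indicator {1..R / norm y} s \<partial>lborel)"
  proof (rule abs_diff_le_nn_integral[OF q])
    fix s assume "1 \<le> s" "s \<le> R / norm y"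
    then have s: "s > 0" by simp
    show "((\<lambda>s. z (s *\<^sub>R y)) has_real_derivative ?f' s) (at s)"
      unfolding z_def by (rule DERIV_chain2[OF has_real_derivative_signed_power[OF dim] v_ray_deriv[OF y(1) s]])
  next
    have im: "(\<lambda>s. s *\<^sub>R y) ` {1..R / norm y} \<subseteq> - {0}" using y by auto
    have cl: "continuous_on {1..R / norm y} (\<lambda>s. s *\<^sub>R y)" by (intro continuous_intros)
    show "continuous_on {1..R / norm y} ?f'"
      by (intro continuous_intros continuous_on_compose2[OF cont_v cl im] continuous_on_compose2[OF cont_H cl im])
  qed
  also have "\<dots> \<le> (\<integral>\<^sup>+s. ennreal (k (s *\<^sub>R y) * norm y) * indicator {1..R / norm y} s \<partial>lborel)"
  proof (intro nn_integral_mono mult_right_mono ennreal_leI)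
    fix s
    have "\<bar>?f' s\<bar> = ?n / 2 * sqrt (\<bar>v (s *\<^sub>R y)\<bar> ^ (?n - 2)) * \<bar>H (s *\<^sub>R y) \<bullet> y\<bar>"
      by (simp add: abs_mult)
    also have "\<dots> \<le> ?n / 2 * sqrt (\<bar>v (s *\<^sub>R y)\<bar> ^ (?n - 2)) * (norm (H (s *\<^sub>R y)) * norm y)"
      by (intro mult_left_mono Cauchy_Schwarz_ineq2) auto
    finally show "\<bar>?f' s\<bar> \<le> k (s *\<^sub>R y) * norm y" by (simp add: k_def mult.assoc)
  qed simp
  finally show ?thesis .
qed

text \<open>Prepares Cauchy-Schwarz: one factor is the quadratic density in
  \<open>remainder\<close>, the other the density of \<open>nn_integral_log_shell\<close>. In
  |v|^(n-2) |H|^2 the weight \<tau>^(-(n-1)) appears, of which |a|^(n-2) absorbs all but one power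
  of 1/\<tau>.\<close>

lemma k_sq:
  assumes "w \<noteq> 0" "norm w < R"
  shows "(k w / norm w ^ (DIM('a) - 1))\<^sup>2 =
    ((DIM('a) / 2)\<^sup>2 * (norm (a w) ^ (DIM('a) - 2) * (norm (b w))\<^sup>2 / \<theta> ^ (DIM('a) - 2))) * (1 / (\<tau> w * norm w ^ DIM('a)))"
proof -
  let ?n = "DIM('a)"
  have nw: "norm w > 0" using assms by simp
  have t: "\<tau> w > 0" using \<tau>_ge_1[of w] assms by simp
  have \<theta>0: "\<theta> > 0" by (rule \<theta>)
  define p where "p = \<tau> w powr - \<theta>"
  have pN: "p ^ (?n - 2) * p\<^sup>2 = 1 / (\<tau> w ^ (?n - 2) * \<tau> w)"
  proof -
    have "p ^ (?n - 2) * p\<^sup>2 = p ^ ?n" by (rule power_minus2_mult[OF dim])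
    also have "\<dots> = 1 / \<tau> w ^ (?n - 1)"
      unfolding p_def using assms by (intro \<tau>_powr_power) auto
    also have "?n - 1 = Suc (?n - 2)" using dim by simp
    finally show ?thesis by (simp add: mult.commute)
  qed
  have nn: "(norm w ^ (?n - 1))\<^sup>2 = norm w ^ (?n - 2) * norm w ^ ?n"
  proof -
    have "(?n - 1) * 2 = (?n - 2) + ?n" using dim by simp
    then show ?thesis by (simp only: power_mult[symmetric] power_add[symmetric])
  qed
  have pp: "p \<ge> 0" by (simp add: p_def)
  have "(k w / norm w ^ (?n - 1))\<^sup>2 = (?n / 2)\<^sup>2 * (\<bar>v w\<bar> ^ (?n - 2) * (norm (H w))\<^sup>2) / (norm w ^ (?n - 1))\<^sup>2"
    by (simp add: k_def power_mult_distrib power_divide)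
  also have "\<bar>v w\<bar> ^ (?n - 2) * (norm (H w))\<^sup>2 = \<bar>u w\<bar> ^ (?n - 2) * (norm (b w))\<^sup>2 * (p ^ (?n - 2) * p\<^sup>2)"
    using pp by (simp add: v_def H_def p_def[symmetric] abs_mult power_mult_distrib)
  also have "\<dots> = \<bar>u w\<bar> ^ (?n - 2) * (norm (b w))\<^sup>2 / (\<tau> w ^ (?n - 2) * \<tau> w)" by (simp add: pN)
  finally have 1: "(k w / norm w ^ (?n - 1))\<^sup>2 =
     (?n / 2)\<^sup>2 * (\<bar>u w\<bar> ^ (?n - 2) * (norm (b w))\<^sup>2 / (\<tau> w ^ (?n - 2) * \<tau> w)) / (norm w ^ (?n - 2) * norm w ^ ?n)"
    unfolding nn .
  have 2: "norm (a w) ^ (?n - 2) = \<theta> ^ (?n - 2) * \<bar>u w\<bar> ^ (?n - 2) / (\<tau> w ^ (?n - 2) * norm w ^ (?n - 2))"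
    using assms by (simp add: norm_a power_divide power_mult_distrib)
  show ?thesis unfolding 1 2 using \<theta>0 by simp
qed

lemma nn_integral_k_le:
  assumes E: "remainder \<le> ennreal E"
    and "E \<ge> 0" and x: "x \<noteq> 0" "norm x < R"
  shows "(\<integral>\<^sup>+w. ennreal (k w / norm w ^ (DIM('a) - 1)) * indicator {w. norm x / 2 < norm w \<and> norm w < R} w \<partial>lborel)
    \<le> ennreal ((real DIM('a))\<^sup>2 * sqrt (1 + ln (\<tau> x)) * (2 ^ DIM('a) * E + DIM('a) * vball TYPE('a)))"
proof -
  let ?n = "DIM('a)"
  let ?V = "vball TYPE('a)"
  define L where "L = 1 + ln (\<tau> x)"
  have tx: "\<tau> x \<ge> 1" using \<tau>_ge_1 x by simp
  have L: "L \<ge> 1" using tx by (simp add: L_def)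
  \<comment> \<open>The weight in the arithmetic-geometric mean inequality: the two densities have
    integrals of order 1 and L, so e = sqrt L makes both e and L/e equal to sqrt L.\<close>
  define e where "e = sqrt L"
  have e: "e > 0" "L / e = e" using L by (auto simp: e_def real_div_sqrt)
  let ?c = "(real ?n)\<^sup>2" and ?K = "2 ^ ?n :: real"
  let ?A = "{w::'a. norm x / 2 < norm w \<and> norm w < R}"
  let ?h = "\<lambda>w. norm (a w) ^ (?n - 2) * (norm (b w))\<^sup>2 + norm (b w) ^ ?n"
  have pt: "k w / norm w ^ (?n - 1) \<le> ?c * (e * (?K * ?h w)) + ?c / e * (1 / (\<tau> w * norm w ^ ?n))"
    if "w \<in> ?A" for w
  proof -
    have w: "w \<noteq> 0" "norm w < R" using that x by auto
    have t: "\<tau> w > 0" using \<tau>_ge_1[of w] w by simp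
    define A where "A = norm (a w) ^ (?n - 2) * (norm (b w))\<^sup>2"
    define B where "B = 1 / (\<tau> w * norm w ^ ?n)"
    have AB: "A \<ge> 0" "B \<ge> 0" using t by (auto simp: A_def B_def)
    have th0: "\<theta> ^ (?n - 2) > 0" using \<theta> by simp
    have th: "1 / \<theta> ^ (?n - 2) \<le> ?K"
    proof -
      have "(1 / 2) ^ (?n - 2) \<le> \<theta> ^ (?n - 2)" using \<theta> by (intro power_mono) auto
      moreover have "(1 / 2 :: real) ^ ?n \<le> (1 / 2) ^ (?n - 2)" by (intro power_decreasing) auto
      ultimately have "1 / ?K \<le> \<theta> ^ (?n - 2)" by (simp add: power_divide)
      then show ?thesis using th0 by (simp add: field_simps)
    qed
    have "k w / norm w ^ (?n - 1) \<le> (e * ((?n / 2)\<^sup>2 * (A / \<theta> ^ (?n - 2))) + B / e) / 2"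
      using k_sq[OF w] AB th0 e unfolding A_def B_def by (intro le_of_square_eq_mult) auto
    also have "\<dots> \<le> ?c * (e * (?K * A)) + ?c / e * B"
    proof -
      have d1: "(1::real) \<le> ?c" using dim by (simp add: one_le_power)
      have "A / \<theta> ^ (?n - 2) \<le> ?K * A" using mult_right_mono[OF th AB(1)] by simp
      then have "(?n / 2)\<^sup>2 * (A / \<theta> ^ (?n - 2)) \<le> ?c * (?K * A)"
        using AB th0 by (intro mult_mono) (auto simp: power_divide)
      then have i: "e * ((?n / 2)\<^sup>2 * (A / \<theta> ^ (?n - 2))) \<le> e * (?c * (?K * A))"
        using e by (intro mult_left_mono) auto
      have ii: "1 * (B / e) \<le> ?c * (B / e)" using d1 AB e by (intro mult_right_mono) auto
      have iii: "0 \<le> e * (?c * (?K * A))" "0 \<le> B / e" using AB e by auto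
      have "(e * ((?n / 2)\<^sup>2 * (A / \<theta> ^ (?n - 2))) + B / e) / 2 \<le> e * (?c * (?K * A)) + ?c * (B / e)"
      proof -
        have gen: "(X + Y) / 2 \<le> P + Q" if "X \<le> P" "1 * Y \<le> Q" "0 \<le> P" "0 \<le> Y" for X Y P Q :: real
          using that by (simp add: field_simps)
        show ?thesis by (rule gen[OF i ii iii])
      qed
      then show ?thesis by (simp add: mult_ac)
    qed
    also have "\<dots> \<le> ?c * (e * (?K * ?h w)) + ?c / e * B"
      using e by (intro add_right_mono mult_left_mono) (auto simp: A_def)
    finally show ?thesis unfolding B_def .
  qed
  have "(\<integral>\<^sup>+w. ennreal (k w / norm w ^ (?n - 1)) * indicator ?A w \<partial>lborel) \<le>
    (\<integral>\<^sup>+w. ennreal (?c * e * ?K) * ennreal (?h w) + ennreal (?c / e) * (ennreal (1 / ((1 - ln (norm w / R)) * norm w ^ ?n)) * indicator ?A w) \<partial>lborel)" (is "nn_integral _ ?lhs \<le> nn_integral _ ?rhs")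
  proof (rule nn_integral_mono)
    fix w
    show "?lhs w \<le> ?rhs w"
    proof (cases "w \<in> ?A")
      case True
      then have "\<tau> w \<ge> 1" using \<tau>_ge_1 by simp
      have "ennreal (k w / norm w ^ (?n - 1)) \<le> ennreal ((?c * e * ?K) * ?h w + ?c / e * (1 / (\<tau> w * norm w ^ ?n)))"
        using pt[OF True] by (intro ennreal_leI) (simp only: mult.assoc)
      also have "\<dots> = ennreal (?c * e * ?K) * ennreal (?h w) + ennreal (?c / e) * ennreal (1 / (\<tau> w * norm w ^ ?n))"
      proof -
        have "0 \<le> ?c * e * ?K" "0 \<le> ?c / e" "0 \<le> ?h w" "0 \<le> 1 / (\<tau> w * norm w ^ ?n)"
          using e \<open>\<tau> w \<ge> 1\<close> by auto
        then show ?thesis by (simp only: ennreal_plus ennreal_mult mult_nonneg_nonneg)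
      qed
      finally show ?thesis using True by (simp add: \<tau>_def)
    qed simp
  qed
  also have "\<dots> = ennreal (?c * e * ?K) * (\<integral>\<^sup>+w. ennreal (?h w) \<partial>lborel) +
    ennreal (?c / e) * (\<integral>\<^sup>+w. ennreal (1 / ((1 - ln (norm w / R)) * norm w ^ ?n)) * indicator ?A w \<partial>lborel)"
    by (subst nn_integral_add) (auto simp: nn_integral_cmult simp del: ennreal_plus)
  also have "(\<integral>\<^sup>+w. ennreal (1 / ((1 - ln (norm w / R)) * norm w ^ ?n)) * indicator ?A w \<partial>lborel) =
     ennreal (?n * ?V * (ln (1 - ln ((norm x / 2) / R)) - ln (1 - ln (R / R))))"
    using x R by (intro nn_integral_log_shell) auto
  \<comment> \<open>Starting the shell at |x|/2 in place of |x| adds ln 2 to \<tau>, hence at most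
    doubles it, and the extra ln 2 is covered by the 1 in L.\<close>
  also have "?n * ?V * (ln (1 - ln ((norm x / 2) / R)) - ln (1 - ln (R / R))) \<le> ?n * ?V * L"
  proof (intro mult_left_mono)
    have "ln ((norm x / 2) / R) = ln (norm x / R) - ln 2" using x R by (simp add: ln_div ln_mult)
    then have "1 - ln ((norm x / 2) / R) = \<tau> x + ln 2" by (simp add: \<tau>_def)
    also have "\<dots> \<le> 2 * \<tau> x" using tx ln_2_less_1 by simp
    finally have "1 - ln ((norm x / 2) / R) \<le> 2 * \<tau> x" .
    moreover have "1 - ln ((norm x / 2) / R) > 0" using \<open>1 - ln ((norm x / 2) / R) = \<tau> x + ln 2\<close> tx ln_gt_zero[of 2] by linarith
    ultimately have "ln (1 - ln ((norm x / 2) / R)) \<le> ln (2 * \<tau> x)" using tx by (subst ln_le_cancel_iff) auto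
    also have "\<dots> = ln 2 + ln (\<tau> x)" using tx by (simp add: ln_mult)
    also have "\<dots> \<le> L" using ln_2_less_1 by (simp add: L_def)
    finally show "ln (1 - ln ((norm x / 2) / R)) - ln (1 - ln (R / R)) \<le> L" using R by simp
  qed auto
  also have "ennreal (?c * e * ?K) * (\<integral>\<^sup>+w. ennreal (?h w) \<partial>lborel) \<le> ennreal (?c * e * ?K) * ennreal E"
    by (intro mult_left_mono E[unfolded remainder_def]) auto
  also have "ennreal (?c * e * ?K) * ennreal E + ennreal (?c / e) * ennreal (?n * ?V * L) =
     ennreal ((?c * e * ?K) * E + (?c / e) * (?n * ?V * L))"
  proof -
    have "0 \<le> ?c * e * ?K" "0 \<le> ?c / e" "0 \<le> ?n * ?V * L" using e L by auto
    then show ?thesis using \<open>E \<ge> 0\<close> by (simp only: ennreal_plus ennreal_mult mult_nonneg_nonneg)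
  qed
  also have "(?c * e * ?K) * E + (?c / e) * (?n * ?V * L) = ?c * e * (?K * E + ?n * ?V)"
  proof -
    have "(?c / e) * (?n * ?V * L) = ?c * (?n * ?V) * (L / e)" by simp
    then show ?thesis unfolding e(2) by (simp add: algebra_simps)
  qed
  finally show ?thesis unfolding e_def L_def by (simp add: add_mono mult_left_mono ennreal_leI)
qed

text \<open>Averaging \<open>z_le\<close> over the ball around x removes the dependence on single
  rays. The ball lies in the ball of radius 3|x|/2 about the origin, to which
  \<open>nn_integral_dilation\<close> applies, and points further out on its rays have norm above
  |x|/2. The ratio of the radii 3|x|/2 and |x|/2 gives the factor 3^n.\<close>

lemma nn_integral_z_le:
  assumes E: "remainder \<le> ennreal E"
    and "E \<ge> 0" and x: "x \<noteq> 0" "norm x < R"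
  shows "(\<integral>\<^sup>+y. ennreal \<bar>z y\<bar> * indicator (ball x (norm x / 2)) y \<partial>lborel)
    \<le> ennreal ((norm x / 2) ^ DIM('a) * (3 ^ DIM('a) * DIM('a) * (2 ^ DIM('a) * E + DIM('a) * vball TYPE('a))) * sqrt (1 + ln (\<tau> x)))"
proof -
  let ?n = "DIM('a)"
  let ?A = "{w::'a. norm x / 2 < norm w \<and> norm w < R}"
  let ?d = "3 * norm x / 2"
  let ?C = "(real ?n)\<^sup>2 * sqrt (1 + ln (\<tau> x)) * (2 ^ ?n * E + ?n * vball TYPE('a))"
  have nx: "norm x > 0" using x by simp
  define g where "g w = ennreal (k w) * indicator ?A w" for w
  have [measurable]: "g \<in> borel_measurable borel" unfolding g_def by measurable
  have "(\<integral>\<^sup>+y. ennreal \<bar>z y\<bar> * indicator (ball x (norm x / 2)) y \<partial>lborel) \<le>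
    (\<integral>\<^sup>+y. (\<integral>\<^sup>+s. g (s *\<^sub>R y) * ennreal (norm y) * indicator {0<..} s \<partial>lborel) * indicator {y. norm y \<le> ?d} y \<partial>lborel)" (is "nn_integral _ ?lhs \<le> nn_integral _ ?rhs")
  proof (rule nn_integral_mono)
    fix y
    show "?lhs y \<le> ?rhs y"
    proof (cases "y \<in> ball x (norm x / 2) \<and> norm y < R")
      case True
      then have yx: "norm (x - y) < norm x / 2" by (simp add: dist_norm)
      have y: "norm x / 2 < norm y" "norm y \<le> ?d"
        using yx norm_triangle_ineq2[of x y] norm_triangle_ineq2[of y x] by (auto simp: norm_minus_commute)
      then have y0: "y \<noteq> 0" using nx by auto
      have "ennreal \<bar>z y\<bar> \<le> (\<integral>\<^sup>+s. ennreal (k (s *\<^sub>R y) * norm y) * indicator {1..R / norm y} s \<partial>lborel)"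
        using y0 True by (intro z_le) auto
      also have "\<dots> \<le> (\<integral>\<^sup>+s. g (s *\<^sub>R y) * ennreal (norm y) * indicator {0<..} s \<partial>lborel)"
      proof (rule nn_integral_mono)
        fix s
        show "ennreal (k (s *\<^sub>R y) * norm y) * indicator {1..R / norm y} s \<le> g (s *\<^sub>R y) * ennreal (norm y) * indicator {0<..} s"
        proof (cases "1 \<le> s \<and> s \<le> R / norm y")
          case True
          have "1 * norm y \<le> s * norm y" using True by (intro mult_right_mono) auto
          then have 1: "norm x / 2 < norm (s *\<^sub>R y)" using y True by simp
          show ?thesis
          proof (cases "norm (s *\<^sub>R y) < R")
            case True
            then show ?thesis using 1 k_nonneg[of "s *\<^sub>R y"] \<open>1 \<le> s \<and> s \<le> R / norm y\<close>
              by (simp add: g_def ennreal_mult)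
          next
            case False
            then have "k (s *\<^sub>R y) = 0" using \<rho> by (simp add: k_def H_def b_eq_0)
            then show ?thesis by simp
          qed
        qed auto
      qed
      finally show ?thesis using True y by simp
    next
      case False
      then have "ennreal \<bar>z y\<bar> * indicator (ball x (norm x / 2)) y = 0"
        using \<rho> by (auto simp: z_def v_eq_0 indicator_def)
      then show ?thesis by (simp only: zero_le)
    qed
  qed
  also have "\<dots> = ennreal (?d ^ ?n / ?n) * (\<integral>\<^sup>+w. g w * ennreal (1 / norm w ^ (?n - 1)) \<partial>lborel)"
    using nx by (intro nn_integral_dilation) auto
  also have "(\<integral>\<^sup>+w. g w * ennreal (1 / norm w ^ (?n - 1)) \<partial>lborel) =
     (\<integral>\<^sup>+w. ennreal (k w / norm w ^ (?n - 1)) * indicator ?A w \<partial>lborel)"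
    using k_nonneg by (intro nn_integral_cong) (auto simp: g_def indicator_def ennreal_mult[symmetric])
  also have "\<dots> \<le> ennreal ?C"
    by (rule nn_integral_k_le[OF E \<open>E \<ge> 0\<close> x])
  also have "ennreal (?d ^ ?n / ?n) * ennreal ?C = ennreal (?d ^ ?n / ?n * ?C)"
    by (rule ennreal_mult'[symmetric]) simp
  also have "?d ^ ?n / ?n * ?C = (norm x / 2) ^ ?n * (3 ^ ?n * ?n * (2 ^ ?n * E + ?n * vball TYPE('a))) * sqrt (1 + ln (\<tau> x))"
  proof -
    have "?d ^ ?n = 3 ^ ?n * (norm x / 2) ^ ?n"
      by (simp only: power_mult_distrib[symmetric] times_divide_eq_right)
    then show ?thesis by (simp add: power2_eq_square)
  qed
  finally show ?thesis by (simp add: mult_left_mono)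
qed

lemma nn_integral_v_le:
  assumes E: "remainder \<le> ennreal E"
    and "E \<ge> 0" and x: "x \<noteq> 0" "norm x < R"
  shows "(\<integral>\<^sup>+y. ennreal \<bar>v y\<bar> * indicator (ball x (norm x / 2)) y \<partial>lborel)
    \<le> ennreal ((norm x / 2) ^ DIM('a) *
       (vball TYPE('a) + 3 ^ DIM('a) * DIM('a) * (2 ^ DIM('a) * E + DIM('a) * vball TYPE('a))) * (1 + ln (\<tau> x)) powr (1 / DIM('a)))"
proof -
  let ?n = "DIM('a)"
  let ?V = "vball TYPE('a)"
  let ?B = "ball x (norm x / 2)"
  define L where "L = 1 + ln (\<tau> x)"
  have L: "L \<ge> 1" using \<tau>_ge_1[of x] x by (simp add: L_def)
  define l where "l = L powr (1 / ?n)"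
  have l: "l > 0" using L by (simp add: l_def)
  have lN: "l ^ ?n = L" using L by (simp add: l_def powr_power)
  define S where "S = sqrt (l ^ (?n - 2))"
  have S: "S > 0" using l by (simp add: S_def)
  have sL: "sqrt L = l * S"
  proof -
    have "L = l ^ (?n - 2) * l\<^sup>2" unfolding lN[symmetric] by (rule power_minus2_mult[OF dim, symmetric])
    then show ?thesis using l by (simp add: S_def real_sqrt_mult)
  qed
  let ?C = "3 ^ ?n * ?n * (2 ^ ?n * E + ?n * ?V)"
  have C: "?C \<ge> 0" using \<open>E \<ge> 0\<close> by (intro mult_nonneg_nonneg add_nonneg_nonneg) auto
  \<comment> \<open>Cutting at the level l = L^(1/n) replaces Jensen's inequality. Above it |v|
    \<le> |z|/S with S = l^((n-2)/2), and sqrt L = l S turns the mean of |z| into a multiple of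
    l.\<close>
  have pt: "\<bar>v y\<bar> \<le> l + 1 / S * \<bar>z y\<bar>" for y
  proof (cases "\<bar>v y\<bar> \<le> l")
    case True
    moreover have "0 \<le> 1 / S * \<bar>z y\<bar>" using S by simp
    ultimately show ?thesis by linarith
  next
    case False
    then have "S \<le> sqrt (\<bar>v y\<bar> ^ (?n - 2))"
      unfolding S_def using l by (intro real_sqrt_le_mono power_mono) auto
    then have "\<bar>v y\<bar> * S \<le> \<bar>v y\<bar> * sqrt (\<bar>v y\<bar> ^ (?n - 2))" by (intro mult_left_mono) auto
    also have "\<dots> = \<bar>z y\<bar>" by (simp add: z_def abs_mult)
    finally have "\<bar>v y\<bar> \<le> 1 / S * \<bar>z y\<bar>" using S by (simp add: field_simps)
    then show ?thesis using l by linarith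
  qed
  have "(\<integral>\<^sup>+y. ennreal \<bar>v y\<bar> * indicator ?B y \<partial>lborel) \<le>
    (\<integral>\<^sup>+y. ennreal l * indicator ?B y + ennreal (1 / S) * (ennreal \<bar>z y\<bar> * indicator ?B y) \<partial>lborel)" (is "nn_integral _ ?lhs \<le> nn_integral _ ?rhs")
  proof (rule nn_integral_mono)
    fix y
    have "ennreal \<bar>v y\<bar> \<le> ennreal (l + 1 / S * \<bar>z y\<bar>)" by (intro ennreal_leI pt)
    also have "\<dots> = ennreal l + ennreal (1 / S) * ennreal \<bar>z y\<bar>"
      using l S by (subst ennreal_plus) (auto simp: ennreal_mult'[symmetric])
    finally show "?lhs y \<le> ?rhs y"
      by (auto simp: indicator_def)
  qed
  also have "\<dots> = ennreal l * emeasure lborel ?B + ennreal (1 / S) * (\<integral>\<^sup>+y. ennreal \<bar>z y\<bar> * indicator ?B y \<partial>lborel)"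
    by (subst nn_integral_add) (auto simp: nn_integral_cmult)
  also have "emeasure lborel ?B = ennreal (?V * (norm x / 2) ^ ?n)"
    by (rule emeasure_ball) simp
  also have "(\<integral>\<^sup>+y. ennreal \<bar>z y\<bar> * indicator ?B y \<partial>lborel) \<le> ennreal ((norm x / 2) ^ ?n * ?C * sqrt L)"
    unfolding L_def by (rule nn_integral_z_le[OF E \<open>E \<ge> 0\<close> x])
  also have "ennreal l * ennreal (?V * (norm x / 2) ^ ?n) + ennreal (1 / S) * ennreal ((norm x / 2) ^ ?n * ?C * sqrt L)
     = ennreal (l * (?V * (norm x / 2) ^ ?n) + 1 / S * ((norm x / 2) ^ ?n * ?C * sqrt L))"
  proof -
    have "0 \<le> l" "0 \<le> ?V * (norm x / 2) ^ ?n" "0 \<le> 1 / S" "0 \<le> (norm x / 2) ^ ?n * ?C * sqrt L"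
      using l S C L by auto
    then show ?thesis by (simp only: ennreal_plus ennreal_mult mult_nonneg_nonneg)
  qed
  also have "l * (?V * (norm x / 2) ^ ?n) + 1 / S * ((norm x / 2) ^ ?n * ?C * sqrt L) =
    (norm x / 2) ^ ?n * (?V + ?C) * l"
  proof -
    have gen: "l * (V * q) + 1 / S * (q * c * (l * S)) = q * (V + c) * l" for V q c :: real
      using S by (simp add: algebra_simps)
    show ?thesis unfolding sL by (rule gen)
  qed
  finally show ?thesis unfolding l_def L_def by (simp add: add_mono mult_left_mono)
qed

text \<open>Within the ball the norm grows at most by the factor 3/2, which lowers \<tau> by at most
  ln (3/2) \<le> 1/2 \<le> \<tau>/2.\<close>

lemma \<tau>_ball: assumes x: "norm x < R" and y: "y \<in> ball x (norm x / 2)" "norm y < R"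
  shows "\<tau> y powr - \<theta> \<le> 2 * \<tau> x powr - \<theta>"
proof -
  have x0: "norm x > 0" using y(1) by (smt (verit) dist_norm mem_ball norm_ge_zero divide_le_0_iff)
  have yx: "norm (x - y) < norm x / 2" using y by (simp add: dist_norm)
  have ny: "norm x / 2 < norm y" "norm y \<le> norm x * (3 / 2)"
    using yx norm_triangle_ineq2[of x y] norm_triangle_ineq2[of y x] by (auto simp: norm_minus_commute)
  have y0: "norm y > 0" using ny x0 by linarith
  have tx: "\<tau> x \<ge> 1" and ty: "\<tau> y \<ge> 1" using \<tau>_ge_1[of x] \<tau>_ge_1[of y] x y by auto
  have "ln (norm y / R) \<le> ln (norm x / R * (3 / 2))"
    using ny y0 x0 R by (subst ln_le_cancel_iff) (auto simp: field_simps)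
  also have "\<dots> = ln (norm x / R) + ln (3 / 2)" using x0 R by (intro ln_mult_pos) auto
  also have "ln (3 / 2 :: real) \<le> 1 / 2" using ln_le_minus_one[of "3 / 2 :: real"] by simp
  finally have "\<tau> x / 2 \<le> \<tau> y" using tx by (simp add: \<tau>_def)
  then have "\<tau> y powr - \<theta> \<le> (\<tau> x / 2) powr - \<theta>"
    using tx ty \<theta> by (intro powr_mono2') auto
  also have "\<dots> = 2 powr \<theta> * \<tau> x powr - \<theta>"
    using tx by (simp add: powr_divide powr_minus_divide)
  also have "\<dots> \<le> 2 powr 1 * \<tau> x powr - \<theta>"
    using \<theta> by (intro mult_right_mono powr_mono) auto
  finally show ?thesis by simp
qed

text \<open>Depends on the dimension and on E only; this is what makes c in the theorem independent
  of the domain.\<close>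

definition "potential_const E = (2 * (E + 1 + DIM('a) * vball TYPE('a)) +
  (vball TYPE('a) + 3 ^ DIM('a) * DIM('a) * (2 ^ DIM('a) * E + DIM('a) * vball TYPE('a)))) / vball TYPE('a)"

text \<open>Compare v at x with its mean over the ball. The oscillation is a potential of H, which
  \<tau>_ball bounds by \<open>2 * \<tau> x powr - \<theta>\<close> times the potential of b;
  multiplying by \<open>\<tau> x powr \<theta>\<close> to recover u cancels this weight. It remains
  only on the mean, where it meets the n-th root of the iterated logarithm.\<close>

lemma abs_u_le:
  assumes E: "remainder \<le> ennreal E"
    and "E \<ge> 0" and x: "x \<noteq> 0" "norm x < R" and "K \<ge> 1"
    and K: "(\<integral>\<^sup>+y. ennreal (norm (b y) ^ DIM('a) * (R / norm (y - x)) ^ (DIM('a) - 1)) \<partial>lborel) \<le> ennreal K"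
  shows "\<bar>u x\<bar> \<le> potential_const E * ((1 + ln K) powr \<theta> + \<tau> x powr \<theta> * (1 + ln (\<tau> x)) powr (1 / DIM('a)))"
proof -
  let ?n = "DIM('a)"
  let ?B = "ball x (norm x / 2)" and ?V = "vball TYPE('a)"
  define CC where "CC = 3 ^ ?n * ?n * (2 ^ ?n * E + ?n * vball TYPE('a))"
  let ?l = "(1 + ln (\<tau> x)) powr (1 / ?n)"
  define P where "P = (E + 1 + ?n * ?V) * (1 + ln K) powr \<theta>"
  define q where "q = (norm x / 2) ^ ?n"
  have nx: "norm x > 0" using x by simp
  have q: "q > 0" using nx by (simp add: q_def)
  have V: "?V > 0" by simp
  have C: "CC \<ge> 0" unfolding CC_def using \<open>E \<ge> 0\<close> by (intro mult_nonneg_nonneg add_nonneg_nonneg) auto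
  have tx: "\<tau> x \<ge> 1" using \<tau>_ge_1[of x] x by auto
  have P0: "P \<ge> 0" using \<open>E \<ge> 0\<close> unfolding P_def by (intro mult_nonneg_nonneg add_nonneg_nonneg) auto
  have E2: "(\<integral>\<^sup>+y. ennreal (norm (b y) ^ ?n) \<partial>lborel) \<le> ennreal E"
    by (rule order_trans[OF nn_integral_mono E[unfolded remainder_def]]) (intro ennreal_leI, simp)
  have pot: "(\<integral>\<^sup>+y. ennreal (norm (b y) / norm (y - x) ^ (?n - 1)) * indicator ?B y \<partial>lborel) \<le> ennreal P"
    unfolding P_def \<theta>_def
    by (rule riesz_potential_le[OF dim _ _ _ _ \<open>K \<ge> 1\<close> \<open>E \<ge> 0\<close> E2 K]) (use x R in auto)
  have n0: "0 \<notin> ?B" using nx by (simp add: dist_norm)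
  have "(\<integral>\<^sup>+y. ennreal \<bar>v y - v x\<bar> * indicator ?B y \<partial>lborel) \<le> ennreal (q / ?n) *
     (\<integral>\<^sup>+y. ennreal (norm (H y) / norm (y - x) ^ (?n - 1)) * indicator ?B y \<partial>lborel)"
    unfolding q_def
  proof (rule nn_integral_oscillation_le)
    show "(v has_derivative (\<lambda>h. H w \<bullet> h)) (at w)" if "w \<in> ?B" for w
      using that n0 by (intro v_deriv) auto
    show "continuous_on ?B H" by (rule continuous_on_subset[OF cont_H]) (use n0 in auto)
  qed (use nx in auto)
  also have "(\<integral>\<^sup>+y. ennreal (norm (H y) / norm (y - x) ^ (?n - 1)) * indicator ?B y \<partial>lborel) \<le>
    (\<integral>\<^sup>+y. ennreal (2 * \<tau> x powr - \<theta>) * (ennreal (norm (b y) / norm (y - x) ^ (?n - 1)) * indicator ?B y) \<partial>lborel)" (is "nn_integral _ ?lhs \<le> nn_integral _ ?rhs")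
  proof (rule nn_integral_mono)
    fix y
    show "?lhs y \<le> ?rhs y"
    proof (cases "y \<in> ?B")
      case True
      have "norm (H y) \<le> 2 * \<tau> x powr - \<theta> * norm (b y)"
      proof (cases "norm y < R")
        case True
        then show ?thesis using \<tau>_ball[OF x(2) \<open>y \<in> ?B\<close> True] by (simp add: H_def mult_right_mono)
      next
        case False
        then show ?thesis using \<rho> by (simp add: H_def b_eq_0)
      qed
      then have "norm (H y) / norm (y - x) ^ (?n - 1) \<le> 2 * \<tau> x powr - \<theta> * norm (b y) / norm (y - x) ^ (?n - 1)"
        by (intro divide_right_mono) auto
      then show ?thesis using True by (simp add: ennreal_mult'[symmetric] ennreal_leI)
    qed simp
  qed
  also have "\<dots> = ennreal (2 * \<tau> x powr - \<theta>) * (\<integral>\<^sup>+y. ennreal (norm (b y) / norm (y - x) ^ (?n - 1)) * indicator ?B y \<partial>lborel)"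
    by (rule nn_integral_cmult) measurable
  also have "\<dots> \<le> ennreal (2 * \<tau> x powr - \<theta>) * ennreal P"
    by (intro mult_left_mono pot) simp
  also have "ennreal (q / ?n) * (ennreal (2 * \<tau> x powr - \<theta>) * ennreal P) = ennreal (q / ?n * (2 * \<tau> x powr - \<theta> * P))"
    using q P0 by (simp only: ennreal_mult'[symmetric] ennreal_mult[symmetric] mult_nonneg_nonneg powr_ge_zero)
       (simp add: ennreal_mult'[symmetric])
  finally have osc: "(\<integral>\<^sup>+y. ennreal \<bar>v y - v x\<bar> * indicator ?B y \<partial>lborel) \<le> ennreal (q / ?n * (2 * \<tau> x powr - \<theta> * P))"
    by (simp add: mult_left_mono)
  have "ennreal (\<bar>v x\<bar> * (?V * q)) = (\<integral>\<^sup>+y. ennreal \<bar>v x\<bar> * indicator ?B y \<partial>lborel)"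
    using emeasure_ball[of "norm x / 2" x] by (simp add: nn_integral_cmult_indicator ennreal_mult' q_def)
  also have "\<dots> \<le> (\<integral>\<^sup>+y. ennreal \<bar>v y - v x\<bar> * indicator ?B y + ennreal \<bar>v y\<bar> * indicator ?B y \<partial>lborel)"
    by (intro nn_integral_mono) (auto simp: indicator_def ennreal_plus[symmetric] simp del: ennreal_plus intro!: ennreal_leI)
  also have "\<dots> = (\<integral>\<^sup>+y. ennreal \<bar>v y - v x\<bar> * indicator ?B y \<partial>lborel) + (\<integral>\<^sup>+y. ennreal \<bar>v y\<bar> * indicator ?B y \<partial>lborel)"
    by (rule nn_integral_add) measurable
  also have "\<dots> \<le> ennreal (q / ?n * (2 * \<tau> x powr - \<theta> * P)) + ennreal (q * (?V + CC) * ?l)"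
    unfolding q_def CC_def by (intro add_mono osc[unfolded q_def] nn_integral_v_le E \<open>E \<ge> 0\<close> x)
  also have "\<dots> = ennreal (q / ?n * (2 * \<tau> x powr - \<theta> * P) + q * (?V + CC) * ?l)"
    using q P0 C V \<open>E \<ge> 0\<close> by (intro ennreal_plus[symmetric] mult_nonneg_nonneg add_nonneg_nonneg) auto
  finally have "\<bar>v x\<bar> * (?V * q) \<le> q / ?n * (2 * \<tau> x powr - \<theta> * P) + q * (?V + CC) * ?l"
    using q P0 C V by (subst (asm) ennreal_le_iff) (auto intro!: mult_nonneg_nonneg add_nonneg_nonneg)
  \<comment> \<open>The factor 1/n is given away so that both terms share the factor q.\<close>
  also have "\<dots> \<le> q * (2 * \<tau> x powr - \<theta> * P) + q * (?V + CC) * ?l"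
  proof -
    have "q / ?n \<le> q" using q dim by (simp add: divide_le_eq)
    then show ?thesis using P0 by (intro add_right_mono mult_right_mono) auto
  qed
  also have "\<dots> = q * (2 * \<tau> x powr - \<theta> * P + (?V + CC) * ?l)" by (simp add: algebra_simps)
  finally have "q * (\<bar>v x\<bar> * ?V) \<le> q * (2 * \<tau> x powr - \<theta> * P + (?V + CC) * ?l)" by (simp only: mult_ac)
  then have "\<bar>v x\<bar> * ?V \<le> 2 * \<tau> x powr - \<theta> * P + (?V + CC) * ?l" using q by (simp only: mult_le_cancel_left_pos)
  then have "\<tau> x powr \<theta> * (\<bar>v x\<bar> * ?V) \<le> \<tau> x powr \<theta> * (2 * \<tau> x powr - \<theta> * P + (?V + CC) * ?l)"
    by (intro mult_left_mono) auto
  also have "\<tau> x powr \<theta> * (\<bar>v x\<bar> * ?V) = \<bar>u x\<bar> * ?V"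
    using tx by (simp add: v_def abs_mult powr_minus)
  also have "\<tau> x powr \<theta> * (2 * \<tau> x powr - \<theta> * P + (?V + CC) * ?l) = 2 * P + (?V + CC) * (\<tau> x powr \<theta> * ?l)"
    using tx by (simp add: powr_minus distrib_left mult_ac)
  finally have "\<bar>u x\<bar> * ?V \<le> 2 * P + (?V + CC) * (\<tau> x powr \<theta> * ?l)" .
  also have "\<dots> \<le> (2 * (E + 1 + ?n * ?V) + (?V + CC)) * ((1 + ln K) powr \<theta> + \<tau> x powr \<theta> * ?l)"
  proof -
    have gen: "2 * (p * X) + r * Y \<le> (2 * p + r) * (X + Y)" if "p \<ge> 0" "r \<ge> 0" "X \<ge> 0" "Y \<ge> 0" for p r X Y :: real
      using that by (simp add: algebra_simps)
    show ?thesis unfolding P_def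
      by (rule gen) (use C V \<open>E \<ge> 0\<close> in \<open>auto intro!: add_nonneg_nonneg\<close>)
  qed
  finally show ?thesis unfolding potential_const_def CC_def[symmetric] using V by (simp add: field_simps)
qed

section \<open>Exponential integrability\<close>

lemma X1_eq: "x \<noteq> 0 \<Longrightarrow> X1 (norm x / R) = 1 / \<tau> x"
  using R by (simp add: X1_def \<tau>_def)

lemma X2_eq: "x \<noteq> 0 \<Longrightarrow> norm x < R \<Longrightarrow> X2 (norm x / R) = 1 / (1 + ln (\<tau> x))"
  using \<tau>_ge_1[of x] by (simp add: X2_def X1_eq) (simp add: X1_def ln_div)

text \<open>The weight is exactly the power -1/n of 1 + ln \<tau> and cancels the iterated logarithm
  in \<open>abs_u_le\<close>. The exponent 1/\<theta> then undoes both powers \<theta>, and the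
  exponent becomes linear in ln K and in \<tau> = 1 + ln (R/|x|).\<close>

lemma exp_integrand_le:
  assumes E: "remainder \<le> ennreal E"
    and "E \<ge> 0" and x: "x \<noteq> 0" "norm x < R"
    and c: "c \<ge> 0" "2 * c * (2 * potential_const E) powr (1 / \<theta>) \<le> 1"
  shows "ennreal (exp (c * (\<bar>u x\<bar> * X2 (norm x / R) powr (1 / DIM('a))) powr (1 / \<theta>))) \<le>
    3 * (1 + (\<integral>\<^sup>+y. ennreal (norm (b y) ^ DIM('a) * (R / norm (y - x)) ^ (DIM('a) - 1)) \<partial>lborel)
       + ennreal (R ^ (DIM('a) - 1) / norm x ^ (DIM('a) - 1)))"
    (is "_ \<le> 3 * (1 + ?A + _)")
proof (cases "?A = \<infinity>")
  case True
  then show ?thesis by (simp add: ennreal_mult_top)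
next
  case False
  then obtain A where A: "?A = ennreal A" "A \<ge> 0" by (cases ?A) auto
  define K where "K = 1 + A"
  have K: "K \<ge> 1" "?A \<le> ennreal K" using A by (auto simp: K_def intro!: ennreal_leI)
  define L where "L = 1 + ln (\<tau> x)"
  have t: "\<tau> x \<ge> 1" using \<tau>_ge_1[of x] x by simp
  have L: "L \<ge> 1" using t by (simp add: L_def)
  define C where "C = potential_const E"
  have C: "C \<ge> 0" unfolding C_def potential_const_def using \<open>E \<ge> 0\<close>
    by (intro divide_nonneg_nonneg add_nonneg_nonneg mult_nonneg_nonneg) auto
  define \<Lambda> where "\<Lambda> = 1 + ln K"
  have \<Lambda>: "\<Lambda> \<ge> 1" using K by (simp add: \<Lambda>_def)
  have X2: "X2 (norm x / R) powr (1 / DIM('a)) = L powr - (1 / DIM('a))"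
    using X2_eq[OF x] L by (simp add: L_def powr_divide powr_minus_divide)
  have "\<bar>u x\<bar> * L powr - (1 / DIM('a)) \<le> C * (\<Lambda> powr \<theta> + \<tau> x powr \<theta> * L powr (1 / DIM('a))) * L powr - (1 / DIM('a))"
    unfolding C_def \<Lambda>_def L_def
    by (intro mult_right_mono abs_u_le E \<open>E \<ge> 0\<close> x K) auto
  also have "\<dots> = C * (\<Lambda> powr \<theta> * L powr - (1 / DIM('a)) + \<tau> x powr \<theta>)"
    using L by (simp add: algebra_simps powr_minus)
  also have "\<dots> \<le> C * (\<Lambda> powr \<theta> + \<tau> x powr \<theta>)"
  proof (intro mult_left_mono add_right_mono C)
    have "L powr - (1 / DIM('a)) \<le> 1" using L by (simp add: powr_minus_divide ge_one_powr_ge_zero)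
    then show "\<Lambda> powr \<theta> * L powr - (1 / DIM('a)) \<le> \<Lambda> powr \<theta>" by (intro mult_left_le) auto
  qed
  also have "\<dots> \<le> C * ((\<Lambda> + \<tau> x) powr \<theta> + (\<Lambda> + \<tau> x) powr \<theta>)"
    using \<Lambda> t \<theta> by (intro mult_left_mono add_mono powr_mono2 C) auto
  finally have "\<bar>u x\<bar> * X2 (norm x / R) powr (1 / DIM('a)) \<le> (2 * C) * (\<Lambda> + \<tau> x) powr \<theta>"
    unfolding X2 by simp
  then have "(\<bar>u x\<bar> * X2 (norm x / R) powr (1 / DIM('a))) powr (1 / \<theta>) \<le> ((2 * C) * (\<Lambda> + \<tau> x) powr \<theta>) powr (1 / \<theta>)"
    using \<theta> by (intro powr_mono2) auto
  also have "\<dots> = (2 * C) powr (1 / \<theta>) * (\<Lambda> + \<tau> x)"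
    using \<theta> C t \<Lambda> by (simp add: powr_mult powr_powr)
  finally have "c * (\<bar>u x\<bar> * X2 (norm x / R) powr (1 / DIM('a))) powr (1 / \<theta>) \<le> c * ((2 * C) powr (1 / \<theta>) * (\<Lambda> + \<tau> x))"
    using c by (intro mult_left_mono)
  also have "\<dots> = (2 * c * (2 * C) powr (1 / \<theta>)) * ((\<Lambda> + \<tau> x) / 2)" by simp
  also have "\<dots> \<le> 1 * ((\<Lambda> + \<tau> x) / 2)"
    using c t \<Lambda> unfolding C_def by (intro mult_right_mono) auto
  finally have "exp (c * (\<bar>u x\<bar> * X2 (norm x / R) powr (1 / DIM('a))) powr (1 / \<theta>)) \<le> exp ((\<Lambda> + \<tau> x) / 2)" by simp
  \<comment> \<open>The factor 2 in the condition on c is spent here: it leaves the square root of a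
    product, which is below the sum, so K and R/|x| may be integrated separately.\<close>
  also have "\<dots> = exp 1 * sqrt (K * (R / norm x))"
  proof -
    have xR: "R / norm x > 0" using x R by simp
    have "(\<Lambda> + \<tau> x) / 2 = 1 + (ln K + ln (R / norm x)) / 2"
      using x R by (simp add: \<Lambda>_def \<tau>_def ln_div field_simps)
    also have "ln K + ln (R / norm x) = ln (K * (R / norm x))" using K xR by (intro ln_mult_pos[symmetric]) auto
    finally have "exp ((\<Lambda> + \<tau> x) / 2) = exp 1 * exp (ln (K * (R / norm x)) / 2)" by (simp only: exp_add)
    also have "exp (ln (K * (R / norm x)) / 2) = (K * (R / norm x)) powr (1 / 2)"
      using K x R by (simp add: powr_def)
    also have "\<dots> = sqrt (K * (R / norm x))" using mult_pos_pos[OF _ xR, of K] K by (intro powr_half_sqrt) linarith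
    finally show ?thesis .
  qed
  also have "\<dots> \<le> 3 * (K + R / norm x)"
  proof -
    define X where "X = R / norm x"
    have X: "X \<ge> 0" using R by (simp add: X_def)
    have "0 \<le> K * K + X * X + K * X" using K X by (intro add_nonneg_nonneg mult_nonneg_nonneg) auto
    also have "\<dots> = (K + X)\<^sup>2 - K * X" by (simp add: power2_eq_square algebra_simps)
    finally have "sqrt (K * X) \<le> K + X" using K X by (intro real_le_lsqrt) auto
    then show ?thesis unfolding X_def[symmetric] using exp_le K X by (intro mult_mono) auto
  qed
  also have "\<dots> \<le> 3 * (1 + A + R ^ (DIM('a) - 1) / norm x ^ (DIM('a) - 1))"
  proof -
    have "1 \<le> R / norm x" using x by simp
    then have "(R / norm x) ^ 1 \<le> (R / norm x) ^ (DIM('a) - 1)" using dim by (intro power_increasing) auto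
    then show ?thesis by (simp add: K_def power_divide)
  qed
  finally have "ennreal (exp (c * (\<bar>u x\<bar> * X2 (norm x / R) powr (1 / DIM('a))) powr (1 / \<theta>))) \<le>
    ennreal (3 * (1 + A + R ^ (DIM('a) - 1) / norm x ^ (DIM('a) - 1)))" by (rule ennreal_leI)
  also have "\<dots> = 3 * (1 + ?A + ennreal (R ^ (DIM('a) - 1) / norm x ^ (DIM('a) - 1)))"
  proof -
    have "0 \<le> R ^ (DIM('a) - 1) / norm x ^ (DIM('a) - 1)" using R by simp
    then show ?thesis using A(2) unfolding A(1)
      by (simp only: ennreal_mult' ennreal_plus add_nonneg_nonneg zero_le_one zero_le_numeral ennreal_numeral ennreal_1)
  qed
  finally show ?thesis .
qed

text \<open>By Fubini the potential-like term costs the integral of |x - y|^(1-n) over x, uniformly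
  in y: for y in the ball of radius R, where b is supported, that ball lies in
  \<open>ball y (2 * R)\<close>.\<close>

lemma nn_integral_exp_le:
  assumes E: "remainder \<le> ennreal E"
    and "E \<ge> 0"
    and c: "c \<ge> 0" "2 * c * (2 * potential_const E) powr (1 / \<theta>) \<le> 1"
  shows "(\<integral>\<^sup>+x. ennreal (exp (c * (\<bar>u x\<bar> * X2 (norm x / R) powr (1 / DIM('a))) powr (1 / \<theta>))) * indicator (ball 0 R) x \<partial>lborel) \<le>
    ennreal (3 * R ^ DIM('a) * (vball TYPE('a) + DIM('a) * vball TYPE('a) * (2 * E + 1)))"
proof -
  let ?n = "DIM('a)" and ?V = "vball TYPE('a)"
  define A where "A x = (\<integral>\<^sup>+y. ennreal (norm (b y) ^ ?n * (R / norm (y - x)) ^ (?n - 1)) \<partial>lborel)" for x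
  define r where "r x = ennreal (R ^ (?n - 1)) * (ennreal (1 / norm x ^ (?n - 1)))" for x :: 'a
  have Am [measurable]: "A \<in> borel_measurable borel" unfolding A_def by measurable
  have [measurable]: "r \<in> borel_measurable borel" unfolding r_def by measurable
  have Rn: "R ^ (?n - 1) * R = R ^ ?n" by (rule power_minus_mult) simp
  have V: "?V > 0" by simp
  have "(\<integral>\<^sup>+x. ennreal (exp (c * (\<bar>u x\<bar> * X2 (norm x / R) powr (1 / ?n)) powr (1 / \<theta>))) * indicator (ball 0 R) x \<partial>lborel) \<le>
    (\<integral>\<^sup>+x. 3 * (indicator (ball 0 R) x + A x * indicator (ball 0 R) x + r x * indicator (ball 0 R) x) \<partial>lborel)" (is "nn_integral _ ?lhs \<le> nn_integral _ ?rhs")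
  proof (rule nn_integral_mono_AE)
    show "AE x in lborel. ?lhs x \<le> ?rhs x"
      using AE_norm_neq[of 0]
    proof eventually_elim
      fix x :: 'a assume "norm x \<noteq> 0"
      then have x0: "x \<noteq> 0" by simp
      show "?lhs x \<le> ?rhs x"
      proof (cases "norm x < R")
        case True
        have "r x = ennreal (R ^ (?n - 1) / norm x ^ (?n - 1))"
          using R by (simp add: r_def ennreal_mult'[symmetric])
        then show ?thesis using exp_integrand_le[OF E \<open>E \<ge> 0\<close> x0 True c] True by (simp add: A_def)
      qed simp
    qed
  qed
  also have "\<dots> = 3 * (emeasure lborel (ball (0::'a) R) + (\<integral>\<^sup>+x. A x * indicator (ball 0 R) x \<partial>lborel) + (\<integral>\<^sup>+x. r x * indicator (ball 0 R) x \<partial>lborel))"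
    by (simp add: nn_integral_cmult nn_integral_add)
  also have "emeasure lborel (ball (0::'a) R) = ennreal (?V * R ^ ?n)"
    using R by (intro emeasure_ball) simp
  also have "(\<integral>\<^sup>+x. r x * indicator (ball 0 R) x \<partial>lborel) = ennreal (R ^ (?n - 1)) * ennreal (?n * ?V * R)"
    using R unfolding r_def mult.assoc[of "ennreal (R ^ (?n - 1))"]
    by (subst nn_integral_cmult) (simp_all add: nn_integral_inverse_norm_ball[OF R, simplified])
  also have "\<dots> = ennreal (?n * ?V * R ^ ?n)"
    using R by (simp add: ennreal_mult'[symmetric] Rn[symmetric] mult_ac)
  also have "(\<integral>\<^sup>+x. A x * indicator (ball 0 R) x \<partial>lborel) \<le> ennreal (2 * ?n * ?V * R ^ ?n * E)"
  proof -
    have "(\<integral>\<^sup>+x. A x * indicator (ball 0 R) x \<partial>lborel) =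
      (\<integral>\<^sup>+x. (\<integral>\<^sup>+y. ennreal (norm (b y) ^ ?n * (R / norm (y - x)) ^ (?n - 1)) * indicator (ball 0 R) x \<partial>lborel) \<partial>lborel)"
      unfolding A_def by (intro nn_integral_cong nn_integral_multc[symmetric]) measurable
    also have "\<dots> = (\<integral>\<^sup>+y. (\<integral>\<^sup>+x. ennreal (norm (b y) ^ ?n * (R / norm (y - x)) ^ (?n - 1)) * indicator (ball 0 R) x \<partial>lborel) \<partial>lborel)"
      by (rule lborel_pair.Fubini') measurable
    also have "\<dots> \<le> (\<integral>\<^sup>+y. ennreal (2 * ?n * ?V * R ^ ?n) * ennreal (norm (b y) ^ ?n) \<partial>lborel)" (is "_ \<le> nn_integral _ ?rhs")
    proof (rule nn_integral_mono)
      fix y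
      show "(\<integral>\<^sup>+x. ennreal (norm (b y) ^ ?n * (R / norm (y - x)) ^ (?n - 1)) * indicator (ball 0 R) x \<partial>lborel) \<le> ?rhs y"
      proof (cases "norm y < R")
        case True
        let ?q = "norm (b y) ^ ?n * R ^ (?n - 1)"
        have q: "?q \<ge> 0" using R by simp
        have "(\<integral>\<^sup>+x. ennreal (norm (b y) ^ ?n * (R / norm (y - x)) ^ (?n - 1)) * indicator (ball 0 R) x \<partial>lborel) \<le>
          (\<integral>\<^sup>+x. ennreal ?q * (ennreal (1 / norm (x - y) ^ (?n - 1)) * indicator (ball y (2 * R)) x) \<partial>lborel)"
        proof (rule nn_integral_mono)
          fix x
          have "x \<in> ball y (2 * R)" if "norm x < R"
            using that True norm_triangle_ineq4[of y x] by (simp add: dist_norm)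
          then have "indicator (ball 0 R) x \<le> (indicator (ball y (2 * R)) x :: ennreal)" by (auto simp: indicator_def)
          moreover have "ennreal (norm (b y) ^ ?n * (R / norm (y - x)) ^ (?n - 1)) = ennreal ?q * ennreal (1 / norm (x - y) ^ (?n - 1))"
            using q by (simp add: ennreal_mult'[symmetric] norm_minus_commute power_divide)
          ultimately show "ennreal (norm (b y) ^ ?n * (R / norm (y - x)) ^ (?n - 1)) * indicator (ball 0 R) x \<le>
            ennreal ?q * (ennreal (1 / norm (x - y) ^ (?n - 1)) * indicator (ball y (2 * R)) x)"
            by (simp add: mult.assoc mult_left_mono)
        qed
        also have "\<dots> = ennreal ?q * (\<integral>\<^sup>+x. ennreal (1 / norm (x - y) ^ (?n - 1)) * indicator (ball y (2 * R)) x \<partial>lborel)"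
          by (rule nn_integral_cmult) measurable
        also have "(\<integral>\<^sup>+x. ennreal (1 / norm (x - y) ^ (?n - 1)) * indicator (ball y (2 * R)) x \<partial>lborel) =
          (\<integral>\<^sup>+w. (\<lambda>x. ennreal (1 / norm (x - y) ^ (?n - 1)) * indicator (ball y (2 * R)) x) (y + w) \<partial>lborel)"
          by (rule nn_integral_shift[symmetric]) measurable
        also have "\<dots> = (\<integral>\<^sup>+w. ennreal (1 / norm w ^ (?n - 1)) * indicator (ball 0 (2 * R)) (w::'a) \<partial>lborel)"
          by (intro nn_integral_cong) (auto simp: indicator_def dist_norm)
        also have "\<dots> = ennreal (?n * ?V * (2 * R))"
          using R by (intro nn_integral_inverse_norm_ball) simp
        also have "ennreal ?q * \<dots> = ennreal (2 * ?n * ?V * R ^ ?n) * ennreal (norm (b y) ^ ?n)"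
          using R q by (simp add: ennreal_mult'[symmetric] ennreal_mult[symmetric] Rn[symmetric] mult_ac)
        finally show ?thesis .
      next
        case False
        then show ?thesis using \<rho> by (simp add: b_eq_0 zero_power)
      qed
    qed
    also have "\<dots> = ennreal (2 * ?n * ?V * R ^ ?n) * (\<integral>\<^sup>+y. ennreal (norm (b y) ^ ?n) \<partial>lborel)"
      by (rule nn_integral_cmult) measurable
    also have "\<dots> \<le> ennreal (2 * ?n * ?V * R ^ ?n) * ennreal E"
      by (intro mult_left_mono order_trans[OF nn_integral_mono E[unfolded remainder_def]] ennreal_leI) auto
    also have "\<dots> = ennreal (2 * ?n * ?V * R ^ ?n * E)"
      using R by (intro ennreal_mult'[symmetric]) auto
    finally show ?thesis .
  qed
  also have "3 * (ennreal (?V * R ^ ?n) + ennreal (2 * ?n * ?V * R ^ ?n * E) + ennreal (?n * ?V * R ^ ?n)) =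
    ennreal (3 * (?V * R ^ ?n + 2 * ?n * ?V * R ^ ?n * E + ?n * ?V * R ^ ?n))"
  proof -
    have "0 \<le> ?V * R ^ ?n" "0 \<le> 2 * ?n * ?V * R ^ ?n * E" "0 \<le> ?n * ?V * R ^ ?n"
      using R \<open>E \<ge> 0\<close> by auto
    then show ?thesis
      by (simp only: ennreal_mult' ennreal_plus add_nonneg_nonneg zero_le_numeral ennreal_numeral)
  qed
  also have "3 * (?V * R ^ ?n + 2 * ?n * ?V * R ^ ?n * E + ?n * ?V * R ^ ?n) = 3 * R ^ ?n * (?V + ?n * ?V * (2 * E + 1))"
    by (simp add: algebra_simps)
  finally show ?thesis by (simp add: add_mono mult_left_mono)
qed

end

section \<open>From bounded domains to the radial setting\<close>

lemma gradient_eqI: "GDERIV u x :> D \<Longrightarrow> gradient u x = D"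
proof -
  assume D: "GDERIV u x :> D"
  have "D' = D" if "GDERIV u x :> D'" for D'
  proof -
    have "(\<lambda>h. h \<bullet> D') = (\<lambda>h. h \<bullet> D)"
      using D that unfolding gderiv_def by (rule has_derivative_unique[rotated])
    then have "(D' - D) \<bullet> D' = (D' - D) \<bullet> D" by meson
    then have "(D' - D) \<bullet> (D' - D) = 0" by (simp add: inner_diff_right)
    then show ?thesis by simp
  qed
  with D show ?thesis unfolding gradient_def by (rule the_equality)
qed

lemma gradient_has_derivative:
  fixes u :: "'a::euclidean_space \<Rightarrow> real"
  assumes "u differentiable (at x)"
  shows "(u has_derivative (\<lambda>h. gradient u x \<bullet> h)) (at x)"
proof -
  obtain f where f: "(u has_derivative f) (at x)" using assms by (auto simp: differentiable_def)
  then interpret f: bounded_linear f by (rule has_derivative_bounded_linear)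
  define D where "D = (\<Sum>i\<in>Basis. f i *\<^sub>R i)"
  have "f h = h \<bullet> D" for h
  proof -
    have "f h = f (\<Sum>i\<in>Basis. (h \<bullet> i) *\<^sub>R i)" by (simp add: euclidean_representation)
    also have "\<dots> = (\<Sum>i\<in>Basis. (h \<bullet> i) * f i)" by (simp add: f.sum f.scaleR)
    also have "\<dots> = h \<bullet> D" by (simp add: D_def inner_sum_right mult.commute)
    finally show ?thesis .
  qed
  then have "f = (\<lambda>h. h \<bullet> D)" by auto
  then have "GDERIV u x :> D" using f by (simp add: gderiv_def)
  moreover from this have "gradient u x = D" by (rule gradient_eqI)
  ultimately show ?thesis by (simp only: gderiv_def inner_commute[of D])
qed

lemma gradient_eq_0:
  fixes u :: "'a::euclidean_space \<Rightarrow> real"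
  assumes "x \<notin> closure {x. u x \<noteq> 0}"
  shows "gradient u x = 0"
proof (rule gradient_eqI)
  have "((\<lambda>_. 0) has_derivative (\<lambda>h. h \<bullet> 0)) (at x)" by simp
  then have "(u has_derivative (\<lambda>h. h \<bullet> 0)) (at x)"
  proof (rule has_derivative_transform_within_open)
    show "open (- closure {x. u x \<noteq> 0})" by auto
    show "0 = u y" if "y \<in> - closure {x. u x \<noteq> 0}" for y
      using that closure_subset[of "{x. u x \<noteq> 0}"] by auto
  qed (use assms in auto)
  then show "GDERIV u x :> 0" unfolding gderiv_def .
qed

lemma bounded_domain_outer_radius:
  fixes \<Omega> :: "'a::euclidean_space set"
  assumes "bounded_domain \<Omega>" "0 \<in> \<Omega>"
  shows "\<Omega> \<subseteq> ball 0 (outer_radius \<Omega>)" and "outer_radius \<Omega> > 0"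
proof -
  have op: "open \<Omega>" and "bounded \<Omega>" using assms by (auto simp: bounded_domain_def)
  then obtain B where "\<And>x. x \<in> \<Omega> \<Longrightarrow> norm x \<le> B" unfolding bounded_iff by blast
  then have bd: "bdd_above (norm ` \<Omega>)" by (rule bdd_aboveI2)
  obtain e where e: "e > 0" "ball 0 e \<subseteq> \<Omega>" using op assms(2) by (auto simp: open_contains_ball)
  show sub: "\<Omega> \<subseteq> ball 0 (outer_radius \<Omega>)"
  proof
    fix x assume x: "x \<in> \<Omega>"
    obtain r where r: "r > 0" "ball x r \<subseteq> \<Omega>" using op x by (auto simp: open_contains_ball)
    obtain i :: 'a where i: "i \<in> Basis" using nonempty_Basis by blast
    \<comment> \<open>A unit vector pointing away from the origin. Moving along it stays in the open
      set and increases the norm, so the supremum is not attained.\<close>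
    define d where "d = (if x = 0 then i else sgn x)"
    have d: "norm d = 1" using i by (simp add: d_def norm_sgn)
    define y where "y = x + (r / 2) *\<^sub>R d"
    have "y \<in> \<Omega>" using r d by (auto simp: y_def dist_norm intro!: subsetD[OF r(2)])
    have "norm y = norm x + r / 2"
    proof (cases "x = 0")
      case True
      then show ?thesis using r d by (simp add: y_def)
    next
      case False
      have "y = (norm x + r / 2) *\<^sub>R sgn x"
        using False by (simp add: y_def d_def scaleR_add_left) (simp add: sgn_div_norm)
      then show ?thesis using r False by (simp add: norm_sgn)
    qed
    moreover have "norm y \<le> outer_radius \<Omega>"
      unfolding outer_radius_def by (rule cSUP_upper[OF \<open>y \<in> \<Omega>\<close> bd])
    ultimately show "x \<in> ball 0 (outer_radius \<Omega>)" using r by simp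
  qed
  then show "outer_radius \<Omega> > 0" using assms(2) by fastforce
qed

lemma C1c_leray:
  fixes \<Omega> :: "'a::euclidean_space set"
  assumes "DIM('a) \<ge> 2" "bounded_domain \<Omega>" "0 \<in> \<Omega>" and u: "u \<in> C1c \<Omega>"
  obtains \<rho> where "leray (outer_radius \<Omega>) \<rho> u (gradient u)"
proof -
  let ?R = "outer_radius \<Omega>" and ?S = "closure {x. u x \<noteq> 0}"
  have \<Omega>: "\<Omega> \<subseteq> ball 0 ?R" "?R > 0" using bounded_domain_outer_radius[OF assms(2,3)] by auto
  have S: "compact ?S" "?S \<subseteq> \<Omega>" using u by (auto simp: C1c_def)
  obtain \<rho>0 where \<rho>0: "\<rho>0 < ?R" "\<And>x. x \<in> ?S \<Longrightarrow> norm x \<le> \<rho>0"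
  proof (cases "?S = {}")
    case True
    then show ?thesis using that[of "?R / 2"] \<Omega> by auto
  next
    case False
    obtain x0 where "x0 \<in> ?S" "\<And>x. x \<in> ?S \<Longrightarrow> norm x \<le> norm x0"
      using continuous_attains_sup[OF S(1) False, of norm] by (auto intro: continuous_intros)
    then show ?thesis using that[of "norm x0"] S \<Omega> by auto
  qed
  \<comment> \<open>Strictly between the largest norm on the support and R, so that u vanishes
    already on the sphere of radius \<rho>.\<close>
  define \<rho> where "\<rho> = (max \<rho>0 0 + ?R) / 2"
  have \<rho>: "0 < \<rho>" "\<rho> < ?R" "\<rho>0 < \<rho>" using \<rho>0 \<Omega> by (auto simp: \<rho>_def max_def)
  have "leray ?R \<rho> u (gradient u)"
  proof
    show "u x = 0" if "\<rho> \<le> norm x" for x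
      using that \<rho> \<rho>0(2)[of x] closure_subset[of "{x. u x \<noteq> 0}"] by fastforce
  qed (use assms \<rho> u gradient_has_derivative in \<open>auto simp: C1c_def\<close>)
  then show thesis by (rule that)
qed

lemma hardy_functional_eq_energy:
  fixes \<Omega> :: "(real ^ 'n) set"
  assumes L: "leray (outer_radius \<Omega>) \<rho> u (gradient u)" and u: "u \<in> C1c \<Omega>"
  shows "hardy_functional \<Omega> u = leray.energy (outer_radius \<Omega>) u (gradient u)"
proof -
  interpret leray "outer_radius \<Omega>" \<rho> u "gradient u" by (rule L)
  have S: "closure {x. u x \<noteq> 0} \<subseteq> \<Omega>" using u by (auto simp: C1c_def)
  have u0: "u x = 0" if "x \<notin> \<Omega>" for x
    using that S closure_subset[of "{x. u x \<noteq> 0}"] by auto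
  have g0: "gradient u x = 0" if "x \<notin> \<Omega>" for x
    using that S by (intro gradient_eq_0) auto
  have card: "CARD('n) = DIM(real ^ 'n)" by simp
  have "(LINT x:\<Omega>|lborel. norm (gradient u x) ^ CARD('n)) = (\<integral>x. norm (gradient u x) ^ DIM(real ^ 'n) \<partial>lborel)"
    unfolding set_lebesgue_integral_def
    by (intro Bochner_Integration.integral_cong refl) (auto simp: indicator_def g0)
  moreover have "((real CARD('n) - 1) / real CARD('n)) ^ CARD('n) *
       (LINT x:\<Omega>|lborel. \<bar>u x\<bar> ^ CARD('n) / norm x ^ CARD('n) * X1 (norm x / outer_radius \<Omega>) ^ CARD('n))
     = (\<integral>x. norm (a x) ^ DIM(real ^ 'n) \<partial>lborel)"
    unfolding set_lebesgue_integral_def integral_mult_right_zero[symmetric]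
  proof (intro Bochner_Integration.integral_cong refl)
    fix x
    show "((real CARD('n) - 1) / real CARD('n)) ^ CARD('n) *
      (indicator \<Omega> x *\<^sub>R (\<bar>u x\<bar> ^ CARD('n) / norm x ^ CARD('n) * X1 (norm x / outer_radius \<Omega>) ^ CARD('n))) =
      norm (a x) ^ DIM(real ^ 'n)"
    proof (cases "u x = 0 \<or> x = 0")
      \<comment> \<open>At the origin both sides are 0: the quotient by the default value of
        division by zero, and \<open>a\<close> because it is a multiple of x.\<close>
      case True
      then show ?thesis by (auto simp: a_def zero_power)
    next
      case False
      then have x: "x \<in> \<Omega>" "x \<noteq> 0" using u0 by auto
      have "norm x < outer_radius \<Omega>" using False supp[of x] \<rho> by (smt (verit))
      then have "norm (a x) ^ CARD('n) = (\<theta> * \<bar>u x\<bar> / (\<tau> x * norm x)) ^ CARD('n)" by (simp add: norm_a)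
      also have "\<dots> = \<theta> ^ CARD('n) * (\<bar>u x\<bar> ^ CARD('n) / norm x ^ CARD('n) * (1 / \<tau> x) ^ CARD('n))"
        by (simp add: power_divide power_mult_distrib)
      finally show ?thesis using x by (simp add: X1_eq \<theta>_def)
    qed
  qed
  ultimately show ?thesis unfolding hardy_functional_def energy_def by simp
qed

lemma leray_trudinger:
  assumes n: "CARD('n::finite) \<ge> 2"
  shows "\<exists>c::real. c > 0 \<and>
            (\<forall>\<Omega> :: (real ^ 'n) set. bounded_domain \<Omega> \<and> 0 \<in> \<Omega> \<longrightarrow>
               (\<forall>\<alpha>::real. \<alpha> < c \<longrightarrow>
                  (SUP u\<in>admissible \<Omega>. exp_mean \<alpha> (1 / real CARD('n)) \<Omega> u) < \<infinity>))"
proof -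
  let ?n = "real CARD('n)" and ?V = "vball TYPE(real ^ 'n)"
  define E where "E = 4 * (4 * ?n) ^ CARD('n)"
  define C where "C = (2 * (E + 1 + ?n * ?V) + (?V + 3 ^ CARD('n) * ?n * (2 ^ CARD('n) * E + ?n * ?V))) / ?V"
  define c where "c = 1 / (2 * (2 * C) powr (?n / (?n - 1)))"
  have E0: "E > 0" using n by (simp add: E_def)
  have "?V > 0" by (rule vball_pos)
  then have C: "C > 0" unfolding C_def using E0 n
    by (intro divide_pos_pos add_pos_nonneg mult_pos_pos add_nonneg_nonneg mult_nonneg_nonneg) auto
  then have c: "c > 0" by (simp add: c_def)
  have "(SUP u\<in>admissible \<Omega>. exp_mean \<alpha> (1 / ?n) \<Omega> u) < \<infinity>"
    if \<Omega>: "bounded_domain \<Omega>" "0 \<in> \<Omega>" and \<alpha>: "\<alpha> < c" for \<Omega> :: "(real ^ 'n) set" and \<alpha>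
  proof -
    let ?R = "outer_radius \<Omega>"
    define M where "M = 3 * ?R ^ CARD('n) * (?V + ?n * ?V * (2 * E + 1))"
    have sub: "\<Omega> \<subseteq> ball 0 ?R" by (rule bounded_domain_outer_radius[OF \<Omega>])
    have op: "open \<Omega>" using \<Omega> by (simp add: bounded_domain_def)
    have m: "emeasure lborel \<Omega> \<noteq> 0"
      using op \<Omega> open_not_negligible[OF op] by (auto simp: negligible_iff_emeasure0)
    have "exp_mean \<alpha> (1 / ?n) \<Omega> u \<le> ennreal M / emeasure lborel \<Omega>" if u: "u \<in> admissible \<Omega>" for u
    proof -
      have uc: "u \<in> C1c \<Omega>" and h: "hardy_functional \<Omega> u \<le> 1" using u by (auto simp: admissible_def)
      obtain \<rho> where L: "leray ?R \<rho> u (gradient u)"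
        by (rule C1c_leray[OF _ \<Omega> uc]) (use n in auto)
      interpret leray ?R \<rho> u "gradient u" by (rule L)
      have th: "1 / \<theta> = ?n / (?n - 1)" by (simp add: \<theta>_def)
      have pc: "potential_const E = C" by (simp add: potential_const_def C_def)
      have "energy \<le> 1" using h hardy_functional_eq_energy[OF L uc] by simp
      then have "E * energy \<le> E" using E0 by simp
      then have "remainder \<le> ennreal E"
        by (intro order_trans[OF remainder_le_energy] ennreal_leI) (simp add: E_def)
      then have *: "(\<integral>\<^sup>+x. ennreal (exp (c * (\<bar>u x\<bar> * X2 (norm x / ?R) powr (1 / DIM(real ^ 'n))) powr (1 / \<theta>))) * indicator (ball 0 ?R) x \<partial>lborel) \<le> ennreal M"
        using E0 c C nn_integral_exp_le[of E c] unfolding pc th by (simp add: c_def M_def)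
      have "(\<integral>\<^sup>+x. ennreal (exp (\<alpha> * (\<bar>u x\<bar> * X2 (norm x / ?R) powr (1 / ?n)) powr (?n / (?n - 1)))) * indicator \<Omega> x \<partial>lborel) \<le>
         (\<integral>\<^sup>+x. ennreal (exp (c * (\<bar>u x\<bar> * X2 (norm x / ?R) powr (1 / DIM(real ^ 'n))) powr (1 / \<theta>))) * indicator (ball 0 ?R) x \<partial>lborel)"
      proof (intro nn_integral_mono mult_mono ennreal_leI)
        fix x
        show "indicator \<Omega> x \<le> (indicator (ball 0 ?R) x :: ennreal)" using sub by (auto simp: indicator_def)
        \<comment> \<open>Negative values of \<alpha> are included: the power that \<alpha>
          multiplies is nonnegative, so the comparison with c holds for all of them.\<close>
        show "exp (\<alpha> * (\<bar>u x\<bar> * X2 (norm x / ?R) powr (1 / ?n)) powr (?n / (?n - 1))) \<le>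
          exp (c * (\<bar>u x\<bar> * X2 (norm x / ?R) powr (1 / DIM(real ^ 'n))) powr (1 / \<theta>))"
          unfolding th using \<alpha> by (simp add: mult_right_mono)
      qed auto
      also note *
      finally show ?thesis unfolding exp_mean_def by (rule divide_right_mono_ennreal)
    qed
    then have "(SUP u\<in>admissible \<Omega>. exp_mean \<alpha> (1 / ?n) \<Omega> u) \<le> ennreal M / emeasure lborel \<Omega>"
      by (rule SUP_least)
    also have "\<dots> < \<infinity>" using m by (simp add: ennreal_divide_eq_top_iff less_top[symmetric])
    finally show ?thesis .
  qed
  with c show ?thesis by blast
qed

section \<open>Sharpness of the exponent\<close>

text \<open>Squaring the positive part of a parabola gives a function that is continuously
  differentiable across the ends 1/2 and 3/2 of its support, which is all that \<open>C1c\<close>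
  asks of the test function. The maximum at 1 corresponds to ln \<tau> = S.\<close>

definition bump :: "real \<Rightarrow> real" where
  "bump y = (max 0 (1 - 4 * (y - 1)\<^sup>2))\<^sup>2"

definition bump' :: "real \<Rightarrow> real" where
  "bump' y = 2 * max 0 (1 - 4 * (y - 1)\<^sup>2) * (- 8 * (y - 1))"

lemma has_real_derivative_pos_part_sq: "((\<lambda>t::real. (max 0 t)\<^sup>2) has_real_derivative 2 * max 0 t) (at t)"
proof -
  consider "t < 0" | "t = 0" | "t > 0" by linarith
  then show ?thesis
  proof cases
    case 1
    have "((\<lambda>_. 0) has_real_derivative 2 * max 0 t) (at t)" using 1 by simp
    then show ?thesis
      by (rule has_field_derivative_transform_within_open[of _ _ _ "{..<0}"]) (use 1 in auto)
  next
    case 2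
    have "((\<lambda>h::real. \<bar>h\<bar>) \<longlongrightarrow> \<bar>0\<bar>) (at 0)" by (intro tendsto_intros)
    then have "((\<lambda>h::real. \<bar>h\<bar>) \<longlongrightarrow> 0) (at 0)" by simp
    then have "((\<lambda>h::real. (max 0 h)\<^sup>2 / h) \<longlongrightarrow> 0) (at 0)"
      by (rule Lim_null_comparison[rotated]) (auto intro!: always_eventually simp: max_def power2_eq_square)
    then show ?thesis using 2 by (simp add: has_field_derivative_iff)
  next
    case 3
    have "((\<lambda>t. t\<^sup>2) has_real_derivative 2 * max 0 t) (at t)" using 3 by (auto intro!: derivative_eq_intros)
    then show ?thesis
      by (rule has_field_derivative_transform_within_open[of _ _ _ "{0<..}"]) (use 3 in auto)
  qed
qed

lemma bump_deriv: "(bump has_real_derivative bump' y) (at y)"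
  unfolding bump_def bump'_def
  by (rule DERIV_chain2[OF has_real_derivative_pos_part_sq]) (auto intro!: derivative_eq_intros)

lemma bump_eq_0: assumes "y \<le> 1 / 2 \<or> 3 / 2 \<le> y" shows "bump y = 0" "bump' y = 0"
proof -
  have "(1 / 2)\<^sup>2 \<le> \<bar>y - 1\<bar>\<^sup>2" using assms by (intro power_mono) auto
  then have "1 - 4 * (y - 1)\<^sup>2 \<le> 0" by (simp add: power2_eq_square)
  then show "bump y = 0" "bump' y = 0" by (auto simp: bump_def bump'_def max_def)
qed

lemma bump_bounds: "0 \<le> bump y" "bump y \<le> 1" "\<bar>bump' y\<bar> \<le> 8"
proof -
  show "0 \<le> bump y" by (simp add: bump_def)
  have m: "0 \<le> max 0 (1 - 4 * (y - 1)\<^sup>2)" "max 0 (1 - 4 * (y - 1)\<^sup>2) \<le> 1" by auto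
  then show "bump y \<le> 1" unfolding bump_def by (intro power_le_one) auto
  show "\<bar>bump' y\<bar> \<le> 8"
  proof (cases "y \<le> 1 / 2 \<or> 3 / 2 \<le> y")
    case True
    then show ?thesis by (simp add: bump_eq_0)
  next
    case False
    then have "1 / 2 < y" "y < 3 / 2" by auto
    then have "\<bar>y - 1\<bar> \<le> 1 / 2" by linarith
    then have le: "max 0 (1 - 4 * (y - 1)\<^sup>2) * \<bar>y - 1\<bar> \<le> 1 * (1 / 2)" using m by (intro mult_mono) auto
    have "\<bar>2 * M * (- 8 * d)\<bar> = 16 * (M * \<bar>d\<bar>)" if "0 \<le> M" for M d :: real
      using that by (simp add: abs_mult)
    from this[OF m(1), of "y - 1"] show ?thesis using le unfolding bump'_def by linarith
  qed
qed

lemma bump_ge_half: assumes "1 \<le> y" "y \<le> 5 / 4" shows "1 / 2 \<le> bump y"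
proof -
  have "(y - 1)\<^sup>2 \<le> (1 / 4)\<^sup>2" using assms by (intro power_mono) auto
  then have "(y - 1)\<^sup>2 \<le> 1 / 16" by (simp add: power_divide)
  then have "3 / 4 \<le> max 0 (1 - 4 * (y - 1)\<^sup>2)" by linarith
  then have "(3 / 4)\<^sup>2 \<le> bump y" unfolding bump_def by (rule power_mono) simp
  moreover have "(1 / 2 :: real) \<le> (3 / 4)\<^sup>2" by (simp add: power2_eq_square)
  ultimately show ?thesis by linarith
qed

lemma continuous_on_bump [continuous_intros]:
  assumes "continuous_on A f"
  shows "continuous_on A (\<lambda>x. bump (f x))" "continuous_on A (\<lambda>x. bump' (f x))"
  unfolding bump_def bump'_def using assms by (auto intro!: continuous_intros)

text \<open>The parameter \<open>T\<close> carries nothing but the type of the space, which the real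
  parameters do not mention.\<close>

locale log_bump =
  fixes R S \<kappa> :: real and T :: "'a::euclidean_space itself"
  assumes dim: "DIM('a) \<ge> 2" and R: "R > 0" and S: "S \<ge> 4" and \<kappa>: "\<kappa> > 0"
begin

text \<open>In the variable \<open>s = ln \<tau>\<close> the profile \<open>v\<close> is a bump of height \<open>\<kappa> S\<^bsup>1/N\<^esup>\<close> on the interval from
  \<open>S/2\<close> to \<open>3S/2\<close>, which keeps the energy bounded while \<open>S\<close> grows.\<close>

definition "\<theta> = (real DIM('a) - 1) / real DIM('a)"
definition "\<tau> x = 1 - ln (norm x / R)" for x :: 'a
definition "r1 = R * exp (1 - exp (3 * S / 2))"
definition "r2 = R * exp (1 - exp (S / 2))"
definition "m = \<kappa> * S powr (1 / DIM('a))"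
definition "u x = (if 0 < norm x \<and> norm x < R then m * (\<tau> x powr \<theta> * bump (ln (\<tau> x) / S)) else 0)"
text \<open>A + B is the derivative of the profile with respect to \<tau>: A differentiates
  \<open>\<tau> powr \<theta>\<close> and B the bump. Divided by the norm of x they are the
  components of the fields a and b in the direction of -x.\<close>

definition "A x = m * \<theta> * \<tau> x powr (\<theta> - 1) * bump (ln (\<tau> x) / S)"
definition "B x = m / S * \<tau> x powr (\<theta> - 1) * bump' (ln (\<tau> x) / S)"
definition "G x = (if 0 < norm x \<and> norm x < R then - (((A x + B x) / (norm x)\<^sup>2) *\<^sub>R x) else 0)"

lemma m: "m > 0" using \<kappa> S by (simp add: m_def)

lemma \<theta>: "0 < \<theta>" "\<theta> < 1" "\<theta> - 1 = - (1 / DIM('a))"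
  using dim by (auto simp: \<theta>_def field_simps)

lemma r12: "0 < r1" "r1 < r2" "r2 < R"
  using R S by (auto simp: r1_def r2_def)

lemma \<tau>_ge_1: "norm x \<le> R \<Longrightarrow> \<tau> x \<ge> 1"
  using R by (cases "x = 0") (auto simp: \<tau>_def)

lemma \<tau>_gt_iff: "x \<noteq> 0 \<Longrightarrow> t < \<tau> x \<longleftrightarrow> norm x < R * exp (1 - t)"
proof -
  assume "x \<noteq> 0"
  then have "t < \<tau> x \<longleftrightarrow> ln (norm x / R) < ln (exp (1 - t))" by (auto simp: \<tau>_def)
  also have "\<dots> \<longleftrightarrow> norm x / R < exp (1 - t)" using R \<open>x \<noteq> 0\<close> by (subst ln_less_cancel_iff) auto
  finally show ?thesis using R by (simp add: field_simps)
qed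

lemma \<tau>_less_iff: "x \<noteq> 0 \<Longrightarrow> \<tau> x < t \<longleftrightarrow> R * exp (1 - t) < norm x"
proof -
  assume "x \<noteq> 0"
  then have "\<tau> x < t \<longleftrightarrow> ln (exp (1 - t)) < ln (norm x / R)" by (auto simp: \<tau>_def)
  also have "\<dots> \<longleftrightarrow> exp (1 - t) < norm x / R" using R \<open>x \<noteq> 0\<close> by (subst ln_less_cancel_iff) auto
  finally show ?thesis using R by (simp add: field_simps)
qed

lemma bump_0:
  assumes x: "0 < norm x" "norm x < R" and "\<not> (r1 < norm x \<and> norm x < r2)"
  shows "bump (ln (\<tau> x) / S) = 0" "bump' (ln (\<tau> x) / S) = 0"
proof -
  have x0: "x \<noteq> 0" and t: "\<tau> x > 0" using x \<tau>_ge_1[of x] by auto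
  have "\<not> (\<tau> x < exp (3 * S / 2) \<and> exp (S / 2) < \<tau> x)"
    using assms(3) \<tau>_less_iff[OF x0] \<tau>_gt_iff[OF x0] by (simp add: r1_def r2_def)
  then have "\<not> (ln (\<tau> x) < 3 * S / 2 \<and> S / 2 < ln (\<tau> x))"
    using t by (metis exp_less_cancel_iff exp_ln)
  then have "ln (\<tau> x) / S \<le> 1 / 2 \<or> 3 / 2 \<le> ln (\<tau> x) / S"
    using S by (auto simp: field_simps not_less)
  then show "bump (ln (\<tau> x) / S) = 0" "bump' (ln (\<tau> x) / S) = 0" by (rule bump_eq_0)+
qed

lemma u_eq_0: "\<not> (r1 < norm x \<and> norm x < r2) \<Longrightarrow> u x = 0"
  using bump_0[of x] by (auto simp: u_def)

lemma G_eq_0: "\<not> (r1 < norm x \<and> norm x < r2) \<Longrightarrow> G x = 0"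
  using bump_0[of x] by (auto simp: G_def A_def B_def)

lemma u_deriv: "(u has_derivative (\<lambda>h. G x \<bullet> h)) (at x)"
proof (cases "0 < norm x \<and> norm x < R")
  case True
  then have x0: "x \<noteq> 0" and t: "\<tau> x > 0" using \<tau>_ge_1[of x] by auto
  have 1: "(\<tau> has_derivative (\<lambda>h. - (x \<bullet> h) / (norm x)\<^sup>2)) (at x)"
    unfolding \<tau>_def by (rule has_derivative_log_norm[OF x0 R])
  have "((\<lambda>t. ln t / S) has_real_derivative 1 / \<tau> x / S) (at (\<tau> x))"
    using t S by (auto intro!: derivative_eq_intros)
  from DERIV_chain2[OF bump_deriv this]
  have "((\<lambda>t. bump (ln t / S)) has_real_derivative bump' (ln (\<tau> x) / S) * (1 / \<tau> x / S)) (at (\<tau> x))" .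
  from DERIV_cmult[OF DERIV_mult[OF has_real_derivative_powr[OF t, of \<theta>] this], of m]
  have "((\<lambda>t. m * (t powr \<theta> * bump (ln t / S))) has_real_derivative
     m * (\<theta> * \<tau> x powr (\<theta> - 1) * bump (ln (\<tau> x) / S) + bump' (ln (\<tau> x) / S) * (1 / \<tau> x / S) * \<tau> x powr \<theta>)) (at (\<tau> x))" .
  also have "m * (\<theta> * \<tau> x powr (\<theta> - 1) * bump (ln (\<tau> x) / S) + bump' (ln (\<tau> x) / S) * (1 / \<tau> x / S) * \<tau> x powr \<theta>) = A x + B x"
    using t S by (simp add: A_def B_def powr_diff field_simps)
  finally have 2: "((\<lambda>t. m * (t powr \<theta> * bump (ln t / S))) has_real_derivative A x + B x) (at (\<tau> x))" .
  have "((\<lambda>x. m * (\<tau> x powr \<theta> * bump (ln (\<tau> x) / S))) has_derivative (\<lambda>h. - (x \<bullet> h) / (norm x)\<^sup>2 * (A x + B x))) (at x)"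
    by (rule DERIV_compose_FDERIV[OF 2 1])
  then have "((\<lambda>x. m * (\<tau> x powr \<theta> * bump (ln (\<tau> x) / S))) has_derivative (\<lambda>h. G x \<bullet> h)) (at x)"
    using True by (simp add: G_def mult.commute)
  then show ?thesis
  proof (rule has_derivative_transform_within_open)
    show "open {x::'a. 0 < norm x \<and> norm x < R}" by (intro open_Collect_conj open_Collect_less continuous_intros)
  qed (use True in \<open>auto simp: u_def\<close>)
next
  case False
  then have "x = 0 \<or> norm x \<ge> R" by auto
  then have x: "x \<in> {x. norm x < r1} \<union> {x. r2 < norm x}" using r12 by auto
  have "G x = 0" using False by (auto simp: G_def)
  then have "((\<lambda>_. 0) has_derivative (\<lambda>h. G x \<bullet> h)) (at x)" by simp
  then show ?thesis
  proof (rule has_derivative_transform_within_open)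
    show "open ({x::'a. norm x < r1} \<union> {x. r2 < norm x})" by (intro open_Un open_Collect_less continuous_intros)
  qed (use x u_eq_0 in auto)
qed

lemma cont_G: "continuous_on UNIV G"
proof -
  let ?U = "{x::'a. 0 < norm x \<and> norm x < R}" and ?V = "{x::'a. norm x < r1} \<union> {x. r2 < norm x}"
  have "continuous_on ?U G"
  proof (rule continuous_on_eq)
    have nz: "\<tau> x \<noteq> 0" if "norm x < R" for x using \<tau>_ge_1[of x] that by fastforce
    have ct: "continuous_on ?U \<tau>" unfolding \<tau>_def using R by (intro continuous_intros) auto
    show "continuous_on ?U (\<lambda>x. - (((A x + B x) / (norm x)\<^sup>2) *\<^sub>R x))"
      unfolding A_def B_def using S by (intro continuous_intros ct) (auto simp: nz)
  qed (simp add: G_def)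
  moreover have "continuous_on ?V G"
    by (rule continuous_on_eq[of _ "\<lambda>_. 0"]) (auto simp: G_eq_0)
  moreover have "open ?U" "open ?V" by (intro open_Un open_Collect_conj open_Collect_less continuous_intros)+
  ultimately have "continuous_on (?U \<union> ?V) G" by (simp only: continuous_on_open_Un)
  moreover have "?U \<union> ?V = UNIV" using r12 by auto
  ultimately show ?thesis by simp
qed

lemma gradient_u: "gradient u = G"
  using u_deriv by (auto intro!: gradient_eqI simp: gderiv_def inner_commute[of "G _"])

lemma leray: "leray R r2 u G"
  by standard (use dim r12 u_deriv cont_G u_eq_0 in auto)

text \<open>The powers of S decide the height of the bump. The n-th power of the height S^(1/n)
  gives S, and two derivatives of the bump give S^(-2); the product 1/S is compensated by the shell,
  whose mass is proportional to S.\<close>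

lemma remainder_le:
  assumes x: "0 < norm x" "norm x < R"
  shows "\<bar>A x / norm x + B x / norm x\<bar> ^ DIM('a) \<le> (A x / norm x) ^ DIM('a) +
    DIM('a) * ((A x / norm x) ^ (DIM('a) - 2) * (A x / norm x * (B x / norm x))) +
    2 * (32 * \<kappa>) ^ DIM('a) / S * (1 / (\<tau> x * norm x ^ DIM('a)))"
proof -
  let ?n = "DIM('a)"
  have t: "\<tau> x \<ge> 1" using \<tau>_ge_1[of x] x by auto
  define p q where "p = A x / norm x" and "q = B x / norm x"
  \<comment> \<open>A common bound for both components: p \<le> Q, and q has an additional 1/S
    because the bump varies on the scale S of ln \<tau>. The constant 8 bounds the derivative of the
    bump.\<close>
  define Q where "Q = 8 * m * \<tau> x powr (\<theta> - 1) / norm x"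
  have Q: "Q \<ge> 0" using m x by (simp add: Q_def)
  have p: "p \<ge> 0" using m \<theta> bump_bounds x by (simp add: p_def A_def)
  have pQ: "p \<le> Q"
  proof -
    have "\<theta> * bump (ln (\<tau> x) / S) \<le> 1 * 1" using \<theta> bump_bounds by (intro mult_mono) auto
    then have "m * \<tau> x powr (\<theta> - 1) * (\<theta> * bump (ln (\<tau> x) / S)) \<le> m * \<tau> x powr (\<theta> - 1) * 8"
      using m by (intro mult_left_mono) auto
    then have "A x \<le> 8 * m * \<tau> x powr (\<theta> - 1)" by (simp add: A_def mult_ac)
    then show ?thesis unfolding p_def Q_def using x by (intro divide_right_mono) auto
  qed
  have qQ: "\<bar>q\<bar> \<le> Q / S"
  proof -
    have "m / S * \<tau> x powr (\<theta> - 1) * \<bar>bump' (ln (\<tau> x) / S)\<bar> \<le> m / S * \<tau> x powr (\<theta> - 1) * 8"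
      using m S bump_bounds by (intro mult_left_mono) auto
    then have "\<bar>B x\<bar> \<le> 8 * m * \<tau> x powr (\<theta> - 1) / S" using m S by (simp add: B_def abs_mult mult_ac)
    then have "\<bar>B x\<bar> / norm x \<le> 8 * m * \<tau> x powr (\<theta> - 1) / S / norm x" using x by (intro divide_right_mono) auto
    then show ?thesis using x by (simp add: q_def Q_def abs_divide mult.commute)
  qed
  have QN: "Q ^ ?n = (8 * \<kappa>) ^ ?n * S * (1 / (\<tau> x * norm x ^ ?n))"
  proof -
    have "(S powr (1 / ?n)) ^ ?n = S" using S by (simp add: powr_power)
    moreover have "(\<tau> x powr (\<theta> - 1)) ^ ?n = 1 / \<tau> x"
      unfolding \<theta>(3) using t by (subst powr_power) (auto simp: powr_minus_divide)
    ultimately show ?thesis by (simp add: Q_def m_def power_divide power_mult_distrib)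
  qed
  have "p ^ (?n - 2) * q\<^sup>2 \<le> Q ^ (?n - 2) * (Q / S)\<^sup>2"
  proof (rule mult_mono[OF power_mono[OF pQ p]])
    show "q\<^sup>2 \<le> (Q / S)\<^sup>2" using power_mono[OF qQ, of 2] by simp
  qed (use Q in auto)
  also have "\<dots> = Q ^ ?n / S\<^sup>2" by (simp add: power_divide power_minus2_mult[OF dim])
  finally have 1: "p ^ (?n - 2) * q\<^sup>2 \<le> Q ^ ?n / S\<^sup>2" .
  have "\<bar>q\<bar> ^ ?n \<le> (Q / S) ^ ?n" using qQ by (intro power_mono) auto
  also have "\<dots> = Q ^ ?n / S ^ ?n" by (simp add: power_divide)
  also have "\<dots> \<le> Q ^ ?n / S\<^sup>2" using Q S power_increasing[OF dim, of S] by (intro divide_left_mono) auto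
  finally have 2: "\<bar>q\<bar> ^ ?n \<le> Q ^ ?n / S\<^sup>2" .
  have "4 ^ ?n * (p ^ (?n - 2) * q\<^sup>2 + \<bar>q\<bar> ^ ?n) \<le> 4 ^ ?n * (Q ^ ?n / S\<^sup>2 + Q ^ ?n / S\<^sup>2)"
    using 1 2 by (intro mult_left_mono add_mono) auto
  also have "\<dots> = 2 * (4 ^ ?n * (8 * \<kappa>) ^ ?n) / S * (1 / (\<tau> x * norm x ^ ?n))"
    unfolding QN using S by (simp add: power2_eq_square)
  also have "4 ^ ?n * (8 * \<kappa>) ^ ?n = (32 * \<kappa>) ^ ?n" unfolding power_mult_distrib[symmetric] by simp
  finally have 3: "4 ^ ?n * (p ^ (?n - 2) * q\<^sup>2 + \<bar>q\<bar> ^ ?n) \<le> 2 * (32 * \<kappa>) ^ ?n / S * (1 / (\<tau> x * norm x ^ ?n))" .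
  have "p ^ (?n - 1) = p ^ (?n - 2) * p"
  proof -
    have "?n - 1 = Suc (?n - 2)" using dim by simp
    then show ?thesis by simp
  qed
  then have "\<bar>p + q\<bar> ^ ?n \<le> p ^ ?n + ?n * (p ^ (?n - 2) * (p * q)) + 4 ^ ?n * (p ^ (?n - 2) * q\<^sup>2 + \<bar>q\<bar> ^ ?n)"
    using add_power_le[OF dim p, of q] by (simp only: mult.assoc)
  then show ?thesis using 3 unfolding p_def q_def by linarith
qed

lemma energy_le: "leray.energy R u G \<le> 2 * (32 * \<kappa>) ^ DIM('a) * (DIM('a) * vball TYPE('a))"
proof -
  let ?V = "vball TYPE('a)"
  interpret L: leray R r2 u G by (rule leray)
  let ?n = "DIM('a)" and ?C = "2 * (32 * \<kappa>) ^ DIM('a)"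
  let ?D = "\<lambda>x. norm (L.a x + L.b x) ^ ?n - norm (L.a x) ^ ?n - ?n * L.cross x"
  have teq: "L.\<tau> x = \<tau> x" "L.\<theta> = \<theta>" for x by (simp_all add: L.\<tau>_def \<tau>_def L.\<theta>_def \<theta>_def)
  have C: "?C \<ge> 0" using \<kappa> by simp
  have pt: "?D x \<le> ?C / S * (1 / ((1 - ln (norm x / R)) * norm x ^ ?n)) * indicator {x. r1 < norm x \<and> norm x < r2} x" for x
  proof (cases "r1 < norm x \<and> norm x < r2")
    case True
    then have x: "0 < norm x" "norm x < R" using r12 by auto
    have t: "\<tau> x \<ge> 1" using \<tau>_ge_1[of x] x by auto
    \<comment> \<open>All vectors are multiples of this one unit vector, along which the norms and
      inner products become the scalar expressions of \<open>remainder_le\<close>.\<close>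
    define e where "e = - sgn x"
    have e: "norm e = 1" "e \<bullet> e = 1" using x by (auto simp: e_def norm_sgn dot_square_norm)
    have xe: "x = - norm x *\<^sub>R e" using x by (simp add: e_def sgn_div_norm)
    have p: "A x / norm x \<ge> 0" using m \<theta> bump_bounds x by (simp add: A_def)
    have ax: "L.a x = (A x / norm x) *\<^sub>R e"
    proof -
      have "\<theta> * u x / (\<tau> x * (norm x)\<^sup>2) = A x / (norm x)\<^sup>2"
        using x t by (simp add: u_def A_def powr_diff)
      then have "L.a x = - ((A x / (norm x)\<^sup>2) *\<^sub>R x)" by (simp add: L.a_def teq)
      also have "\<dots> = (A x / norm x) *\<^sub>R e"
        by (subst (2) xe) (use x in \<open>simp add: power2_eq_square\<close>)
      finally show ?thesis .
    qed
    have Gx: "G x = ((A x + B x) / norm x) *\<^sub>R e"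
    proof -
      have "G x = - (((A x + B x) / (norm x)\<^sup>2) *\<^sub>R x)" using x by (simp add: G_def)
      also have "\<dots> = ((A x + B x) / norm x) *\<^sub>R e"
        by (subst (4) xe) (use x in \<open>simp add: power2_eq_square\<close>)
      finally show ?thesis .
    qed
    have bx: "L.b x = (B x / norm x) *\<^sub>R e"
      by (simp add: L.b_def ax Gx add_divide_distrib scaleR_add_left)
    have "?D x = \<bar>A x / norm x + B x / norm x\<bar> ^ ?n - (A x / norm x) ^ ?n -
       ?n * ((A x / norm x) ^ (?n - 2) * (A x / norm x * (B x / norm x)))"
      using p by (simp only: L.cross_def ax bx scaleR_add_left[symmetric] norm_scaleR e mult_1_right abs_of_nonneg inner_scaleR_left inner_scaleR_right mult.commute[of "B x / norm x"])
    also have "\<dots> \<le> ?C / S * (1 / (\<tau> x * norm x ^ ?n))"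
      using remainder_le[OF x] by linarith
    finally show ?thesis using True by (simp add: \<tau>_def)
  next
    case False
    then have "L.a x = 0" "G x = 0" by (auto simp: L.a_def u_eq_0 G_eq_0)
    then show ?thesis using False by (simp add: L.b_def L.cross_def)
  qed
  have "(\<integral>\<^sup>+x. ennreal (?D x) \<partial>lborel) \<le>
     (\<integral>\<^sup>+x. ennreal (?C / S) * (ennreal (1 / ((1 - ln (norm x / R)) * norm x ^ ?n)) * indicator {x. r1 < norm x \<and> norm x < r2} x) \<partial>(lborel :: 'a measure))" (is "nn_integral _ ?lhs \<le> nn_integral _ ?rhs")
  proof (rule nn_integral_mono)
    fix x :: 'a
    have "ennreal (?D x) \<le> ennreal (?C / S * (1 / ((1 - ln (norm x / R)) * norm x ^ ?n)) * indicator {x. r1 < norm x \<and> norm x < r2} x)"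
      by (intro ennreal_leI pt)
    also have "\<dots> = ennreal (?C / S) * (ennreal (1 / ((1 - ln (norm x / R)) * norm x ^ ?n)) * indicator {x. r1 < norm x \<and> norm x < r2} x)"
      using C S by (auto simp: indicator_def ennreal_mult'[symmetric])
    finally show "?lhs x \<le> ?rhs x" .
  qed
  also have "\<dots> = ennreal (?C / S) * ennreal (?n * ?V * (ln (1 - ln (r1 / R)) - ln (1 - ln (r2 / R))))"
    using r12 by (subst nn_integral_cmult) (auto simp: nn_integral_log_shell)
  \<comment> \<open>The radii r1 and r2 are those where ln \<tau> is 3S/2 and S/2, so the length is
    S and cancels the factor 1/S.\<close>
  also have "ln (1 - ln (r1 / R)) - ln (1 - ln (r2 / R)) = S"
    using R by (simp add: r1_def r2_def)
  also have "ennreal (?C / S) * ennreal (?n * ?V * S) = ennreal (?C * (?n * ?V))"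
    using C S by (simp add: ennreal_mult''[symmetric])
  finally have "(\<integral>x. ?D x \<partial>lborel) \<le> ?C * (?n * ?V)"
    using C by (intro integral_real_bounded) auto
  then show ?thesis using has_bochner_integral_integral_eq[OF L.energy_eq] by simp
qed

text \<open>On this shell exp S < \<tau> < exp S + 1, so ln \<tau> exceeds S by at most 1/4: the
  bump is still near its top and the weight \<open>X2\<close> is no smaller than a multiple of
  1/S.\<close>

lemma u_lower:
  assumes x: "R * exp (- exp S) < norm x" "norm x < R * exp (1 - exp S)"
  shows "\<kappa> / 2 * (S powr (1 / DIM('a)) * exp S powr \<theta>) \<le> u x" "\<tau> x \<ge> 1" "1 + ln (\<tau> x) \<le> 2 * S"
proof -
  have T4: "exp S \<ge> 4" using S exp_ge_add_one_self[of S] by linarith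
  have nx: "norm x > 0" using x(1) R by (smt (verit) exp_gt_zero mult_pos_pos)
  then have x0: "x \<noteq> 0" by auto
  have xR: "norm x < R"
  proof -
    have "R * exp (1 - exp S) \<le> R * 1" using R T4 S by (intro mult_left_mono) auto
    then show ?thesis using x by simp
  qed
  have t: "exp S < \<tau> x" "\<tau> x < exp S + 1"
    using \<tau>_gt_iff[OF x0, of "exp S"] \<tau>_less_iff[OF x0, of "exp S + 1"] x by auto
  show t1: "\<tau> x \<ge> 1" using t T4 by simp
  have l1: "S < ln (\<tau> x)" using t t1 by (metis exp_gt_zero ln_exp ln_less_cancel_iff less_le_trans zero_less_one)
  have "ln (\<tau> x) \<le> ln (exp S * (1 + 1 / exp S))"
    using t t1 by (subst ln_le_cancel_iff) (auto simp: distrib_left)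
  also have "\<dots> = S + ln (1 + 1 / exp S)" by (subst ln_mult_pos) (auto simp: add_pos_pos)
  also have "ln (1 + 1 / exp S) \<le> 1 / exp S" by (rule ln_add_one_self_le_self) simp
  also have "1 / exp S \<le> 1 / 4" using T4 by (intro divide_left_mono) auto
  finally have l2: "ln (\<tau> x) \<le> S + 1 / 4" by simp
  then show "1 + ln (\<tau> x) \<le> 2 * S" using S by simp
  have "1 \<le> ln (\<tau> x) / S" "ln (\<tau> x) / S \<le> 5 / 4" using l1 l2 S by (auto simp: field_simps)
  then have b: "1 / 2 \<le> bump (ln (\<tau> x) / S)" by (rule bump_ge_half)
  have "exp S powr \<theta> * (1 / 2) \<le> \<tau> x powr \<theta> * bump (ln (\<tau> x) / S)"
    using t \<theta> b by (intro mult_mono powr_mono2) auto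
  then have "m * (exp S powr \<theta> * (1 / 2)) \<le> u x"
    using m nx xR by (simp add: u_def mult_left_mono)
  then show "\<kappa> / 2 * (S powr (1 / DIM('a)) * exp S powr \<theta>) \<le> u x" by (simp add: m_def mult_ac)
qed

end

text \<open>On the shell where \<tau> is about T = exp S, the test function times the weight has
  size S^\<delta> T^\<theta> with \<delta> > 0 the deficit in the exponent. Its power 1/\<theta> is
  S^(\<delta>/\<theta>) T, which for large S exceeds every multiple of T, while the volume of the
  shell is of order exp (-n T).\<close>

lemma leray_trudinger_sharp:
  fixes \<Omega> :: "(real ^ 'n::finite) set"
  assumes n2: "CARD('n) \<ge> 2" and \<Omega>: "bounded_domain \<Omega>" "0 \<in> \<Omega>"
    and \<beta>: "\<beta> < 1 / real CARD('n)" and \<alpha>: "\<alpha> > 0"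
  shows "(SUP u\<in>admissible \<Omega>. exp_mean \<alpha> \<beta> \<Omega> u) = \<infinity>"
proof -
  let ?n = "real CARD('n)" and ?V = "vball TYPE(real ^ 'n)" and ?R = "outer_radius \<Omega>"
  have R: "?R > 0" by (rule bounded_domain_outer_radius[OF \<Omega>])
  have op: "open \<Omega>" and bd: "bounded \<Omega>" using \<Omega> by (auto simp: bounded_domain_def)
  obtain e where e: "e > 0" "ball 0 e \<subseteq> \<Omega>" using op \<Omega>(2) by (auto simp: open_contains_ball)
  have V: "?V > 0" by (rule vball_pos)
  define \<theta> where "\<theta> = (?n - 1) / ?n"
  have \<theta>: "0 < \<theta>" "1 / \<theta> = ?n / (?n - 1)" using n2 by (auto simp: \<theta>_def)
  define X where "X = 2 * 32 ^ CARD('n) * (?n * ?V)"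
  have X: "X \<ge> 0" using V by (simp add: X_def)
  \<comment> \<open>Normalises the energy to at most 1. Since \<kappa> \<le> 1, its n-th power is at
    most \<kappa>, so no root has to be taken.\<close>
  define \<kappa> where "\<kappa> = 1 / (X + 1)"
  have \<kappa>: "\<kappa> > 0" "\<kappa> \<le> 1" using X by (auto simp: \<kappa>_def)
  have \<kappa>X: "2 * (32 * \<kappa>) ^ CARD('n) * (?n * ?V) \<le> 1"
  proof -
    have "\<kappa> ^ CARD('n) \<le> \<kappa> ^ 1" using \<kappa> n2 by (intro power_decreasing) auto
    then have "X * \<kappa> ^ CARD('n) \<le> X * \<kappa>" using X by (intro mult_left_mono) auto
    also have "\<dots> \<le> 1" using X by (simp add: \<kappa>_def)
    finally show ?thesis by (simp add: X_def power_mult_distrib mult_ac)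
  qed
  \<comment> \<open>Negative \<beta> reduces to \<beta> = 0: the weight is at most 1, so lowering
    the exponent only increases its power.\<close>
  define \<beta>' where "\<beta>' = max \<beta> 0"
  have \<beta>': "0 \<le> \<beta>'" "\<beta> \<le> \<beta>'" "\<beta>' < 1 / ?n" using \<beta> n2 by (auto simp: \<beta>'_def)
  have "1 / ?n \<le> 1" using n2 by simp
  then have \<beta>'1: "\<beta>' \<le> 1" using \<beta>' by linarith
  define \<delta> where "\<delta> = 1 / ?n - \<beta>'"
  have \<delta>: "\<delta> > 0" using \<beta>' by (simp add: \<delta>_def)
  \<comment> \<open>Makes the exponent on the shell at least (n + 1) T once S^(\<delta>/\<theta>)
    \<ge> M.\<close>
  define M where "M = (?n + 1) / (\<alpha> * (\<kappa> / 4) powr (1 / \<theta>))"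
  have M: "M > 0" using \<alpha> \<kappa> by (simp add: M_def add_pos_pos)
  \<comment> \<open>The three bounds serve \<open>log_bump\<close>, the inclusion of the support in
    a ball inside the domain, and the size M of the exponent.\<close>
  define S0 where "S0 = max 4 (max (2 * (1 - ln (e / ?R))) (M powr (\<theta> / \<delta>)))"
  have ex: "\<exists>u\<in>admissible \<Omega>. ennreal (S * ?R ^ CARD('n) * (?n * ?V)) / emeasure lborel \<Omega> \<le> exp_mean \<alpha> \<beta> \<Omega> u"
    if S: "S \<ge> S0" for S
  proof -
    have S4: "S \<ge> 4" and Se: "S \<ge> 2 * (1 - ln (e / ?R))" and SM: "S \<ge> M powr (\<theta> / \<delta>)"
      using S by (auto simp: S0_def)
    interpret B: log_bump ?R S \<kappa> "TYPE(real ^ 'n)"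
      by standard (use n2 R S4 \<kappa> in auto)
    have r2e: "B.r2 < e"
    proof -
      have gen: "1 - E < l" if "1 + s / 2 \<le> E" "2 * (1 - l) \<le> s" for E l s :: real
        using that by (simp add: field_simps)
      have "1 - exp (S / 2) < ln (e / ?R)" by (rule gen[OF exp_ge_add_one_self Se])
      then have "exp (1 - exp (S / 2)) < e / ?R" using e R by (metis divide_pos_pos exp_less_mono exp_ln)
      then show ?thesis using R by (simp add: B.r2_def field_simps)
    qed
    have cl: "closure {x. B.u x \<noteq> 0} \<subseteq> cball 0 B.r2"
      by (rule closure_minimal) (use B.u_eq_0 in force)+
    have uc: "B.u \<in> C1c \<Omega>"
      unfolding C1c_def
    proof (intro CollectI conjI allI)
      show "B.u differentiable (at x)" for x using B.u_deriv by (auto simp: differentiable_def)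
      show "continuous_on UNIV (gradient B.u)" using B.cont_G by (simp add: B.gradient_u)
      show "compact (closure {x. B.u x \<noteq> 0})"
        using cl bounded_subset[OF bounded_cball] by (auto simp: compact_eq_bounded_closed)
      show "closure {x. B.u x \<noteq> 0} \<subseteq> \<Omega>" using cl r2e e by force
    qed
    have "hardy_functional \<Omega> B.u = leray.energy ?R B.u B.G"
      using hardy_functional_eq_energy[OF _ uc] B.leray by (simp add: B.gradient_u)
    also have "\<dots> \<le> 1" using B.energy_le \<kappa>X by simp
    finally have adm: "B.u \<in> admissible \<Omega>" using uc by (simp add: admissible_def)
    define T where "T = exp S"
    have T: "S \<le> T" "T > 0" using exp_ge_add_one_self[of S] unfolding T_def by (linarith, simp)
    let ?W = "{x :: real ^ 'n. ?R * exp (- T) < norm x \<and> norm x < ?R * exp (1 - T)}"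
    have W: "?R * exp (1 - T) \<le> B.r2"
      unfolding B.r2_def T_def using R S4 by (intro mult_left_mono) auto
    have pt: "S * ?R ^ CARD('n) * (1 / norm x ^ CARD('n)) \<le>
        exp (\<alpha> * (\<bar>B.u x\<bar> * X2 (norm x / ?R) powr \<beta>) powr (?n / (?n - 1)))"
      if x: "?R * exp (- T) < norm x" "norm x < ?R * exp (1 - T)" for x :: "real ^ 'n"
    proof -
      have nx: "norm x > 0" using x(1) R by (smt (verit) exp_gt_zero mult_pos_pos)
      have u: "\<kappa> / 2 * (S powr (1 / ?n) * T powr \<theta>) \<le> B.u x" and t: "B.\<tau> x \<ge> 1" "1 + ln (B.\<tau> x) \<le> 2 * S"
        using B.u_lower[of x] x by (simp_all add: T_def \<theta>_def B.\<theta>_def)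
      have X2: "X2 (norm x / ?R) = 1 / (1 + ln (B.\<tau> x))"
      proof -
        have "X1 (norm x / ?R) = 1 / B.\<tau> x" using nx R by (simp add: X1_def B.\<tau>_def)
        then show ?thesis using t by (simp add: X2_def) (simp add: X1_def ln_div)
      qed
      define Y where "Y = X2 (norm x / ?R)"
      have Y: "0 < Y" "Y \<le> 1" "1 / (2 * S) \<le> Y"
      proof -
        have gen: "0 < 1 / (1 + l)" "1 / (1 + l) \<le> 1" "1 / (2 * S) \<le> 1 / (1 + l)"
          if "0 \<le> l" "1 + l \<le> 2 * S" for l
          using that by (simp_all add: frac_le)
        show "0 < Y" "Y \<le> 1" "1 / (2 * S) \<le> Y"
          unfolding Y_def X2 by (rule gen[OF ln_ge_zero[OF t(1)] t(2)])+
      qed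
      have "1 / 2 * S powr - \<beta>' \<le> (1 / (2 * S)) powr \<beta>'"
      proof -
        have "2 powr \<beta>' \<le> 2 powr 1" using \<beta>'1 by (intro powr_mono) auto
        then have "1 / 2 \<le> 1 / 2 powr \<beta>'" by (intro divide_left_mono) auto
        then have "1 / 2 * S powr - \<beta>' \<le> 1 / 2 powr \<beta>' * S powr - \<beta>'" by (intro mult_right_mono) auto
        also have "\<dots> = (1 / (2 * S)) powr \<beta>'" using S4 by (simp add: powr_divide powr_mult powr_minus_divide)
        finally show ?thesis .
      qed
      also have "\<dots> \<le> Y powr \<beta>'" using Y \<beta>' S4 by (intro powr_mono2) auto
      also have "\<dots> \<le> Y powr \<beta>" using Y \<beta>' by (intro powr_mono') auto
      finally have Yb: "1 / 2 * S powr - \<beta>' \<le> Y powr \<beta>" .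
      have pS: "S powr (1 / ?n) * S powr - \<beta>' = S powr \<delta>"
        unfolding \<delta>_def diff_conv_add_uminus by (rule powr_add[symmetric])
      have "\<kappa> / 4 * S powr \<delta> * T powr \<theta> = \<kappa> / 2 * (S powr (1 / ?n) * T powr \<theta>) * (1 / 2 * S powr - \<beta>')"
        unfolding pS[symmetric] by simp
      also have "\<dots> \<le> \<bar>B.u x\<bar> * Y powr \<beta>"
        using u Yb \<kappa> by (intro mult_mono) auto
      finally have "(\<kappa> / 4 * S powr \<delta> * T powr \<theta>) powr (1 / \<theta>) \<le> (\<bar>B.u x\<bar> * Y powr \<beta>) powr (1 / \<theta>)"
        by (rule powr_mono2[rotated 2]) (use \<kappa> \<theta>(1) in auto)
      moreover have "(\<kappa> / 4 * S powr \<delta> * T powr \<theta>) powr (1 / \<theta>) = (\<kappa> / 4) powr (1 / \<theta>) * S powr (\<delta> / \<theta>) * T"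
      proof -
        have gen: "(p * q * r) powr c = p powr c * q powr c * r powr c" if "0 \<le> p" "0 \<le> q" "0 \<le> r" for p q r c :: real
          using that by (simp add: powr_mult)
        have "(\<kappa> / 4 * S powr \<delta> * T powr \<theta>) powr (1 / \<theta>) = (\<kappa> / 4) powr (1 / \<theta>) * (S powr \<delta>) powr (1 / \<theta>) * (T powr \<theta>) powr (1 / \<theta>)"
          by (rule gen) (use \<kappa> in auto)
        then show ?thesis using \<theta>(1) T(2) by (simp add: powr_powr)
      qed
      moreover have "M \<le> S powr (\<delta> / \<theta>)"
      proof -
        have "M = (M powr (\<theta> / \<delta>)) powr (\<delta> / \<theta>)" using M \<theta>(1) \<delta> by (simp add: powr_powr)
        also have "\<dots> \<le> S powr (\<delta> / \<theta>)" using SM \<delta> \<theta>(1) by (intro powr_mono2) auto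
        finally show ?thesis .
      qed
      then have "(\<kappa> / 4) powr (1 / \<theta>) * M * T \<le> (\<kappa> / 4) powr (1 / \<theta>) * S powr (\<delta> / \<theta>) * T"
        using T by (intro mult_right_mono mult_left_mono) auto
      ultimately have "\<alpha> * ((\<kappa> / 4) powr (1 / \<theta>) * M * T) \<le> \<alpha> * (\<bar>B.u x\<bar> * Y powr \<beta>) powr (1 / \<theta>)"
        using \<alpha> by (intro mult_left_mono) auto
      moreover have "\<alpha> * ((\<kappa> / 4) powr (1 / \<theta>) * M * T) = (?n + 1) * T"
        using \<alpha> \<kappa> by (simp add: M_def)
      ultimately have big: "(?n + 1) * T \<le> \<alpha> * (\<bar>B.u x\<bar> * Y powr \<beta>) powr (1 / \<theta>)" by simp
      have "(?R * exp (- T)) ^ CARD('n) \<le> norm x ^ CARD('n)" using x R by (intro power_mono) auto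
      then have "?R ^ CARD('n) \<le> norm x ^ CARD('n) * exp (?n * T)"
        by (simp add: power_mult_distrib exp_of_nat_mult[symmetric] exp_minus field_simps)
      then have "?R ^ CARD('n) * (1 / norm x ^ CARD('n)) \<le> exp (?n * T)"
        using nx by (simp add: divide_le_eq mult.commute)
      \<comment> \<open>Of the exponent (n + 1) T, the part n T pays for (R/|x|)^n and the remaining
        T for the growing factor S.\<close>
      moreover have "S \<le> exp T" using T exp_ge_add_one_self[of T] by linarith
      ultimately have "S * (?R ^ CARD('n) * (1 / norm x ^ CARD('n))) \<le> exp T * exp (?n * T)"
        using S4 R nx by (intro mult_mono) auto
      also have "\<dots> = exp ((?n + 1) * T)" by (simp add: exp_add[symmetric] algebra_simps)
      also have "\<dots> \<le> exp (\<alpha> * (\<bar>B.u x\<bar> * Y powr \<beta>) powr (1 / \<theta>))" using big by simp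
      finally show ?thesis unfolding Y_def \<theta>(2) by (simp add: mult.assoc)
    qed
    \<comment> \<open>The radii of the shell have ratio e, so the integral of |x|^(-n) over it does
      not depend on S, and the factor S survives.\<close>
    have "ennreal (S * ?R ^ CARD('n) * (?n * ?V)) = ennreal (S * ?R ^ CARD('n)) * ennreal (DIM(real ^ 'n) * ?V * ln ((?R * exp (1 - T)) / (?R * exp (- T))))"
    proof -
      have "(?R * exp (1 - T)) / (?R * exp (- T)) = exp 1" using R by (simp add: exp_diff exp_minus field_simps)
      then show ?thesis using R S4 by (simp add: ennreal_mult[symmetric] del: exp_ge_zero)
    qed
    also have "\<dots> = ennreal (S * ?R ^ CARD('n)) * (\<integral>\<^sup>+x. ennreal (1 / norm x ^ DIM(real ^ 'n)) * indicator ?W x \<partial>lborel)"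
      using R by (subst nn_integral_inverse_norm_shell) auto
    also have "\<dots> = (\<integral>\<^sup>+x. ennreal (S * ?R ^ CARD('n)) * (ennreal (1 / norm x ^ DIM(real ^ 'n)) * indicator ?W x) \<partial>lborel)"
      by (rule nn_integral_cmult[symmetric]) measurable
    also have "\<dots> \<le> (\<integral>\<^sup>+x. ennreal (exp (\<alpha> * (\<bar>B.u x\<bar> * X2 (norm x / ?R) powr \<beta>) powr (?n / (?n - 1)))) * indicator \<Omega> x \<partial>lborel)" (is "_ \<le> nn_integral _ ?rhs")
    proof (rule nn_integral_mono)
      fix x :: "real ^ 'n"
      show "ennreal (S * ?R ^ CARD('n)) * (ennreal (1 / norm x ^ DIM(real ^ 'n)) * indicator ?W x) \<le> ?rhs x"
      proof (cases "x \<in> ?W")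
        case True
        then have "x \<in> \<Omega>" using W r2e e by auto
        moreover have "ennreal (S * ?R ^ CARD('n)) * ennreal (1 / norm x ^ DIM(real ^ 'n)) \<le>
          ennreal (exp (\<alpha> * (\<bar>B.u x\<bar> * X2 (norm x / ?R) powr \<beta>) powr (?n / (?n - 1))))"
          using pt[of x] True S4 R by (simp add: ennreal_mult'[symmetric] ennreal_leI)
        ultimately show ?thesis using True by simp
      qed simp
    qed
    finally have "ennreal (S * ?R ^ CARD('n) * (?n * ?V)) / emeasure lborel \<Omega> \<le> exp_mean \<alpha> \<beta> \<Omega> B.u"
      unfolding exp_mean_def by (rule divide_right_mono_ennreal)
    then show ?thesis using adm by blast
  qed
  show ?thesis
  proof (rule ccontr)
    assume "(SUP u\<in>admissible \<Omega>. exp_mean \<alpha> \<beta> \<Omega> u) \<noteq> \<infinity>"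
    then have fin: "(SUP u\<in>admissible \<Omega>. exp_mean \<alpha> \<beta> \<Omega> u) < top"
      by (simp only: infinity_ennreal_def less_top not_False_eq_True)
    have m: "emeasure lborel \<Omega> \<noteq> 0" "emeasure lborel \<Omega> < top"
      using op \<Omega> open_not_negligible[OF op] emeasure_bounded_finite[OF bd]
      by (auto simp: negligible_iff_emeasure0 less_top)
    define c where "c = ?R ^ CARD('n) * (?n * ?V)"
    have c: "c > 0" unfolding c_def using R V n2 by (intro mult_pos_pos zero_less_power) auto
    have "(SUP u\<in>admissible \<Omega>. exp_mean \<alpha> \<beta> \<Omega> u) * emeasure lborel \<Omega> < top"
      using fin m by (simp add: ennreal_mult_less_top)
    then obtain q where q: "(SUP u\<in>admissible \<Omega>. exp_mean \<alpha> \<beta> \<Omega> u) * emeasure lborel \<Omega> = ennreal q" "q \<ge> 0"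
      by (cases "(SUP u\<in>admissible \<Omega>. exp_mean \<alpha> \<beta> \<Omega> u) * emeasure lborel \<Omega>") auto
    define S where "S = max S0 ((q + 1) / c)"
    obtain u where u: "u \<in> admissible \<Omega>" "ennreal (S * ?R ^ CARD('n) * (?n * ?V)) / emeasure lborel \<Omega> \<le> exp_mean \<alpha> \<beta> \<Omega> u"
      using ex[of S] by (auto simp: S_def)
    have "q + 1 \<le> S * c" using c by (simp add: S_def max_def field_simps)
    then have "ennreal (q + 1) \<le> ennreal (S * ?R ^ CARD('n) * (?n * ?V))" unfolding c_def by (intro ennreal_leI) (simp add: mult.assoc)
    also have "\<dots> = ennreal (S * ?R ^ CARD('n) * (?n * ?V)) / emeasure lborel \<Omega> * emeasure lborel \<Omega>"
      using m by (simp add: ennreal_divide_times ennreal_mult_divide_eq less_top[symmetric])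
    also have "\<dots> \<le> (SUP u\<in>admissible \<Omega>. exp_mean \<alpha> \<beta> \<Omega> u) * emeasure lborel \<Omega>"
      by (intro mult_right_mono order_trans[OF u(2)] SUP_upper u(1)) auto
    also note q(1)
    finally show False using q(2) by (simp add: ennreal_le_iff)
  qed
qed

theorem theorem1p1:
  assumes "CARD('n::finite) \<ge> 2"
  shows "(\<exists>c::real. c > 0 \<and>
            (\<forall>\<Omega> :: (real ^ 'n) set. bounded_domain \<Omega> \<and> 0 \<in> \<Omega> \<longrightarrow>
               (\<forall>\<alpha>::real. \<alpha> < c \<longrightarrow>
                  (SUP u\<in>admissible \<Omega>. exp_mean \<alpha> (1 / real CARD('n)) \<Omega> u) < \<infinity>))) \<and>
         (\<forall>\<Omega> :: (real ^ 'n) set. bounded_domain \<Omega> \<and> 0 \<in> \<Omega> \<longrightarrow>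
            (\<forall>\<beta>::real. \<forall>\<alpha>::real. \<beta> < 1 / real CARD('n) \<longrightarrow> \<alpha> > 0 \<longrightarrow>
               (SUP u\<in>admissible \<Omega>. exp_mean \<alpha> \<beta> \<Omega> u) = \<infinity>))"
  using leray_trudinger[OF assms] leray_trudinger_sharp[OF assms] by blast

end
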